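(* Let $X=IG_\omega(m,\mathbb{C}^N)$ be a Grassmannian of type $B$, $C$, or $D$, and let $T\preceq P$ be Schubert symbols in $\Omega(X)$. Then the projected Richardson variety $\psi(\pi^{-1}(Y_{P,T}))$ is contained in $Z_{P,T}$.
   Context: Setting. Let $N\ge 2$, and let $\omega$ be a nondegenerate bilinear form on $\mathbb{C}^N$, symmetric or skew-symmetric, with a fixed basis $\mathbf e_1,\dots,\mathbf e_N$ such that $\omega(\mathbf e_i,\mathbf e_j)=\delta_{i+j,N+1}$ for $i\le j$. For a positive integer $m\le N/2$, $X=IG_\omega(m,\mathbb{C}^N)$ is the projective variety of $m$-dimensional subspaces $\Sigma\subset\mathbb{C}^N$ that are isotropic ($\omega|_{\Sigma\times\Sigma}=0$). Type $C$: $\omega$ skew-symmetric, $N=2n$. Type $B$: $\omega$ symmetric, $N=2n+1$. Type $D$: $\omega$ symmetric, $N=2n+2$. $[a,b]$ denotes an integer interval. Schubert symbols. A Schubert symbol is a subset $P=\{p_1<\dots<p_m\}\subset[1,N]$ of cardinality $m$ with $c+d\ne N+1$ for all $c,d\in P$ (including $c=d$). $\Omega(X)$ is the set of all of them. Convention: $p_0=0$, $p_{m+1}=N+1$ (not elements of $P$). Put $\bar P=\{c: N+1-c\in P\}$, $[P]=P\cup\bar P$. $X_P$ is the closure in $X$ of $\{\Sigma\in X:\ \{c:\Sigma\cap\langle\mathbf e_1,\dots,\mathbf e_c\rangle\supsetneq\Sigma\cap\langle\mathbf e_1,\dots,\mathbf e_{c-1}\rangle\}=P\}$; the opposite Schubert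 variety $X^T$ is the closure of $\{\Sigma\in X:\ \{c:\Sigma\cap\langle\mathbf e_c,\dots,\mathbf e_N\rangle\supsetneq\Sigma\cap\langle\mathbf e_{c+1},\dots,\mathbf e_N\rangle\}=T\}$. $T\preceq P$ means $X_T\subset X_P$; $T\le P$ means $t_i\le p_i$ for all $i$ (and $T\preceq P$ implies $T\le P$). $Y_{P,T}=X_P\cap X^T$ is the Richardson variety. In type $D$, $\mathfrak t(P)\in\{0,1,2\}$: if $n+1\in[P]$, $\mathfrak t(P)\in\{0,1\}$ is the parity of $\#([1,n+1]\setminus P)$; otherwise $\mathfrak t(P)=2$. Projections. $IF=\{(L,\Sigma): L\subset\Sigma,\ \dim L=1,\ \Sigma\in X\}$, $\pi(L,\Sigma)=\Sigma\in X$, $\psi(L,\Sigma)=L\in\mathbb{P}^{N-1}$. So $\psi(\pi^{-1}(Y_{P,T}))$ is the set of lines contained in some $\Sigma\in Y_{P,T}$. Cuts. Let $T\le P$. A visible cut is $c\in[0,N]$ with $p_i\le c<t_{i+1}$ for some $i\in[0,m]$. An apparent cut is $c\in[0,N]$ such that $c$ or $N-c$ is a visible cut. In types $B,C$ the cuts are the apparent cuts. In type $D$ the cuts are the apparent cuts together with the exceptional cuts: (1) $n+1$ is a cut if for some $i\in[1,m]$ either $p_i=n+2\le t_{i+1}$ or $t_i=n+1\ge p_{i-1}$; (2) if $\mathfrak t(T)\ne\mathfrak t(P)$, then for each $c\in[1,n]$ with $[c+1,n+1]\subset[P]\cap[T]$ and $\#(T\cap[1,c])=\#(P\cap[1,c])+1$,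 both $c$ and $N-c$ are cuts. $\mathcal C_{P,T}$ is the set of cuts. Equations. $c$ is a zero column if $p_j<c<t_{j+1}$ for some $j\in[0,m]$. Column $c$ contains a lone star if ($c\in T$ and $c\in\mathcal C_{P,T}$) or ($c\in P$ and $c-1\in\mathcal C_{P,T}$). $\mathcal L_{P,T}$ is the set of $c\in[1,N]$ such that $c$ is a zero column or column $N+1-c$ contains a lone star. $\mathcal Q_{P,T}=[0,n]\cap\mathcal C_{P,T}$ in type $C$, and $\mathcal Q_{P,T}=([0,n]\cap\mathcal C_{P,T})\cup\{n+1\}$ in types $B,D$. Let $x_1,\dots,x_N$ be the coordinates dual to $\mathbf e_1,\dots,\mathbf e_N$; $f_0=0$, $f_c=\sum_{i=1}^c x_ix_{N+1-i}$ for $1\le c\le n$; in type $B$, $f_{n+1}=\sum_{i=1}^n x_ix_{N+1-i}+\frac12x_{n+1}^2$; in type $D$, $f_{n+1}=\sum_{i=1}^{n+1}x_ix_{N+1-i}$. $Z_{P,T}\subset\mathbb{P}^{N-1}$ is the zero locus of $\{f_c: c\in\mathcal Q_{P,T}\}\cup\{x_c: c\in\mathcal L_{P,T}\}$. *)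

theory Defs
  imports "HOL-Analysis.Analysis"
begin

datatype lie_type = TypeB | TypeC | TypeD

fun ambient_dim :: "lie_type \<Rightarrow> nat \<Rightarrow> nat" where
  "ambient_dim TypeB n = 2 * n + 1"
| "ambient_dim TypeC n = 2 * n"
| "ambient_dim TypeD n = 2 * n + 2"

definition schubert_symbols :: "nat \<Rightarrow> nat \<Rightarrow> nat set set" where
  "schubert_symbols N m =
     {P. P \<subseteq> {1..N} \<and> card P = m \<and> (\<forall>c\<in>P. \<forall>d\<in>P. c + d \<noteq> N + 1)}"

text \<open>The \<open>i\<close>-th smallest element \<open>p\<^sub>i\<close> of \<open>P = {p\<^sub>1 < \<dots> < p\<^sub>m}\<close>,
  with \<open>p\<^sub>0 = 0\<close> and \<open>p\<^sub>m\<^sub>+\<^sub>1 = N + 1\<close>.\<close>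

definition entry :: "nat \<Rightarrow> nat set \<Rightarrow> nat \<Rightarrow> nat" where
  "entry N P i = (if i = 0 then 0
                  else if i \<le> card P then sorted_list_of_set P ! (i - 1)
                  else N + 1)"

definition sym_hull :: "nat \<Rightarrow> nat set \<Rightarrow> nat set" where
  "sym_hull N P = P \<union> {c \<in> {1..N}. N + 1 - c \<in> P}"

text \<open>Only meaningful in type \<open>D\<close>, where the ambient dimension is \<open>2 n + 2\<close>.\<close>

definition symbol_type :: "nat \<Rightarrow> nat set \<Rightarrow> nat" where
  "symbol_type n P = (if n + 1 \<in> sym_hull (2 * n + 2) P then card ({1..n + 1} - P) mod 2 else 2)"

definition visible_cuts :: "nat \<Rightarrow> nat \<Rightarrow> nat set \<Rightarrow> nat set \<Rightarrow> nat set" where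
  "visible_cuts N m P T =
     {c \<in> {0..N}. \<exists>i\<in>{0..m}. entry N P i \<le> c \<and> c < entry N T (i + 1)}"

definition apparent_cuts :: "nat \<Rightarrow> nat \<Rightarrow> nat set \<Rightarrow> nat set \<Rightarrow> nat set" where
  "apparent_cuts N m P T =
     {c \<in> {0..N}. c \<in> visible_cuts N m P T \<or> N - c \<in> visible_cuts N m P T}"

definition exceptional_cuts1 :: "nat \<Rightarrow> nat \<Rightarrow> nat set \<Rightarrow> nat set \<Rightarrow> nat set" where
  "exceptional_cuts1 n m P T = (let N = 2 * n + 2 in
     {c. c = n + 1 \<and>
         (\<exists>i\<in>{1..m}.
            (entry N P i = n + 2 \<and> n + 2 \<le> entry N T (i + 1)) \<or>
            (entry N T i = n + 1 \<and> n + 1 \<ge> entry N P (i - 1)))})"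

definition exceptional_cuts2 :: "nat \<Rightarrow> nat set \<Rightarrow> nat set \<Rightarrow> nat set" where
  "exceptional_cuts2 n P T = (let N = 2 * n + 2 in
     (\<Union>c \<in> {c \<in> {1..n}. symbol_type n T \<noteq> symbol_type n P \<and>
                 {c + 1..n + 1} \<subseteq> sym_hull N P \<inter> sym_hull N T \<and>
                 card (T \<inter> {1..c}) = card (P \<inter> {1..c}) + 1}.
        {c, N - c}))"

definition cuts :: "lie_type \<Rightarrow> nat \<Rightarrow> nat \<Rightarrow> nat set \<Rightarrow> nat set \<Rightarrow> nat set" where
  "cuts ty n m P T = apparent_cuts (ambient_dim ty n) m P T \<union>
     (if ty = TypeD then exceptional_cuts1 n m P T \<union> exceptional_cuts2 n P T else {})"

definition zero_column :: "nat \<Rightarrow> nat \<Rightarrow> nat set \<Rightarrow> nat set \<Rightarrow> nat \<Rightarrow> bool" where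
  "zero_column N m P T c \<longleftrightarrow> (\<exists>j\<in>{0..m}. entry N P j < c \<and> c < entry N T (j + 1))"

definition lone_star :: "lie_type \<Rightarrow> nat \<Rightarrow> nat \<Rightarrow> nat set \<Rightarrow> nat set \<Rightarrow> nat \<Rightarrow> bool" where
  "lone_star ty n m P T c \<longleftrightarrow>
     (c \<in> T \<and> c \<in> cuts ty n m P T) \<or> (c \<in> P \<and> c - 1 \<in> cuts ty n m P T)"

definition linear_indices :: "lie_type \<Rightarrow> nat \<Rightarrow> nat \<Rightarrow> nat set \<Rightarrow> nat set \<Rightarrow> nat set" where
  "linear_indices ty n m P T = (let N = ambient_dim ty n in
     {c \<in> {1..N}. zero_column N m P T c \<or> lone_star ty n m P T (N + 1 - c)})"

definition quadratic_indices :: "lie_type \<Rightarrow> nat \<Rightarrow> nat \<Rightarrow> nat set \<Rightarrow> nat set \<Rightarrow> nat set" where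
  "quadratic_indices ty n m P T =
     ({0..n} \<inter> cuts ty n m P T) \<union> (if ty = TypeC then {} else {n + 1})"

definition bilinear_form :: "(complex^'k \<Rightarrow> complex^'k \<Rightarrow> complex) \<Rightarrow> bool" where
  "bilinear_form \<omega> \<longleftrightarrow>
     (\<forall>x. Vector_Spaces.linear (*s) (*) (\<lambda>y. \<omega> x y)) \<and>
     (\<forall>y. Vector_Spaces.linear (*s) (*) (\<lambda>x. \<omega> x y))"

definition nondegenerate :: "(complex^'k \<Rightarrow> complex^'k \<Rightarrow> complex) \<Rightarrow> bool" where
  "nondegenerate \<omega> \<longleftrightarrow> (\<forall>x. (\<forall>y. \<omega> x y = 0) \<longrightarrow> x = 0) \<and> (\<forall>y. (\<forall>x. \<omega> x y = 0) \<longrightarrow> y = 0)"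

fun form_of_type :: "lie_type \<Rightarrow> (complex^'k \<Rightarrow> complex^'k \<Rightarrow> complex) \<Rightarrow> bool" where
  "form_of_type TypeB \<omega> \<longleftrightarrow> (\<forall>x y. \<omega> x y = \<omega> y x)"
| "form_of_type TypeC \<omega> \<longleftrightarrow> (\<forall>x y. \<omega> x y = - \<omega> y x)"
| "form_of_type TypeD \<omega> \<longleftrightarrow> (\<forall>x y. \<omega> x y = \<omega> y x)"

text \<open>The basis \<open>e 1, \<dots>, e N\<close> of \<open>\<complex>\<^sup>N\<close>, \<open>N = CARD('k)\<close>; other values of \<open>e\<close> are irrelevant.\<close>

definition adapted_basis ::
  "(complex^'k \<Rightarrow> complex^'k \<Rightarrow> complex) \<Rightarrow> (nat \<Rightarrow> complex^'k) \<Rightarrow> bool" where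
  "adapted_basis \<omega> e \<longleftrightarrow>
     inj_on e {1..CARD('k)} \<and>
     vec.independent (e ` {1..CARD('k)}) \<and>
     vec.span (e ` {1..CARD('k)}) = UNIV \<and>
     (\<forall>i\<in>{1..CARD('k)}. \<forall>j\<in>{1..CARD('k)}. i \<le> j \<longrightarrow>
        \<omega> (e i) (e j) = (if i + j = CARD('k) + 1 then 1 else 0))"

definition coord :: "(nat \<Rightarrow> complex^'k) \<Rightarrow> nat \<Rightarrow> complex^'k \<Rightarrow> complex" where
  "coord e c x = vec.representation (e ` {1..CARD('k)}) x (e c)"

definition isotropic_grassmannian ::
  "(complex^'k \<Rightarrow> complex^'k \<Rightarrow> complex) \<Rightarrow> nat \<Rightarrow> (complex^'k) set set" where
  "isotropic_grassmannian \<omega> m =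
     {S. vec.subspace S \<and> vec.dim S = m \<and> (\<forall>x\<in>S. \<forall>y\<in>S. \<omega> x y = 0)}"

text \<open>Homogeneous polynomials with complex coefficients in variables indexed by \<open>I\<close>, of the
  given degree, as functions; over an infinite field nothing is lost by this. The zero
  polynomial has every degree.\<close>

inductive homogeneous_poly :: "'i set \<Rightarrow> nat \<Rightarrow> (('i \<Rightarrow> complex) \<Rightarrow> complex) \<Rightarrow> bool"
  for I :: "'i set" where
  const: "homogeneous_poly I 0 (\<lambda>v. a)"
| var: "i \<in> I \<Longrightarrow> homogeneous_poly I 1 (\<lambda>v. v i)"
| add: "homogeneous_poly I d f \<Longrightarrow> homogeneous_poly I d g \<Longrightarrow> homogeneous_poly I d (\<lambda>v. f v + g v)"
| mult: "homogeneous_poly I d f \<Longrightarrow> homogeneous_poly I d' g \<Longrightarrow>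
           homogeneous_poly I (d + d') (\<lambda>v. f v * g v)"

text \<open>The Pluecker coordinate indexed by \<open>J = {j\<^sub>1 < \<dots> < j\<^sub>m}\<close> of the tuple \<open>a 1, \<dots>, a m\<close>:
  the minor on columns \<open>J\<close> of the \<open>m \<times> N\<close> matrix whose rows are the \<open>a i\<close> written in the
  basis \<open>e\<close>.\<close>

definition pluecker ::
  "(nat \<Rightarrow> complex^'k) \<Rightarrow> nat \<Rightarrow> (nat \<Rightarrow> complex^'k) \<Rightarrow> nat set \<Rightarrow> complex" where
  "pluecker e m a J =
     (\<Sum>\<sigma> | \<sigma> permutes {1..m}. of_int (sign \<sigma>) *
        (\<Prod>i\<in>{1..m}. coord e (entry (CARD('k)) J (\<sigma> i)) (a i)))"

text \<open>Vanishing of \<open>f\<close> at the point of projective space given by the \<open>m\<close>-dimensional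
  subspace \<open>S\<close>. Any \<open>m\<close> vectors spanning \<open>S\<close> form a basis of \<open>S\<close>; a change of basis scales
  all Pluecker coordinates by a common nonzero factor.\<close>

definition vanishes_at ::
  "(nat \<Rightarrow> complex^'k) \<Rightarrow> nat \<Rightarrow> ((nat set \<Rightarrow> complex) \<Rightarrow> complex) \<Rightarrow> (complex^'k) set \<Rightarrow> bool" where
  "vanishes_at e m f S \<longleftrightarrow> (\<forall>a. vec.span (a ` {1..m}) = S \<longrightarrow> f (pluecker e m a) = 0)"

definition zariski_closed ::
  "(complex^'k \<Rightarrow> complex^'k \<Rightarrow> complex) \<Rightarrow> (nat \<Rightarrow> complex^'k) \<Rightarrow> nat \<Rightarrow>
   (complex^'k) set set \<Rightarrow> bool" where
  "zariski_closed \<omega> e m A \<longleftrightarrow>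
     (\<exists>F. (\<forall>f\<in>F. \<exists>d. homogeneous_poly {J. J \<subseteq> {1..CARD('k)} \<and> card J = m} d f) \<and>
          A = {S \<in> isotropic_grassmannian \<omega> m. \<forall>f\<in>F. vanishes_at e m f S})"

definition zariski_closure ::
  "(complex^'k \<Rightarrow> complex^'k \<Rightarrow> complex) \<Rightarrow> (nat \<Rightarrow> complex^'k) \<Rightarrow> nat \<Rightarrow>
   (complex^'k) set set \<Rightarrow> (complex^'k) set set" where
  "zariski_closure \<omega> e m A = \<Inter>{B. zariski_closed \<omega> e m B \<and> A \<subseteq> B}"

definition schubert_variety ::
  "(complex^'k \<Rightarrow> complex^'k \<Rightarrow> complex) \<Rightarrow> (nat \<Rightarrow> complex^'k) \<Rightarrow> nat \<Rightarrow> nat set \<Rightarrow>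
   (complex^'k) set set" where
  "schubert_variety \<omega> e m P = zariski_closure \<omega> e m
     {S \<in> isotropic_grassmannian \<omega> m.
        {c \<in> {1..CARD('k)}. S \<inter> vec.span (e ` {1..c}) \<supset> S \<inter> vec.span (e ` {1..c - 1})} = P}"

definition opposite_schubert_variety ::
  "(complex^'k \<Rightarrow> complex^'k \<Rightarrow> complex) \<Rightarrow> (nat \<Rightarrow> complex^'k) \<Rightarrow> nat \<Rightarrow> nat set \<Rightarrow>
   (complex^'k) set set" where
  "opposite_schubert_variety \<omega> e m T = zariski_closure \<omega> e m
     {S \<in> isotropic_grassmannian \<omega> m.
        {c \<in> {1..CARD('k)}. S \<inter> vec.span (e ` {c..CARD('k)}) \<supset>
                            S \<inter> vec.span (e ` {c + 1..CARD('k)})} = T}"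

definition bruhat_le ::
  "(complex^'k \<Rightarrow> complex^'k \<Rightarrow> complex) \<Rightarrow> (nat \<Rightarrow> complex^'k) \<Rightarrow> nat \<Rightarrow>
   nat set \<Rightarrow> nat set \<Rightarrow> bool" where
  "bruhat_le \<omega> e m T P \<longleftrightarrow> schubert_variety \<omega> e m T \<subseteq> schubert_variety \<omega> e m P"

definition richardson_variety ::
  "(complex^'k \<Rightarrow> complex^'k \<Rightarrow> complex) \<Rightarrow> (nat \<Rightarrow> complex^'k) \<Rightarrow> nat \<Rightarrow>
   nat set \<Rightarrow> nat set \<Rightarrow> (complex^'k) set set" where
  "richardson_variety \<omega> e m P T = schubert_variety \<omega> e m P \<inter> opposite_schubert_variety \<omega> e m T"

text \<open>Points of \<open>P\<^sup>N\<^sup>-\<^sup>1\<close> are the one-dimensional subspaces of \<open>\<complex>\<^sup>N\<close>.\<close>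

definition projective_space :: "(complex^'k) set set" where
  "projective_space = {L. vec.subspace L \<and> vec.dim L = 1}"

definition incidence_variety ::
  "(complex^'k \<Rightarrow> complex^'k \<Rightarrow> complex) \<Rightarrow> nat \<Rightarrow> ((complex^'k) set \<times> (complex^'k) set) set" where
  "incidence_variety \<omega> m =
     {(L, S). L \<in> projective_space \<and> S \<in> isotropic_grassmannian \<omega> m \<and> L \<subseteq> S}"

text \<open>\<open>\<psi>(\<pi>\<^sup>-\<^sup>1(Y))\<close>, where \<open>\<psi>\<close> and \<open>\<pi>\<close> are the restrictions of \<open>fst\<close> and \<open>snd\<close> to the
  incidence variety.\<close>

definition line_projection ::
  "(complex^'k \<Rightarrow> complex^'k \<Rightarrow> complex) \<Rightarrow> nat \<Rightarrow> (complex^'k) set set \<Rightarrow> (complex^'k) set set" where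
  "line_projection \<omega> m Y = fst ` (incidence_variety \<omega> m \<inter> snd -` Y)"

text \<open>In types \<open>B\<close> and \<open>D\<close>, \<open>c = n + 1\<close> gives half the quadratic form \<open>\<omega> x x\<close>; in type \<open>B\<close>
  the middle coordinate \<open>x\<^sub>n\<^sub>+\<^sub>1\<close> is paired with itself.\<close>

definition quadric :: "lie_type \<Rightarrow> nat \<Rightarrow> (nat \<Rightarrow> complex^'k) \<Rightarrow> nat \<Rightarrow> complex^'k \<Rightarrow> complex" where
  "quadric ty n e c x =
     (if ty = TypeB \<and> c = n + 1
      then (\<Sum>i=1..n. coord e i x * coord e (CARD('k) + 1 - i) x) + 1 / 2 * (coord e (n + 1) x)\<^sup>2
      else (\<Sum>i=1..c. coord e i x * coord e (CARD('k) + 1 - i) x))"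

definition Z_locus ::
  "lie_type \<Rightarrow> nat \<Rightarrow> (nat \<Rightarrow> complex^'k) \<Rightarrow> nat \<Rightarrow> nat set \<Rightarrow> nat set \<Rightarrow> (complex^'k) set set" where
  "Z_locus ty n e m P T =
     {L \<in> projective_space.
        (\<forall>c\<in>quadratic_indices ty n m P T. \<forall>x\<in>L. quadric ty n e c x = 0) \<and>
        (\<forall>c\<in>linear_indices ty n m P T. \<forall>x\<in>L. coord e c x = 0)}"

end

theory Submission
  imports Defs
begin

text \<open>The proof rests on conditions of the form \<open>q \<le> dim (S \<inter> E A)\<close>, where \<open>E A\<close> is the span of
  the basis vectors indexed by \<open>A\<close>. They are Zariski closed, being equivalent to the vanishing of
  certain Pluecker coordinates, so they pass from a Schubert cell to its closure. For intervals
  \<open>A\<close> they split \<open>S\<close> at every visible cut; isotropy of \<open>S\<close> then gives the equations from apparent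
  cuts.

  In type \<open>D\<close> one needs in addition that the image of \<open>S \<inter> E {1..N - c}\<close> in
  \<open>E {1..N - c} / E {1..c}\<close> belongs to the family of maximal isotropic subspaces prescribed by the
  symbol. This is encoded by the same kind of condition: \<open>S\<close> meets \<open>E ({1..c} \<union> J)\<close> outside
  \<open>E {1..c}\<close> for each index set \<open>J\<close> of a maximal isotropic coordinate subspace of the wrong parity.
  At an exceptional cut the two images coming from \<open>P\<close> and \<open>T\<close> meet in codimension at most one and
  belong to the same family, hence coincide, and the equations follow.\<close>

section \<open>Coordinate subspaces\<close>

text \<open>The family of a maximal isotropic subspace is a parity, not a rank, so it does not
  obviously survive passage to a closure. What survives is failure of transversality: such a
  subspace is transversal only to coordinate subspaces of a single parity, so meeting every
  \<open>E J\<close> of the other parity is a collection of closed conditions; and since some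
  \<open>E J\<close> is always transversal, these conditions recover the parity. The obstacle is
  that they control the image of \<open>S\<close> only while \<open>S \<inter> E {1..c}\<close> has
  no more than the dimension prescribed by the symbol. On the boundary they may become void. Then,
  however, the surplus dimension makes \<open>S\<close> split at \<open>c\<close> or at
  \<open>N - c\<close> much as at an apparent cut, or the condition at a neighbouring index takes
  over; hence the case distinctions at an exceptional cut. Statements about \<open>T\<close> come
  from statements about \<open>P\<close> by reversing the basis, which exchanges \<open>P\<close>
  with the reflection of \<open>T\<close>.\<close>

declare One_nat_def [simp del]

lemma exists_nonzero_if_dim_pos:
  assumes "0 < vec.dim (X :: (complex^'k) set)"
  shows "\<exists>x\<in>X. x \<noteq> 0"
  using assms by (metis gr_implies_not0 subsetI singletonI vec.dim_eq_0)

lemma dim_add_le_dim_Int: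
  fixes X Y Z :: "(complex^'k) set"
  assumes "vec.subspace X" "vec.subspace Y" "vec.subspace Z" "X \<subseteq> Z" "Y \<subseteq> Z"
  shows "vec.dim X + vec.dim Y \<le> vec.dim Z + vec.dim (X \<inter> Y)"
proof -
  have "{x + y |x y. x \<in> X \<and> y \<in> Y} \<subseteq> Z"
    using assms vec.subspace_add by blast
  from vec.dim_subset[OF this] show ?thesis
    using vec.dim_sums_Int[OF assms(1,2)] by linarith
qed

lemma Int_nonzero_if_dim:
  fixes X Y Z :: "(complex^'k) set"
  assumes "vec.subspace X" "vec.subspace Y" "vec.subspace Z" "X \<subseteq> Z" "Y \<subseteq> Z"
    and "vec.dim Z < vec.dim X + vec.dim Y"
  shows "\<exists>x. x \<in> X \<and> x \<in> Y \<and> x \<noteq> 0"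
proof -
  have "0 < vec.dim (X \<inter> Y)"
    using dim_add_le_dim_Int[OF assms(1-5)] assms(6) by linarith
  then show ?thesis
    using exists_nonzero_if_dim_pos by blast
qed

lemma sum_decomposition_if_dim:
  fixes X Y Z :: "(complex^'k) set"
  assumes "vec.subspace X" "vec.subspace Y" "vec.subspace Z" "X \<subseteq> Z" "Y \<subseteq> Z"
    and "vec.dim Z + vec.dim (X \<inter> Y) \<le> vec.dim X + vec.dim Y" and "z \<in> Z"
  obtains x y where "x \<in> X" "y \<in> Y" "z = x + y"
proof -
  have "{x + y |x y. x \<in> X \<and> y \<in> Y} = Z"
  proof (rule vec.subspace_dim_equal)
    show "{x + y |x y. x \<in> X \<and> y \<in> Y} \<subseteq> Z"
      using assms vec.subspace_add by blast
    show "vec.dim Z \<le> vec.dim {x + y |x y. x \<in> X \<and> y \<in> Y}"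
      using vec.dim_sums_Int[OF assms(1,2)] assms(6) by linarith
  qed (use assms vec.subspace_sums in blast)+
  then show thesis using that assms(7) by blast
qed

lemma exists_diff_if_dim_less:
  fixes X Y :: "(complex^'k) set"
  assumes "vec.dim Y < vec.dim X"
  shows "\<exists>x\<in>X. x \<notin> Y"
  using assms vec.dim_subset[of X Y] by (meson not_le subsetI)

lemma dim_less_if_mem_diff:
  fixes X Y :: "(complex^'k) set"
  assumes "vec.subspace X" "vec.subspace Y" "X \<subseteq> Y" "y \<in> Y" "y \<notin> X"
  shows "vec.dim X < vec.dim Y"
proof (rule ccontr)
  assume "\<not> vec.dim X < vec.dim Y"
  then have "X = Y" using assms(1-3) by (intro vec.subspace_dim_equal) auto
  then show False using assms by simp
qed

text \<open>Vanishing coordinates instead of a span: \<open>A\<close> may leave the index range, and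
  intersections of coordinate subspaces are intersections of index sets.\<close>

definition coord_subspace :: "(nat \<Rightarrow> complex^'k) \<Rightarrow> nat set \<Rightarrow> (complex^'k) set" where
  "coord_subspace e A = {x. \<forall>i\<in>{1..CARD('k)}. i \<notin> A \<longrightarrow> coord e i x = 0}"

definition coord_proj :: "(nat \<Rightarrow> complex^'k) \<Rightarrow> nat set \<Rightarrow> complex^'k \<Rightarrow> complex^'k" where
  "coord_proj e A x = (\<Sum>i\<in>{1..CARD('k)} \<inter> A. coord e i x *s e i)"

locale coordinates =
  fixes e :: "nat \<Rightarrow> complex^'k" and N :: nat
  assumes N_eq: "N = CARD('k)"
    and inj_basis: "inj_on e {1..N}"
    and independent_basis: "vec.independent (e ` {1..N})"
    and span_basis: "vec.span (e ` {1..N}) = UNIV"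
begin

abbreviation "E \<equiv> coord_subspace e"
abbreviation "pr \<equiv> coord_proj e"

lemma coord_eq: "coord e c x = vec.representation (e ` {1..N}) x (e c)"
  by (simp add: coord_def N_eq)

lemma coord_subspace_eq: "E A = {x. \<forall>i\<in>{1..N}. i \<notin> A \<longrightarrow> coord e i x = 0}"
  by (simp add: coord_subspace_def N_eq)

lemma coord_proj_eq: "pr A x = (\<Sum>i\<in>{1..N} \<inter> A. coord e i x *s e i)"
  by (simp add: coord_proj_def N_eq)

lemma bar_mem: "i \<in> {1..N} \<Longrightarrow> N + 1 - i \<in> {1..N}"
  by auto

lemma coord_add: "coord e i (x + y) = coord e i x + coord e i y"
  unfolding coord_eq by (simp add: vec.representation_add independent_basis span_basis)

lemma coord_diff: "coord e i (x - y) = coord e i x - coord e i y"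
  unfolding coord_eq by (simp add: vec.representation_diff independent_basis span_basis)

lemma coord_scale: "coord e i (a *s x) = a * coord e i x"
  unfolding coord_eq by (simp add: vec.representation_scale independent_basis span_basis)

lemma coord_zero: "coord e i 0 = 0"
  unfolding coord_eq by (simp add: vec.representation_zero)

lemma coord_sum: "coord e i (sum f A) = (\<Sum>a\<in>A. coord e i (f a))"
  by (induction A rule: infinite_finite_induct) (auto simp: coord_add coord_zero)

lemmas coord_linear = coord_add coord_diff coord_scale coord_zero coord_sum

lemma coord_basis:
  assumes "i \<in> {1..N}" "j \<in> {1..N}"
  shows "coord e i (e j) = (if i = j then 1 else 0)"
  unfolding coord_eq using assms inj_on_eq_iff[OF inj_basis assms]
  by (simp add: vec.representation_basis independent_basis)

lemma coord_expansion: "(\<Sum>i\<in>{1..N}. coord e i x *s e i) = x"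
proof -
  have "(\<Sum>b\<in>e ` {1..N}. vec.representation (e ` {1..N}) x b *s b) = x"
    by (rule vec.sum_representation_eq) (auto simp: independent_basis span_basis)
  then show ?thesis
    unfolding coord_eq by (simp add: sum.reindex[OF inj_basis])
qed

lemma coord_eqI:
  assumes "\<And>i. i \<in> {1..N} \<Longrightarrow> coord e i x = coord e i y"
  shows "x = y"
  using coord_expansion[of x] coord_expansion[of y] assms by (metis (no_types, lifting) sum.cong)

lemma coord_pr: "i \<in> {1..N} \<Longrightarrow> coord e i (pr A x) = (if i \<in> A then coord e i x else 0)"
proof -
  assume i: "i \<in> {1..N}"
  have "coord e i (pr A x) = (\<Sum>j\<in>{1..N} \<inter> A. if i = j then coord e j x else 0)"
    unfolding coord_proj_eq coord_sum coord_scale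
    by (rule sum.cong) (use i in \<open>auto simp: coord_basis\<close>)
  then show ?thesis using i by (simp)
qed

lemma subspace_E [simp, intro]: "vec.subspace (E A)"
  by (rule vec.subspaceI) (auto simp: coord_subspace_eq coord_linear)

lemma E_mono: "A \<subseteq> B \<Longrightarrow> E A \<subseteq> E B"
  by (auto simp: coord_subspace_eq)

lemma E_Int: "E A \<inter> E B = E (A \<inter> B)"
  by (auto simp: coord_subspace_eq)

lemma mem_E_I: "(\<And>i. i \<in> {1..N} \<Longrightarrow> i \<notin> A \<Longrightarrow> coord e i x = 0) \<Longrightarrow> x \<in> E A"
  by (auto simp: coord_subspace_eq)

lemma mem_E_D: "x \<in> E A \<Longrightarrow> i \<in> {1..N} \<Longrightarrow> i \<notin> A \<Longrightarrow> coord e i x = 0"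
  by (auto simp: coord_subspace_eq)

lemma mem_E_Diff: "x \<in> E A \<Longrightarrow> coord e i x = 0 \<Longrightarrow> x \<in> E (A - {i})"
  by (auto simp: coord_subspace_eq)

lemma E_UNIV: "{1..N} \<subseteq> A \<Longrightarrow> E A = UNIV"
  by (auto simp: coord_subspace_eq)

lemma E_disjoint_eq_0: "x \<in> E A \<Longrightarrow> A \<inter> {1..N} = {} \<Longrightarrow> x = 0"
  by (rule coord_eqI) (unfold coord_subspace_eq coord_zero, blast)

lemma pr_mem: "pr A x \<in> E A"
  by (rule mem_E_I) (simp add: coord_pr)

lemma pr_id: "x \<in> E A \<Longrightarrow> pr A x = x"
  by (rule coord_eqI) (simp add: coord_pr mem_E_D)

lemma pr_add: "pr A (x + y) = pr A x + pr A y"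
  by (rule coord_eqI) (auto simp: coord_pr coord_linear)

lemma pr_scale: "pr A (a *s x) = a *s pr A x"
  by (rule coord_eqI) (auto simp: coord_pr coord_linear)

lemma pr_eq_0: "x \<in> E B \<Longrightarrow> A \<inter> B \<inter> {1..N} = {} \<Longrightarrow> pr A x = 0"
  by (rule coord_eqI) (force simp: coord_pr coord_linear coord_subspace_eq)

lemma span_image_basis:
  assumes "A \<subseteq> {1..N}"
  shows "vec.span (e ` A) = E A"
proof
  show "vec.span (e ` A) \<subseteq> E A"
  proof (rule vec.span_minimal)
    show "e ` A \<subseteq> E A"
      using assms by (auto simp: coord_subspace_eq coord_basis subset_eq)
  qed simp
  show "E A \<subseteq> vec.span (e ` A)"
  proof
    fix x assume "x \<in> E A"
    then have "x = pr A x" by (simp add: pr_id)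
    also have "\<dots> \<in> vec.span (e ` A)"
      unfolding coord_proj_eq
      by (intro vec.span_sum vec.span_scale vec.span_base) auto
    finally show "x \<in> vec.span (e ` A)" .
  qed
qed

lemma basis_mem_E: "i \<in> A \<Longrightarrow> i \<in> {1..N} \<Longrightarrow> e i \<in> E A"
  by (rule mem_E_I) (auto simp: coord_basis)

lemma dim_E:
  assumes "A \<subseteq> {1..N}"
  shows "vec.dim (E A) = card A"
proof -
  have "vec.independent (e ` A)"
    using independent_basis assms by (meson image_mono vec.independent_mono)
  then have "vec.dim (E A) = card (e ` A)"
    using vec.dim_span_eq_card_independent span_image_basis[OF assms] by metis
  then show ?thesis
    using card_image[OF inj_on_subset[OF inj_basis assms]] by simp
qed

text \<open>One vector with nonzero coordinate \<open>i\<close> suffices to clear that coordinate in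
  all others.\<close>

lemma dim_Int_E_insert_le:
  assumes S: "vec.subspace S"
  shows "vec.dim (S \<inter> E (insert i A)) \<le> vec.dim (S \<inter> E A) + 1"
proof (cases "\<exists>s\<in>S \<inter> E (insert i A). coord e i s \<noteq> 0")
  case False
  then have "S \<inter> E (insert i A) \<subseteq> S \<inter> E A"
    by (force simp: coord_subspace_eq)
  from vec.dim_subset[OF this] show ?thesis by simp
next
  case True
  then obtain s where s: "s \<in> S" "s \<in> E (insert i A)" "coord e i s \<noteq> 0" by auto
  have "S \<inter> E (insert i A) \<subseteq> vec.span (insert s (S \<inter> E A))"
  proof
    fix x assume x: "x \<in> S \<inter> E (insert i A)"
    define l where "l = coord e i x / coord e i s"
    have "x - l *s s \<in> S \<inter> E A"
    proof (intro IntI mem_E_I)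
      show "x - l *s s \<in> S"
        using S s(1) x by (simp add: vec.subspace_diff vec.subspace_scale)
      fix j assume "j \<in> {1..N}" "j \<notin> A"
      then show "coord e j (x - l *s s) = 0"
        using x s mem_E_D[of x "insert i A" j] mem_E_D[of s "insert i A" j]
        by (cases "j = i") (auto simp: coord_linear l_def)
    qed
    then have "(x - l *s s) + l *s s \<in> vec.span (insert s (S \<inter> E A))"
      by (meson insertI1 insertI2 vec.span_add vec.span_base vec.span_scale)
    then show "x \<in> vec.span (insert s (S \<inter> E A))" by simp
  qed
  then have "vec.dim (S \<inter> E (insert i A)) \<le> vec.dim (insert s (S \<inter> E A))"
    by (rule vec.dim_mono)
  then show ?thesis by (simp add: vec.dim_insert split: if_splits)
qed

text \<open>Maximality makes \<open>A - K\<close> a set of pivot columns: for \<open>i\<close> in it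
  there is a vector of \<open>S\<close> supported on \<open>insert i K\<close> with nonzero
  coordinate \<open>i\<close>, so \<open>e i\<close> is a sum of vectors from
  \<open>S \<inter> E A\<close> and \<open>E K\<close>. This is how a dimension is turned into an
  index set.\<close>

lemma maximal_transversal_complement:
  assumes S: "vec.subspace S" and A: "A \<subseteq> {1..N}" and K: "K \<subseteq> A"
    and tr: "S \<inter> E K \<subseteq> {0}"
    and max: "\<And>i. i \<in> A - K \<Longrightarrow> \<not> S \<inter> E (insert i K) \<subseteq> {0}"
  shows "vec.dim (S \<inter> E A) + card K = card A"
    and "x \<in> E A \<Longrightarrow> \<exists>s t. s \<in> S \<inter> E A \<and> t \<in> E K \<and> x = s + t"
proof -
  let ?M = "{x + y |x y. x \<in> S \<inter> E A \<and> y \<in> E K}"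
  have sub: "vec.subspace (S \<inter> E A)" using S by (simp add: vec.subspace_inter)
  have subM: "vec.subspace ?M" using sub subspace_E by (rule vec.subspace_sums)
  have "e i \<in> ?M" if i: "i \<in> A" for i
  proof (cases "i \<in> K")
    case True
    have "e i \<in> E K" using True i A by (auto intro: basis_mem_E)
    moreover have "0 \<in> S \<inter> E A" using sub vec.subspace_0 by blast
    moreover have "e i = 0 + e i" by simp
    ultimately show ?thesis by blast
  next
    case False
    then obtain s where s: "s \<in> S" "s \<in> E (insert i K)" "s \<noteq> 0"
      using max[of i] i by blast
    have ne: "coord e i s \<noteq> 0"
    proof
      assume "coord e i s = 0"
      then have "s \<in> E K" using s(2) mem_E_Diff[of s "insert i K" i] False by simp
      then show False using tr s by blast
    qed
    define a where "a = inverse (coord e i s)"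
    have "a *s s \<in> S \<inter> E A"
      using s E_mono[of "insert i K" A] K i by (intro vec.subspace_scale[OF sub]) auto
    moreover have "e i - a *s s \<in> E K"
    proof (rule mem_E_I)
      fix j assume "j \<in> {1..N}" "j \<notin> K"
      then have "coord e j (e i) = (if j = i then 1 else 0)" "j \<noteq> i \<Longrightarrow> coord e j s = 0"
        using mem_E_D[OF s(2), of j] coord_basis[of j i] i A by blast+
      then show "coord e j (e i - a *s s) = 0"
        using ne by (cases "j = i") (auto simp: coord_diff coord_scale a_def)
    qed
    moreover have "e i = a *s s + (e i - a *s s)" by simp
    ultimately show ?thesis by blast
  qed
  then have "vec.span (e ` A) \<subseteq> ?M"
    using subM by (intro vec.span_minimal) auto
  then have EM: "E A \<subseteq> ?M" using span_image_basis[OF A] by simp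
  show "\<exists>s t. s \<in> S \<inter> E A \<and> t \<in> E K \<and> x = s + t" if "x \<in> E A"
    using EM that by blast
  have "?M \<subseteq> E A" using E_mono[OF K] vec.subspace_add[OF subspace_E] by blast
  then have M: "?M = E A" using EM by (rule antisym)
  have "S \<inter> E A \<inter> E K \<subseteq> {0}" using tr by blast
  then have "vec.dim (S \<inter> E A \<inter> E K) = 0" by (simp only: vec.dim_eq_0)
  moreover have "vec.dim (E K) = card K" using A K by (intro dim_E) auto
  ultimately show "vec.dim (S \<inter> E A) + card K = card A"
    using vec.dim_sums_Int[OF sub subspace_E, of K] dim_E[OF A] unfolding M by linarith
qed

lemma exists_maximal_transversal:
  assumes "A \<subseteq> {1..N}" "K \<subseteq> A" "S \<inter> E K \<subseteq> {0}"
  shows "\<exists>L. K \<subseteq> L \<and> L \<subseteq> A \<and> S \<inter> E L \<subseteq> {0} \<and> (\<forall>i\<in>A - L. \<not> S \<inter> E (insert i L) \<subseteq> {0})"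
proof -
  let ?F = "{L. K \<subseteq> L \<and> L \<subseteq> A \<and> S \<inter> E L \<subseteq> {0}}"
  have "finite A" using assms(1) finite_subset by blast
  then have fin: "finite ?F" by (intro finite_subset[of ?F "Pow A"]) auto
  have "?F \<noteq> {}" using assms by auto
  from finite_has_maximal[OF fin this]
  obtain L where L: "L \<in> ?F" and maxL: "\<forall>M\<in>?F. L \<subseteq> M \<longrightarrow> L = M"
    by (elim bexE)
  have "\<not> S \<inter> E (insert i L) \<subseteq> {0}" if i: "i \<in> A - L" for i
  proof
    assume "S \<inter> E (insert i L) \<subseteq> {0}"
    then have "L = insert i L" using L i by (intro maxL[rule_format]) auto
    then show False using i by auto
  qed
  then show ?thesis using L by blast
qed

end

section \<open>Rank conditions are Zariski closed\<close>

lemma bij_betw_entry: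
  assumes "finite J"
  shows "bij_betw (entry N J) {1..card J} J"
proof -
  have "bij_betw (\<lambda>i. sorted_list_of_set J ! i) {..<card J} J"
    using assms bij_betw_nth[of "sorted_list_of_set J"] by simp
  moreover have "bij_betw (\<lambda>i. i - 1) {1..card J} {..<card J}"
    by (rule bij_betwI[of _ _ _ Suc]) auto
  ultimately have "bij_betw ((\<lambda>i. sorted_list_of_set J ! i) \<circ> (\<lambda>i. i - 1)) {1..card J} J"
    by (rule bij_betw_trans[rotated])
  then show ?thesis
    by (rule iffD1[OF bij_betw_cong, rotated]) (auto simp: entry_def)
qed

section \<open>Determinants as signed sums over permutations\<close>

lemma permutation_sum_equal_rows:
  fixes c :: "nat \<Rightarrow> nat \<Rightarrow> complex"
  assumes fin: "finite A" and ik: "i \<in> A" "k \<in> A" "i \<noteq> k" and eq: "c i = c k"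
  shows "(\<Sum>\<sigma> | \<sigma> permutes A. of_int (sign \<sigma>) * (\<Prod>h\<in>A. c h (\<sigma> h))) = 0"
    (is "?D = 0")
proof -
  \<comment> \<open>Composing with the transposition of the two equal rows flips every sign and
    preserves every product, so the sum is its own negative.\<close>
  define \<tau> where "\<tau> = Transposition.transpose i k"
  have \<tau>: "\<tau> permutes A" using ik by (simp add: \<tau>_def permutes_swap_id)
  have "?D = (\<Sum>\<sigma> | \<sigma> permutes A. of_int (sign (\<sigma> \<circ> \<tau>)) * (\<Prod>h\<in>A. c h ((\<sigma> \<circ> \<tau>) h)))"
    by (rule sum_permutations_compose_right[OF \<tau>])
  also have "\<dots> = (\<Sum>\<sigma> | \<sigma> permutes A. - (of_int (sign \<sigma>) * (\<Prod>h\<in>A. c h (\<sigma> h))))"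
  proof (rule sum.cong)
    fix \<sigma> assume "\<sigma> \<in> {\<sigma>. \<sigma> permutes A}"
    then have "permutation \<sigma>" "permutation \<tau>"
      using fin \<tau> permutation_permutes by blast+
    then have s: "sign (\<sigma> \<circ> \<tau>) = - sign \<sigma>"
      using ik by (simp add: sign_compose \<tau>_def sign_swap_id)
    have "(\<Prod>h\<in>A. c h ((\<sigma> \<circ> \<tau>) h)) = (\<Prod>h\<in>A. c (\<tau> h) (\<sigma> (\<tau> h)))"
      using eq by (intro prod.cong) (auto simp: \<tau>_def Transposition.transpose_def)
    also have "\<dots> = (\<Prod>h\<in>A. c h (\<sigma> h))"
      by (rule prod.reindex_bij_betw[OF permutes_imp_bij[OF \<tau>]])
    finally show "of_int (sign (\<sigma> \<circ> \<tau>)) * (\<Prod>h\<in>A. c h ((\<sigma> \<circ> \<tau>) h))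
        = - (of_int (sign \<sigma>) * (\<Prod>h\<in>A. c h (\<sigma> h)))"
      using s by simp
  qed simp
  finally show ?thesis by (simp add: sum_negf)
qed

text \<open>Put the vanishing combination of the rows in place of row \<open>k\<close> and expand
  linearly: every term but the \<open>k\<close>-th has two equal rows, and \<open>l k\<close> can be
  cancelled.\<close>

lemma permutation_sum_dependent_rows:
  fixes c :: "nat \<Rightarrow> nat \<Rightarrow> complex"
  assumes fin: "finite A" and k: "k \<in> A" "l k \<noteq> 0"
    and dep: "\<And>j. j \<in> A \<Longrightarrow> (\<Sum>i\<in>A. l i * c i j) = 0"
  shows "(\<Sum>\<sigma> | \<sigma> permutes A. of_int (sign \<sigma>) * (\<Prod>h\<in>A. c h (\<sigma> h))) = 0"
proof -
  define D where "D c = (\<Sum>\<sigma> | \<sigma> permutes A. of_int (sign \<sigma>) * (\<Prod>h\<in>A. c h (\<sigma> h)))"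
    for c :: "nat \<Rightarrow> nat \<Rightarrow> complex"
  have row: "D (c(k := r)) = (\<Sum>\<sigma> | \<sigma> permutes A. of_int (sign \<sigma>) * (r (\<sigma> k) * (\<Prod>h\<in>A - {k}. c h (\<sigma> h))))" for r
    unfolding D_def
  proof (rule sum.cong)
    fix \<sigma> :: "nat \<Rightarrow> nat"
    have "(\<Prod>h\<in>A. (c(k := r)) h (\<sigma> h)) = r (\<sigma> k) * (\<Prod>h\<in>A - {k}. (c(k := r)) h (\<sigma> h))"
      using prod.remove[OF fin k(1), of "\<lambda>h. (c(k := r)) h (\<sigma> h)"] by simp
    also have "(\<Prod>h\<in>A - {k}. (c(k := r)) h (\<sigma> h)) = (\<Prod>h\<in>A - {k}. c h (\<sigma> h))"
      by (rule prod.cong) auto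
    finally show "of_int (sign \<sigma>) * (\<Prod>h\<in>A. (c(k := r)) h (\<sigma> h))
        = of_int (sign \<sigma>) * (r (\<sigma> k) * (\<Prod>h\<in>A - {k}. c h (\<sigma> h)))" by simp
  qed simp
  have "(\<Sum>i\<in>A. l i * D (c(k := c i)))
      = (\<Sum>\<sigma> | \<sigma> permutes A. of_int (sign \<sigma>) * ((\<Sum>i\<in>A. l i * c i (\<sigma> k)) * (\<Prod>h\<in>A - {k}. c h (\<sigma> h))))"
    unfolding row sum_distrib_left sum_distrib_right
    by (subst sum.swap) (simp add: mult_ac)
  also have "\<dots> = 0"
  proof (rule sum.neutral, rule ballI)
    fix \<sigma> assume "\<sigma> \<in> {\<sigma>. \<sigma> permutes A}"
    then have "\<sigma> k \<in> A" using k by (simp add: permutes_in_image)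
    then show "of_int (sign \<sigma>) * ((\<Sum>i\<in>A. l i * c i (\<sigma> k)) * (\<Prod>h\<in>A - {k}. c h (\<sigma> h))) = 0"
      using dep by simp
  qed
  finally have "(\<Sum>i\<in>A. l i * D (c(k := c i))) = 0" .
  moreover have "l i * D (c(k := c i)) = 0" if "i \<in> A" "i \<noteq> k" for i
    using permutation_sum_equal_rows[OF fin, of i k "c(k := c i)"] that k by (simp add: D_def)
  then have "(\<Sum>i\<in>A - {k}. l i * D (c(k := c i))) = 0"
    by (intro sum.neutral) blast
  then have "(\<Sum>i\<in>A. l i * D (c(k := c i))) = l k * D (c(k := c k))"
    using sum.remove[OF fin k(1), of "\<lambda>i. l i * D (c(k := c i))"] by simp
  ultimately show ?thesis using k(2) by (simp add: D_def)
qed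

lemma permutation_sum_identity:
  fixes c :: "nat \<Rightarrow> nat \<Rightarrow> complex"
  assumes fin: "finite A" and c: "\<And>i j. i \<in> A \<Longrightarrow> j \<in> A \<Longrightarrow> c i j = (if i = j then 1 else 0)"
  shows "(\<Sum>\<sigma> | \<sigma> permutes A. of_int (sign \<sigma>) * (\<Prod>h\<in>A. c h (\<sigma> h))) = 1"
proof -
  have "(\<Sum>\<sigma> | \<sigma> permutes A. of_int (sign \<sigma>) * (\<Prod>h\<in>A. c h (\<sigma> h)))
      = (\<Sum>\<sigma> | \<sigma> permutes A. if \<sigma> = id then 1 else 0)"
  proof (rule sum.cong)
    fix \<sigma> assume s: "\<sigma> \<in> {\<sigma>. \<sigma> permutes A}"
    show "of_int (sign \<sigma>) * (\<Prod>h\<in>A. c h (\<sigma> h)) = (if \<sigma> = id then 1 else 0)"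
    proof (cases "\<sigma> = id")
      case True
      then show ?thesis using c by (simp add: sign_id)
    next
      case False
      then obtain h where h: "\<sigma> h \<noteq> h" by (metis eq_id_iff)
      then have "h \<in> A" using s by (auto dest: permutes_not_in)
      moreover have "\<sigma> h \<in> A" using s \<open>h \<in> A\<close> by (simp add: permutes_in_image)
      ultimately have "c h (\<sigma> h) = 0" using c[of h "\<sigma> h"] h by auto
      then have "(\<Prod>h\<in>A. c h (\<sigma> h)) = 0" using fin \<open>h \<in> A\<close> by auto
      then show ?thesis using False by simp
    qed
  qed simp
  also have "\<dots> = 1"
    using finite_permutations[OF fin] permutes_id[of A] by simp
  finally show ?thesis .
qed

section \<open>Pluecker coordinates and dimensions of intersections\<close>

context coordinates
begin

text \<open>The coefficients of \<open>x\<close> with respect to the \<open>a i\<close> form a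
  linear relation between the rows of the minor, since \<open>x\<close> vanishes on the columns
  \<open>J\<close>.\<close>

lemma pluecker_eq_0:
  assumes span: "vec.span (a ` {1..m}) = S" and dim: "vec.dim S = m"
    and J: "J \<subseteq> {1..N}" "card J = m"
    and x: "x \<in> S" "x \<noteq> 0" "x \<in> E ({1..N} - J)"
  shows "pluecker e m a J = 0"
proof -
  \<comment> \<open>Generators of an \<open>m\<close>-dimensional space indexed by
    \<open>{1..m}\<close> are distinct, so coefficients indexed by vectors can be reindexed by
    \<open>{1..m}\<close>.\<close>
  have "m \<le> card (a ` {1..m})"
    using vec.dim_le_card[of S "a ` {1..m}"] span dim by simp
  then have "card (a ` {1..m}) = card {1..m}"
    using card_image_le[of "{1..m}" a] by simp
  then have inj: "inj_on a {1..m}" by (rule eq_card_imp_inj_on[rotated]) simp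
  have "x \<in> range (\<lambda>u. \<Sum>v\<in>a ` {1..m}. u v *s v)"
    using vec.span_finite[of "a ` {1..m}"] span x(1) by simp
  then obtain u where "x = (\<Sum>v\<in>a ` {1..m}. u v *s v)" by blast
  then have xu: "x = (\<Sum>i\<in>{1..m}. u (a i) *s a i)"
    by (simp add: sum.reindex[OF inj])
  then obtain k where k: "k \<in> {1..m}" "u (a k) \<noteq> 0"
    using x(2) by (metis (no_types, lifting) sum.neutral vec.scale_zero_left)
  have bij: "bij_betw (entry N J) {1..m} J"
    using bij_betw_entry[of J N] J finite_subset[OF J(1)] by simp
  show ?thesis
    unfolding pluecker_def N_eq[symmetric]
  proof (rule permutation_sum_dependent_rows[where l = "\<lambda>i. u (a i)" and c = "\<lambda>i j. coord e (entry N J j) (a i)", OF _ k])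
    fix j assume "j \<in> {1..m}"
    then have "entry N J j \<in> J" using bij bij_betwE by blast
    then have "coord e (entry N J j) x = 0"
      using x(3) J(1) by (auto intro: mem_E_D)
    then show "(\<Sum>i\<in>{1..m}. u (a i) * coord e (entry N J j) (a i)) = 0"
      unfolding xu by (simp add: coord_sum coord_scale)
  qed simp
qed

lemma dim_UNIV_eq: "vec.dim (UNIV :: (complex^'k) set) = N"
  using dim_E[of "{1..N}"] E_UNIV[of "{1..N}"] by simp

text \<open>Transversality means that \<open>S\<close> projects isomorphically onto the coordinates
  in \<open>J\<close>; the preimages of the unit vectors form a basis whose minor on
  \<open>J\<close> is the identity matrix.\<close>

lemma exists_spanning_pluecker_neq_0:
  assumes S: "vec.subspace S" and dim: "vec.dim S = m"
    and J: "J \<subseteq> {1..N}" "card J = m"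
    and tr: "S \<inter> E ({1..N} - J) \<subseteq> {0}"
  shows "\<exists>a. vec.span (a ` {1..m}) = S \<and> pluecker e m a J \<noteq> 0"
proof -
  have finJ: "finite J" using J(1) finite_subset by blast
  have bij: "bij_betw (entry N J) {1..m} J"
    using bij_betw_entry[OF finJ, of N] J by simp
  have "vec.dim (S \<inter> E ({1..N} - J)) = 0"
    using tr by (simp only: vec.dim_eq_0)
  moreover have "vec.dim (E ({1..N} - J)) = N - m"
    using dim_E[of "{1..N} - J"] J finJ by (simp add: card_Diff_subset)
  moreover have "m \<le> N" using card_mono[OF _ J(1)] J(2) by simp
  ultimately have le: "vec.dim (UNIV :: (complex^'k) set) + vec.dim (S \<inter> E ({1..N} - J))
      \<le> vec.dim S + vec.dim (E ({1..N} - J))"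
    using dim dim_UNIV_eq by simp
  have "\<exists>s\<in>S. \<forall>l\<in>{1..m}. coord e (entry N J l) s = (if l = i then 1 else 0)"
    if i: "i \<in> {1..m}" for i
  proof -
    obtain s t where st: "s \<in> S" "t \<in> E ({1..N} - J)" "e (entry N J i) = s + t"
      by (rule sum_decomposition_if_dim[OF S subspace_E vec.subspace_UNIV _ _ le UNIV_I]) auto
    have "coord e (entry N J l) s = (if l = i then 1 else 0)" if l: "l \<in> {1..m}" for l
    proof -
      have m: "entry N J l \<in> J" "entry N J i \<in> J" using bij l i bij_betwE by blast+
      have "coord e (entry N J l) t = 0" using st(2) m J(1) by (auto intro: mem_E_D)
      moreover have "s = e (entry N J i) - t" using st(3) by simp
      moreover have "entry N J l = entry N J i \<longleftrightarrow> l = i"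
        using bij l i by (meson bij_betw_imp_inj_on inj_on_eq_iff)
      ultimately show ?thesis
        using coord_basis[of "entry N J l" "entry N J i"] m subsetD[OF J(1)] by (simp add: coord_diff)
    qed
    then show ?thesis using st(1) by blast
  qed
  then obtain a where a: "\<And>i. i \<in> {1..m} \<Longrightarrow> a i \<in> S"
    "\<And>i l. i \<in> {1..m} \<Longrightarrow> l \<in> {1..m} \<Longrightarrow> coord e (entry N J l) (a i) = (if l = i then 1 else 0)"
    by metis
  have "vec.span (a ` {1..m}) = S"
  proof
    show "vec.span (a ` {1..m}) \<subseteq> S"
      using a(1) S by (intro vec.span_minimal) auto
    show "S \<subseteq> vec.span (a ` {1..m})"
    proof
      fix x assume x: "x \<in> S"
      define y where "y = (\<Sum>i\<in>{1..m}. coord e (entry N J i) x *s a i)"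
      have "x - y \<in> S" unfolding y_def
        using x a(1) S by (intro vec.subspace_diff vec.subspace_sum vec.subspace_scale) auto
      moreover have "x - y \<in> E ({1..N} - J)"
      proof (rule mem_E_I)
        fix j assume "j \<in> {1..N}" "j \<notin> {1..N} - J"
        then have "j \<in> J" by simp
        then obtain l where l: "l \<in> {1..m}" "j = entry N J l"
          using bij by (metis bij_betw_imp_surj_on imageE)
        have "coord e j y = (\<Sum>i\<in>{1..m}. coord e (entry N J i) x * (if l = i then 1 else 0))"
          unfolding y_def coord_sum coord_scale l(2) using a(2) l(1) by (intro sum.cong) auto
        also have "\<dots> = (\<Sum>i\<in>{1..m}. if l = i then coord e (entry N J i) x else 0)"
          by (rule sum.cong) auto
        also have "\<dots> = coord e j x" using l by simp
        finally show "coord e j (x - y) = 0" by (simp add: coord_diff)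
      qed
      ultimately have "x = y" using tr by auto
      moreover have "y \<in> vec.span (a ` {1..m})"
        unfolding y_def by (intro vec.span_sum vec.span_scale vec.span_base imageI)
      ultimately show "x \<in> vec.span (a ` {1..m})" by simp
    qed
  qed
  moreover have "pluecker e m a J = 1"
    unfolding pluecker_def N_eq[symmetric]
    by (rule permutation_sum_identity) (auto simp: a(2))
  ultimately show ?thesis by auto
qed

text \<open>A choice of pivots adapted to \<open>A\<close>: \<open>K\<close> is a maximal
  transversal index set inside \<open>A\<close>, \<open>L\<close> extends it within
  \<open>{1..N}\<close>, and \<open>J\<close> is the complement of \<open>L\<close>. Then
  \<open>J \<inter> A = A - K\<close> has exactly \<open>vec.dim (S \<inter> E A)\<close>
  elements.\<close>

lemma exists_pluecker_neq_0_if_dim_less: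
  assumes S: "vec.subspace S" and dim: "vec.dim S = m" and A: "A \<subseteq> {1..N}"
    and q: "vec.dim (S \<inter> E A) < q"
  shows "\<exists>J a. J \<subseteq> {1..N} \<and> card J = m \<and> m < card (J - A) + q
    \<and> vec.span (a ` {1..m}) = S \<and> pluecker e m a J \<noteq> 0"
proof -
  have "S \<inter> E {} \<subseteq> {0}" using E_disjoint_eq_0[of _ "{}"] by auto
  from exists_maximal_transversal[OF A empty_subsetI this]
  obtain K where K: "K \<subseteq> A" "S \<inter> E K \<subseteq> {0}"
    "\<forall>i\<in>A - K. \<not> S \<inter> E (insert i K) \<subseteq> {0}"
    by blast
  have dA: "vec.dim (S \<inter> E A) + card K = card A"
    by (rule maximal_transversal_complement(1)[OF S A K(1,2)]) (use K(3) in blast)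
  have "K \<subseteq> {1..N}" using K(1) A by simp
  from exists_maximal_transversal[OF subset_refl this K(2)]
  obtain L where L: "K \<subseteq> L" "L \<subseteq> {1..N}" "S \<inter> E L \<subseteq> {0}"
    "\<forall>i\<in>{1..N} - L. \<not> S \<inter> E (insert i L) \<subseteq> {0}"
    by blast
  have "vec.dim (S \<inter> E {1..N}) + card L = card {1..N}"
    by (rule maximal_transversal_complement(1)[OF S subset_refl L(2,3)]) (use L(4) in blast)
  then have cL: "m + card L = N" using E_UNIV[of "{1..N}"] dim by simp
  \<comment> \<open>The extension cannot pick up further indices of \<open>A\<close>, by maximality
    of \<open>K\<close>.\<close>
  have "A \<inter> L \<subseteq> K"
  proof
    fix i assume i: "i \<in> A \<inter> L"
    show "i \<in> K"
    proof (rule ccontr)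
      assume "i \<notin> K"
      moreover have "E (insert i K) \<subseteq> E L" using i L(1) by (intro E_mono) auto
      ultimately show False using K(3) L(3) i by blast
    qed
  qed
  then have AL: "A \<inter> L = K" using K(1) L(1) by blast
  define J where "J = {1..N} - L"
  have fin: "finite L" "finite A" using L(2) A finite_subset by blast+
  have J: "J \<subseteq> {1..N}" "card J = m"
    using cL L(2) fin by (auto simp: J_def card_Diff_subset)
  have "J \<inter> A = A - K" using A AL by (auto simp: J_def)
  then have "card (J \<inter> A) = vec.dim (S \<inter> E A)"
    using dA K(1) fin by (simp add: card_Diff_subset finite_subset[OF K(1)])
  moreover have "finite J" using J(1) finite_subset by blast
  then have "card (J - A) = m - card (J \<inter> A)" "card (J \<inter> A) \<le> m"
    using J(2) by (auto simp: card_Diff_subset_Int card_mono)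
  ultimately have "m < card (J - A) + q" using q by linarith
  moreover have "{1..N} - J = L" using L(2) by (auto simp: J_def)
  then have "\<exists>a. vec.span (a ` {1..m}) = S \<and> pluecker e m a J \<noteq> 0"
    using exists_spanning_pluecker_neq_0[OF S dim J] L(3) by simp
  ultimately show ?thesis using J by blast
qed

text \<open>\<open>J\<close> meets \<open>A\<close> in fewer than \<open>q\<close> indices, so
  \<open>E (A - J)\<close> has codimension less than \<open>q\<close> in \<open>E A\<close> and must
  meet \<open>S \<inter> E A\<close>.\<close>

lemma pluecker_eq_0_if_dim_ge:
  assumes S: "vec.subspace S" and dim: "vec.dim S = m" and A: "A \<subseteq> {1..N}"
    and q: "q \<le> vec.dim (S \<inter> E A)"
    and J: "J \<subseteq> {1..N}" "card J = m" "m < card (J - A) + q"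
    and span: "vec.span (a ` {1..m}) = S"
  shows "pluecker e m a J = 0"
proof -
  have fin: "finite J" "finite A" using J(1) A finite_subset by blast+
  have "card (J - A) + card (J \<inter> A) = m"
    using J(2) fin by (metis Int_commute add.commute card_Int_Diff)
  then have "card (J \<inter> A) < q" using J(3) by simp
  moreover have "card (A - J) + card (J \<inter> A) = card A"
    using fin by (metis Int_commute add.commute card_Int_Diff)
  ultimately have "vec.dim (E A) < vec.dim (S \<inter> E A) + vec.dim (E (A - J))"
    using q dim_E[OF A] dim_E[of "A - J"] A by (simp add: subset_iff)
  then obtain x where x: "x \<in> S \<inter> E A" "x \<in> E (A - J)" "x \<noteq> 0"
    using Int_nonzero_if_dim[of "S \<inter> E A" "E (A - J)" "E A"] E_mono[of "A - J" A] S
    by (auto simp: vec.subspace_inter)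
  have "E (A - J) \<subseteq> E ({1..N} - J)" using A by (intro E_mono) auto
  then show ?thesis
    using x by (intro pluecker_eq_0[OF span dim J(1,2)]) auto
qed

text \<open>By the two preceding lemmas the rank condition amounts to the vanishing of certain
  single Pluecker coordinates, hence is closed.\<close>

lemma dim_ge_on_zariski_closure:
  assumes C: "C \<subseteq> isotropic_grassmannian \<omega> m" and A: "A \<subseteq> {1..N}"
    and q: "\<And>S. S \<in> C \<Longrightarrow> q \<le> vec.dim (S \<inter> E A)"
    and S: "S \<in> zariski_closure \<omega> e m C"
  shows "q \<le> vec.dim (S \<inter> E A)"
proof -
  \<comment> \<open>For \<open>card J = m\<close> the inequality says
    \<open>card (J \<inter> A) < q\<close>.\<close>
  define JJ where "JJ = {J. J \<subseteq> {1..N} \<and> card J = m \<and> m < card (J - A) + q}"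
  define F :: "((nat set \<Rightarrow> complex) \<Rightarrow> complex) set" where "F = (\<lambda>J v. v J) ` JJ"
  define B where "B = {S \<in> isotropic_grassmannian \<omega> m. \<forall>f\<in>F. vanishes_at e m f S}"
  have "\<exists>d. homogeneous_poly {J. J \<subseteq> {1..CARD('k)} \<and> card J = m} d f" if f: "f \<in> F" for f
  proof -
    obtain J where J: "J \<in> JJ" "f = (\<lambda>v. v J)" using f unfolding F_def by blast
    have "homogeneous_poly {J. J \<subseteq> {1..CARD('k)} \<and> card J = m} 1 f"
      unfolding J(2) by (rule homogeneous_poly.var) (use J(1) in \<open>auto simp: JJ_def N_eq\<close>)
    then show ?thesis by blast
  qed
  then have "zariski_closed \<omega> e m B"
    unfolding zariski_closed_def B_def by blast
  moreover have "C \<subseteq> B"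
  proof
    fix S assume SC: "S \<in> C"
    then have SG: "S \<in> isotropic_grassmannian \<omega> m" using C by blast
    then have S: "vec.subspace S" "vec.dim S = m" by (auto simp: isotropic_grassmannian_def)
    have "vanishes_at e m f S" if f: "f \<in> F" for f
    proof -
      obtain J where J: "J \<in> JJ" "f = (\<lambda>v. v J)" using f unfolding F_def by blast
      show ?thesis
        unfolding vanishes_at_def J(2)
        using pluecker_eq_0_if_dim_ge[OF S A q[OF SC]] J(1) by (auto simp: JJ_def)
    qed
    then show "S \<in> B" using SG by (simp add: B_def)
  qed
  ultimately have SB: "S \<in> B" using S unfolding zariski_closure_def by blast
  then have Sm: "vec.subspace S" "vec.dim S = m" by (auto simp: B_def isotropic_grassmannian_def)
  show ?thesis
  proof (rule ccontr)
    assume "\<not> q \<le> vec.dim (S \<inter> E A)"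
    then obtain J a where J: "J \<subseteq> {1..N}" "card J = m" "m < card (J - A) + q"
      "vec.span (a ` {1..m}) = S" "pluecker e m a J \<noteq> 0"
      using exists_pluecker_neq_0_if_dim_less[OF Sm A, of q] by (metis not_le)
    have "vanishes_at e m (\<lambda>v. v J) S"
      using SB J(1-3) by (auto simp: B_def F_def JJ_def)
    then show False using J(4,5) by (auto simp: vanishes_at_def)
  qed
qed

end

section \<open>Richardson varieties for all three types\<close>

context coordinates
begin

lemma split_if_dim:
  assumes S: "vec.subspace S"
    and dim: "vec.dim S + vec.dim (S \<inter> E (A \<inter> B)) \<le> vec.dim (S \<inter> E A) + vec.dim (S \<inter> E B)"
    and x: "x \<in> S"
  obtains y z where "y \<in> S" "y \<in> E A" "z \<in> S" "z \<in> E B" "x = y + z"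
proof -
  have "S \<inter> E A \<inter> (S \<inter> E B) = S \<inter> E (A \<inter> B)" using E_Int by blast
  then have "vec.dim S + vec.dim (S \<inter> E A \<inter> (S \<inter> E B)) \<le> vec.dim (S \<inter> E A) + vec.dim (S \<inter> E B)"
    using dim by (simp only:)
  note le = this
  have "vec.subspace (S \<inter> E A)" "vec.subspace (S \<inter> E B)"
    using S by (simp_all add: vec.subspace_inter)
  from sum_decomposition_if_dim[OF this S Int_lower1 Int_lower1 le x]
  obtain y z where "y \<in> S \<inter> E A" "z \<in> S \<inter> E B" "x = y + z" by blast
  then show thesis using that by blast
qed

lemma split_if_disjoint:
  assumes S: "vec.subspace S" and dim: "vec.dim S \<le> vec.dim (S \<inter> E A) + vec.dim (S \<inter> E B)"
    and AB: "A \<inter> B \<inter> {1..N} = {}" and x: "x \<in> S"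
  obtains y z where "y \<in> S" "y \<in> E A" "z \<in> S" "z \<in> E B" "x = y + z"
proof -
  have "S \<inter> E (A \<inter> B) \<subseteq> {0}" using E_disjoint_eq_0 AB by blast
  then have "vec.dim (S \<inter> E (A \<inter> B)) = 0" by (simp only: vec.dim_eq_0)
  then have "vec.dim S + vec.dim (S \<inter> E (A \<inter> B)) \<le> vec.dim (S \<inter> E A) + vec.dim (S \<inter> E B)"
    using dim by linarith
  then show thesis using split_if_dim[OF S _ x] that by blast
qed

lemma dim_Int_E_add_le:
  assumes S: "vec.subspace S"
  shows "vec.dim (S \<inter> E A) + vec.dim (S \<inter> E B) \<le> vec.dim S + vec.dim (S \<inter> E (A \<inter> B))"
proof -
  have "S \<inter> E A \<inter> (S \<inter> E B) = S \<inter> E (A \<inter> B)" using E_Int by blast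
  then show ?thesis
    using dim_add_le_dim_Int[of "S \<inter> E A" "S \<inter> E B" S] S by (auto simp: vec.subspace_inter)
qed

lemma dim_Int_E_disjoint_le:
  assumes S: "vec.subspace S" and AB: "A \<inter> B \<inter> {1..N} = {}"
  shows "vec.dim (S \<inter> E A) + vec.dim (S \<inter> E B) \<le> vec.dim S"
proof -
  have "S \<inter> E (A \<inter> B) \<subseteq> {0}" using E_disjoint_eq_0 AB by blast
  then have "vec.dim (S \<inter> E (A \<inter> B)) = 0" by (simp only: vec.dim_eq_0)
  then show ?thesis using dim_Int_E_add_le[OF S, of A B] by linarith
qed

lemma card_split_at:
  assumes "X \<subseteq> {1..N}" "c \<le> N"
  shows "card X = card (X \<inter> {1..c}) + card (X \<inter> {c + 1..N})"
proof -
  have "X = (X \<inter> {1..c}) \<union> (X \<inter> {c + 1..N})" using assms by auto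
  also have "card \<dots> = card (X \<inter> {1..c}) + card (X \<inter> {c + 1..N})"
    by (rule card_Un_disjoint) auto
  finally show ?thesis .
qed

end

section \<open>Counting the entries of a symbol in an interval\<close>

lemma entry_mem:
  assumes "finite P" "1 \<le> i" "i \<le> card P"
  shows "entry N P i \<in> P"
  using bij_betw_entry[OF assms(1), of N] assms(2,3) bij_betwE by fastforce

lemma entry_mono:
  assumes "finite P" "1 \<le> i" "i \<le> j" "j \<le> card P"
  shows "entry N P i \<le> entry N P j"
  using assms by (auto simp: entry_def intro!: sorted_nth_mono)

lemma card_ge_if_entry_le:
  assumes P: "P \<subseteq> {1..N}" and i: "i \<le> card P" and c: "entry N P i \<le> c"
  shows "i \<le> card (P \<inter> {1..c})"
proof -
  have fin: "finite P" using P finite_subset by blast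
  have "entry N P ` {1..i} \<subseteq> P \<inter> {1..c}"
  proof
    fix x assume "x \<in> entry N P ` {1..i}"
    then obtain j where j: "1 \<le> j" "j \<le> i" "x = entry N P j" by auto
    then have "x \<in> P" "x \<le> c"
      using entry_mem[OF fin, of j N] entry_mono[OF fin, of j i N] i c by auto
    then show "x \<in> P \<inter> {1..c}" using P by auto
  qed
  moreover have "inj_on (entry N P) {1..i}"
    using bij_betw_imp_inj_on[OF bij_betw_entry[OF fin, of N]] i by (auto intro: inj_on_subset)
  ultimately show ?thesis
    using card_mono[of "P \<inter> {1..c}" "entry N P ` {1..i}"] by (simp add: card_image)
qed

lemma card_le_if_less_entry:
  assumes T: "T \<subseteq> {1..N}" and i: "i \<le> card T" and c: "c < entry N T (i + 1)"
  shows "card (T \<inter> {1..c}) \<le> i"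
proof (cases "i = card T")
  \<comment> \<open>Here \<open>entry N T (i + 1)\<close> is the sentinel \<open>N + 1\<close>; no
    entry is left to compare with, and the size of \<open>T\<close> is the bound.\<close>
  case True
  have "finite T" using T finite_subset by blast
  then show ?thesis using True by (simp add: card_mono)
next
  case False
  have fin: "finite T" using T finite_subset by blast
  have "T \<inter> {1..c} \<subseteq> entry N T ` {1..i}"
  proof
    fix t assume t: "t \<in> T \<inter> {1..c}"
    then obtain j where j: "j \<in> {1..card T}" "t = entry N T j"
      using bij_betw_imp_surj_on[OF bij_betw_entry[OF fin, of N]] by blast
    have "j \<le> i"
    proof (rule ccontr)
      assume "\<not> j \<le> i"
      then have "entry N T (i + 1) \<le> t" using entry_mono[OF fin, of "i + 1" j N] j by auto
      then show False using t c by auto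
    qed
    then show "t \<in> entry N T ` {1..i}" using j by auto
  qed
  then have "card (T \<inter> {1..c}) \<le> card (entry N T ` {1..i})" by (rule card_mono[rotated]) simp
  also have "\<dots> \<le> i" using card_image_le[of "{1..i}" "entry N T"] by simp
  finally show ?thesis .
qed

text \<open>Normal form shared by all types: in the symmetric case all weights are 1, in the skew
  case they change sign in the second half. Lone stars need nonzero weights, quadrics the weights of
  the first half.\<close>

locale paired_form = coordinates e N
  for e :: "nat \<Rightarrow> complex^'k" and N +
  fixes \<omega> :: "complex^'k \<Rightarrow> complex^'k \<Rightarrow> complex" and g :: "nat \<Rightarrow> complex"
  assumes paired: "\<omega> x y = (\<Sum>i\<in>{1..N}. g i * (coord e i x * coord e (N + 1 - i) y))"
    and weight_neq_0: "i \<in> {1..N} \<Longrightarrow> g i \<noteq> 0"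
    and weight_eq_1: "i \<in> {1..N} \<Longrightarrow> 2 * i \<le> N + 1 \<Longrightarrow> g i = 1"

locale isotropic_subspace = paired_form e N \<omega> g
  for e :: "nat \<Rightarrow> complex^'k" and N \<omega> g +
  fixes S :: "(complex^'k) set"
  assumes subspace_S: "vec.subspace S"
    and isotropic_S: "x \<in> S \<Longrightarrow> y \<in> S \<Longrightarrow> \<omega> x y = 0"
begin

text \<open>Up to a scalar \<open>w\<close> is \<open>e c\<close>, and pairing with it reads off the
  opposite coordinate.\<close>

lemma coord_bar_eq_0_if_line:
  assumes w: "w \<in> S" "w \<in> E {c}" "w \<noteq> 0" and c: "c \<in> {1..N}" and x: "x \<in> S"
  shows "coord e (N + 1 - c) x = 0"
proof -
  have wc: "coord e c w \<noteq> 0"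
  proof
    assume "coord e c w = 0"
    then have "w \<in> E ({c} - {c})" by (rule mem_E_Diff[OF w(2)])
    then show False using E_disjoint_eq_0[of w "{}"] w(3) by simp
  qed
  have "\<omega> w x = (\<Sum>i\<in>{1..N}. if i = c then g i * (coord e i w * coord e (N + 1 - i) x) else 0)"
    unfolding paired using mem_E_D[OF w(2)] by (intro sum.cong) auto
  then have "g c * (coord e c w * coord e (N + 1 - c) x) = 0"
    using isotropic_S[OF w(1) x] c by simp
  then show ?thesis using wc weight_neq_0[OF c] by simp
qed

text \<open>The truncated quadric at \<open>y + z\<close> is \<open>\<omega> y z\<close>: with
  \<open>d = c\<close> the pairing stops after \<open>c\<close> because of the support of
  \<open>y\<close>, with \<open>d = N - c\<close> because of the support of \<open>z\<close>, and
  \<open>2 * c \<le> N\<close> removes all other products.\<close>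

lemma quadric_eq_0_if_split:
  assumes c: "2 * c \<le> N" and y: "y \<in> S" "y \<in> E {1..d}" and z: "z \<in> S" "z \<in> E {d + 1..N}"
    and d: "d = c \<or> d = N - c"
  shows "(\<Sum>i\<in>{1..c}. coord e i (y + z) * coord e (N + 1 - i) (y + z)) = 0"
proof -
  have z0: "coord e i z = 0" if "i \<in> {1..c}" for i
    using that d c by (intro mem_E_D[OF z(2)]) auto
  have y0: "coord e (N + 1 - i) y = 0" if "i \<in> {1..c}" for i
    using that d c by (intro mem_E_D[OF y(2)]) auto
  have yz0: "coord e i y * coord e (N + 1 - i) z = 0" if i: "i \<in> {1..N}" "i \<notin> {1..c}" for i
    using d
  proof
    assume "d = c"
    then have "coord e i y = 0" using i by (intro mem_E_D[OF y(2)]) auto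
    then show ?thesis by simp
  next
    assume "d = N - c"
    then have "coord e (N + 1 - i) z = 0" using i by (intro mem_E_D[OF z(2)]) auto
    then show ?thesis by simp
  qed
  have "(\<Sum>i\<in>{1..c}. coord e i (y + z) * coord e (N + 1 - i) (y + z))
      = (\<Sum>i\<in>{1..c}. g i * (coord e i y * coord e (N + 1 - i) z))"
    using y0 z0 weight_eq_1 c by (intro sum.cong) (auto simp: coord_add)
  also have "\<dots> = (\<Sum>i\<in>{1..N}. g i * (coord e i y * coord e (N + 1 - i) z))"
    by (rule sum.mono_neutral_left) (use c yz0 in auto)
  also have "\<dots> = 0" using isotropic_S[OF y(1) z(1)] unfolding paired .
  finally show ?thesis .
qed

end

locale richardson_point = isotropic_subspace e N \<omega> g S
  for e :: "nat \<Rightarrow> complex^'k" and N \<omega> g S +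
  fixes m :: nat and P T :: "nat set"
  assumes dim_S: "vec.dim S = m"
    and P_subset: "P \<subseteq> {1..N}" and T_subset: "T \<subseteq> {1..N}"
    and card_P: "card P = m" and card_T: "card T = m"
    and P_symbol: "\<forall>c\<in>P. \<forall>d\<in>P. c + d \<noteq> N + 1"
    and T_symbol: "\<forall>c\<in>T. \<forall>d\<in>T. c + d \<noteq> N + 1"
    and dim_initial: "c \<le> N \<Longrightarrow> card (P \<inter> {1..c}) \<le> vec.dim (S \<inter> E {1..c})"
    and dim_final: "c \<le> N \<Longrightarrow> card (T \<inter> {c + 1..N}) \<le> vec.dim (S \<inter> E {c + 1..N})"
begin

lemma card_final_ge:
  assumes "i \<le> m" "c < entry N T (i + 1)" "c \<le> N"
  shows "m \<le> i + card (T \<inter> {c + 1..N})"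
  using card_le_if_less_entry[OF T_subset, of i c] card_split_at[OF T_subset assms(3)] assms card_T
  by simp

text \<open>The inequality is a splitting criterion: with \<open>dim_initial\<close> and
  \<open>dim_final\<close> it makes \<open>S\<close> the sum of its parts supported on
  \<open>{1..c}\<close> and on \<open>{c + 1..N}\<close>.\<close>

lemma visible_cut_card:
  assumes "c \<in> visible_cuts N m P T"
  shows "c \<le> N" "m \<le> card (P \<inter> {1..c}) + card (T \<inter> {c + 1..N})"
proof -
  obtain i where i: "c \<le> N" "i \<le> m" "entry N P i \<le> c" "c < entry N T (i + 1)"
    using assms by (auto simp: visible_cuts_def)
  show "c \<le> N" by (rule i(1))
  show "m \<le> card (P \<inter> {1..c}) + card (T \<inter> {c + 1..N})"
    using card_ge_if_entry_le[OF P_subset _ i(3)] card_final_ge[OF i(2,4,1)] i(2) card_P by simp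
qed

text \<open>Splitting with a gap: both summands miss column \<open>c\<close>.\<close>

lemma coord_eq_0_if_card:
  assumes c: "c \<in> {1..N}" and ge: "m \<le> card (P \<inter> {1..c - 1}) + card (T \<inter> {c + 1..N})"
    and x: "x \<in> S"
  shows "coord e c x = 0"
proof -
  have "c - 1 \<le> N" "c \<le> N" using c by auto
  then have "vec.dim S \<le> vec.dim (S \<inter> E {1..c - 1}) + vec.dim (S \<inter> E {c + 1..N})"
    using dim_initial[of "c - 1"] dim_final[of c] ge dim_S by linarith
  then obtain y z where yz: "y \<in> E {1..c - 1}" "z \<in> E {c + 1..N}" "x = y + z"
    by (rule split_if_disjoint[OF subspace_S _ _ x]) auto
  have "coord e c y = 0" by (rule mem_E_D[OF yz(1) c]) (use c in auto)
  moreover have "coord e c z = 0" by (rule mem_E_D[OF yz(2) c]) auto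
  ultimately show ?thesis unfolding yz(3) by (simp add: coord_add)
qed

lemma zero_column_coord:
  assumes c: "c \<in> {1..N}" and zero: "zero_column N m P T c" and x: "x \<in> S"
  shows "coord e c x = 0"
proof -
  obtain j where j: "j \<le> m" "entry N P j < c" "c < entry N T (j + 1)"
    using zero by (auto simp: zero_column_def)
  have "j \<le> card (P \<inter> {1..c - 1})"
    by (rule card_ge_if_entry_le[OF P_subset]) (use j card_P in auto)
  moreover have "m \<le> j + card (T \<inter> {c + 1..N})"
    by (rule card_final_ge) (use j c in auto)
  ultimately show ?thesis using coord_eq_0_if_card[OF c _ x] by simp
qed

text \<open>Overlap instead of a gap: the two intersections have total dimension at least
  \<open>m + 1\<close>, so they share a nonzero vector, necessarily a multiple of
  \<open>e c\<close>.\<close>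

lemma coord_bar_eq_0_if_card:
  assumes c: "c \<in> {1..N}" and ge: "m + 1 \<le> card (P \<inter> {1..c}) + card (T \<inter> {c..N})" and x: "x \<in> S"
  shows "coord e (N + 1 - c) x = 0"
proof -
  have cap: "{1..c} \<inter> {c..N} = {c}" using c by auto
  have "c - 1 + 1 = c" "c - 1 \<le> N" "c \<le> N" using c by auto
  then have "0 < vec.dim (S \<inter> E {c})"
    using dim_initial[of c] dim_final[of "c - 1"] ge dim_S
      dim_Int_E_add_le[OF subspace_S, of "{1..c}" "{c..N}"] unfolding cap by simp
  then obtain w where "w \<in> S" "w \<in> E {c}" "w \<noteq> 0" using exists_nonzero_if_dim_pos by blast
  then show ?thesis using coord_bar_eq_0_if_line c x by blast
qed

lemma bar_notin_symbol:
  assumes "\<forall>c\<in>Q. \<forall>d\<in>Q. c + d \<noteq> N + 1" "c \<in> Q" "c \<in> {1..N}"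
  shows "N + 1 - c \<notin> Q"
proof
  assume "N + 1 - c \<in> Q"
  then have "c + (N + 1 - c) \<noteq> N + 1" using assms(1,2) by blast
  then show False using assms(3) by simp
qed

text \<open>A visible cut at \<open>c\<close> puts the line of \<open>e c\<close> into
  \<open>S\<close>. A visible cut at \<open>N - c\<close> yields the same equation through a gap at
  column \<open>N + 1 - c\<close>, because that column is not in \<open>T\<close>.\<close>

lemma apparent_lone_star_T:
  assumes cT: "c \<in> T" and cut: "c \<in> apparent_cuts N m P T" and x: "x \<in> S"
  shows "coord e (N + 1 - c) x = 0"
proof -
  have c: "c \<in> {1..N}" using cT T_subset by blast
  have c': "N + 1 - c \<in> {1..N}" using c by auto
  consider "c \<in> visible_cuts N m P T" | "N - c \<in> visible_cuts N m P T"
    using cut by (auto simp: apparent_cuts_def)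
  then show ?thesis
  proof cases
    case 1
    have "T \<inter> {c..N} = insert c (T \<inter> {c + 1..N})" using cT c by auto
    then have "card (T \<inter> {c..N}) = card (T \<inter> {c + 1..N}) + 1" by simp
    then show ?thesis using coord_bar_eq_0_if_card[OF c _ x] visible_cut_card(2)[OF 1] by simp
  next
    case 2
    have "N - c + 1 = N + 1 - c" "N + 1 - c - 1 = N - c" using c by auto
    moreover have "{N + 1 - c..N} = insert (N + 1 - c) {N + 1 - c + 1..N}" using c by auto
    then have "T \<inter> {N + 1 - c..N} = T \<inter> {N + 1 - c + 1..N}"
      using bar_notin_symbol[OF T_symbol cT c] by simp
    ultimately show ?thesis
      using coord_eq_0_if_card[OF c' _ x] visible_cut_card(2)[OF 2] by simp
  qed
qed

text \<open>With a visible cut at \<open>c - 1\<close> the overlap is again at column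
  \<open>c\<close>, which is now counted by \<open>P\<close>; the gap at \<open>N + 1 - c\<close>
  arises because \<open>P\<close> omits that column.\<close>

lemma apparent_lone_star_P:
  assumes cP: "c \<in> P" and cut: "c - 1 \<in> apparent_cuts N m P T" and x: "x \<in> S"
  shows "coord e (N + 1 - c) x = 0"
proof -
  have c: "c \<in> {1..N}" using cP P_subset by blast
  have c': "N + 1 - c \<in> {1..N}" using c by auto
  consider "c - 1 \<in> visible_cuts N m P T" | "N - (c - 1) \<in> visible_cuts N m P T"
    using cut by (auto simp: apparent_cuts_def)
  then show ?thesis
  proof cases
    case 1
    have "P \<inter> {1..c} = insert c (P \<inter> {1..c - 1})" using cP c by auto
    moreover have "c \<notin> P \<inter> {1..c - 1}" using c by auto
    ultimately have "card (P \<inter> {1..c}) = card (P \<inter> {1..c - 1}) + 1" by simp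
    moreover have "c - 1 + 1 = c" using c by simp
    ultimately show ?thesis using coord_bar_eq_0_if_card[OF c _ x] visible_cut_card(2)[OF 1] by simp
  next
    case 2
    have "N - (c - 1) = N + 1 - c" using c by auto
    moreover have "{1..N + 1 - c} = insert (N + 1 - c) {1..N + 1 - c - 1}" using c by auto
    then have "P \<inter> {1..N + 1 - c} = P \<inter> {1..N + 1 - c - 1}"
      using bar_notin_symbol[OF P_symbol cP c] by simp
    ultimately show ?thesis
      using coord_eq_0_if_card[OF c' _ x] visible_cut_card(2)[OF 2] by simp
  qed
qed

lemma apparent_quadric:
  assumes c: "2 * c \<le> N" and cut: "c \<in> apparent_cuts N m P T" and x: "x \<in> S"
  shows "(\<Sum>i\<in>{1..c}. coord e i x * coord e (N + 1 - i) x) = 0"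
proof -
  obtain d where d: "d \<in> visible_cuts N m P T" "d = c \<or> d = N - c"
    using cut by (auto simp: apparent_cuts_def)
  have "vec.dim S \<le> vec.dim (S \<inter> E {1..d}) + vec.dim (S \<inter> E {d + 1..N})"
    using visible_cut_card[OF d(1)] dim_initial[of d] dim_final[of d] dim_S by linarith
  then obtain y z where "y \<in> S" "y \<in> E {1..d}" "z \<in> S" "z \<in> E {d + 1..N}" "x = y + z"
    by (rule split_if_disjoint[OF subspace_S _ _ x]) auto
  then show ?thesis using quadric_eq_0_if_split[OF c _ _ _ _ d(2)] by simp
qed

end

section \<open>Families of maximal isotropic subspaces\<close>

declare add_2_eq_Suc [simp del] add_2_eq_Suc' [simp del]

text \<open>In a space of dimension \<open>2 * (n + 1 - c)\<close> with basis indexed by \<open>{c + 1..N - c}\<close>, \<open>N = 2 * n + 2\<close>,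
  these index sets span the maximal isotropic coordinate subspaces.\<close>

definition lagrangian_indices :: "nat \<Rightarrow> nat \<Rightarrow> nat set \<Rightarrow> bool" where
  "lagrangian_indices n c J \<longleftrightarrow> J \<subseteq> {c + 1..2 * n + 2 - c} \<and>
     (\<forall>i\<in>{c + 1..2 * n + 2 - c}. i \<in> J \<longleftrightarrow> 2 * n + 3 - i \<notin> J)"

text \<open>For \<open>j \<in> J\<close> the coordinate subspaces of \<open>J\<close> and
  \<open>flip n j J\<close> meet in codimension one; this is the elementary step from one family to
  the other.\<close>

definition flip :: "nat \<Rightarrow> nat \<Rightarrow> nat set \<Rightarrow> nat set" where
  "flip n j J = insert (2 * n + 3 - j) (J - {j})"

lemma lagrangian_indices_range:
  "lagrangian_indices n c J \<Longrightarrow> i \<in> J \<Longrightarrow> c < i \<and> i + c \<le> 2 * n + 2"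
  unfolding lagrangian_indices_def by fastforce

lemma lagrangian_indices_iff:
  "lagrangian_indices n c J \<Longrightarrow> c < i \<Longrightarrow> i + c \<le> 2 * n + 2 \<Longrightarrow> i \<in> J \<longleftrightarrow> 2 * n + 3 - i \<notin> J"
  unfolding lagrangian_indices_def by auto

text \<open>The equivalence is symmetric under \<open>i \<mapsto> 2 * n + 3 - i\<close>, so half of
  the range suffices.\<close>

lemma lagrangian_indicesI:
  assumes "\<And>i. i \<in> J \<Longrightarrow> c < i \<and> i + c \<le> 2 * n + 2"
    and "\<And>i. c < i \<Longrightarrow> i \<le> n + 1 \<Longrightarrow> i \<in> J \<longleftrightarrow> 2 * n + 3 - i \<notin> J"
  shows "lagrangian_indices n c J"
  unfolding lagrangian_indices_def
proof (intro conjI ballI)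
  show "J \<subseteq> {c + 1..2 * n + 2 - c}" using assms(1) by fastforce
  fix i assume i: "i \<in> {c + 1..2 * n + 2 - c}"
  show "i \<in> J \<longleftrightarrow> 2 * n + 3 - i \<notin> J"
  proof (cases "i \<le> n + 1")
    case True
    then show ?thesis using assms(2)[of i] i by auto
  next
    case False
    then have "2 * n + 3 - (2 * n + 3 - i) = i" "c < 2 * n + 3 - i" "2 * n + 3 - i \<le> n + 1"
      using i by auto
    then show ?thesis using assms(2)[of "2 * n + 3 - i"] by auto
  qed
qed

lemma finite_lagrangian_indices: "lagrangian_indices n c J \<Longrightarrow> finite J"
  unfolding lagrangian_indices_def using finite_subset by blast

text \<open>Reflection identifies the part of \<open>J\<close> beyond \<open>n + 1\<close> with the
  part of the lower half that \<open>J\<close> omits.\<close>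

lemma card_lagrangian_indices:
  assumes J: "lagrangian_indices n c J"
  shows "card J = n + 1 - c"
proof -
  let ?H = "{c + 1..n + 1}" and ?b = "\<lambda>i. 2 * n + 3 - i"
  have eq: "J - ?H = ?b ` (?H - J)"
  proof (intro equalityI subsetI)
    fix i assume i: "i \<in> J - ?H"
    then have r: "c < i" "i + c \<le> 2 * n + 2" using lagrangian_indices_range[OF J] by auto
    then have "?b i \<notin> J" using lagrangian_indices_iff[OF J, of i] i by simp
    then have "?b i \<in> ?H - J" "i = ?b (?b i)" using r i by auto
    then show "i \<in> ?b ` (?H - J)" by blast
  next
    fix i assume "i \<in> ?b ` (?H - J)"
    then obtain h where h: "h \<in> ?H" "h \<notin> J" "i = ?b h" by blast
    then have "?b h \<in> J" using lagrangian_indices_iff[OF J, of h] by auto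
    then show "i \<in> J - ?H" using h by auto
  qed
  have "inj_on ?b (?H - J)" by (rule inj_onI) auto
  then have "card (J - ?H) = card (?H - J)" unfolding eq by (rule card_image)
  moreover have "card J = card (J - ?H) + card (J \<inter> ?H)"
    using finite_lagrangian_indices[OF J] by (metis add.commute card_Int_Diff)
  moreover have "card ?H = card (?H - J) + card (J \<inter> ?H)"
    by (metis Int_commute add.commute card_Int_Diff finite_atLeastAtMost)
  ultimately show ?thesis by simp
qed

lemma lagrangian_indices_half: "c \<le> n + 1 \<Longrightarrow> lagrangian_indices n c {c + 1..n + 1}"
  by (rule lagrangian_indicesI) auto

lemma lagrangian_indices_complement:
  assumes J: "lagrangian_indices n c J"
  shows "lagrangian_indices n c ({c + 1..2 * n + 2 - c} - J)"
proof (rule lagrangian_indicesI)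
  fix i assume i: "c < i" "i \<le> n + 1"
  then show "(i \<in> {c + 1..2 * n + 2 - c} - J) = (2 * n + 3 - i \<notin> {c + 1..2 * n + 2 - c} - J)"
    using lagrangian_indices_iff[OF J, of i] by auto
qed auto

lemma lagrangian_indices_flip:
  assumes J: "lagrangian_indices n c J" and j: "j \<in> J"
  shows "lagrangian_indices n c (flip n j J)"
  unfolding flip_def
proof (rule lagrangian_indicesI)
  have rj: "c < j" "j + c \<le> 2 * n + 2" using lagrangian_indices_range[OF J j] by auto
  fix i
  show "c < i \<and> i + c \<le> 2 * n + 2" if "i \<in> insert (2 * n + 3 - j) (J - {j})"
    using that rj lagrangian_indices_range[OF J, of i] by auto
  assume i: "c < i" "i \<le> n + 1"
  have "2 * n + 3 - i = j \<longleftrightarrow> i = 2 * n + 3 - j"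
    "2 * n + 3 - i = 2 * n + 3 - j \<longleftrightarrow> i = j"
    using i rj by linarith+
  moreover have "2 * n + 3 - j \<noteq> j" using rj by presburger
  moreover have "2 * n + 3 - j \<notin> J" using lagrangian_indices_iff[OF J rj] j by simp
  ultimately show "(i \<in> insert (2 * n + 3 - j) (J - {j})) = (2 * n + 3 - i \<notin> insert (2 * n + 3 - j) (J - {j}))"
    using lagrangian_indices_iff[OF J, of i] i by auto
qed

text \<open>Of \<open>j\<close> and its partner exactly one is at most \<open>n + 1\<close>.\<close>

lemma flip_parity:
  assumes J: "lagrangian_indices n c J" and j: "j \<in> J"
  shows "even (card (flip n j J \<inter> {c + 1..n + 1})) \<longleftrightarrow> odd (card (J \<inter> {c + 1..n + 1}))"
proof -
  let ?H = "{c + 1..n + 1}"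
  have rj: "c < j" "j + c \<le> 2 * n + 2" using lagrangian_indices_range[OF J j] by auto
  have nj: "2 * n + 3 - j \<notin> J" using lagrangian_indices_iff[OF J rj] j by simp
  show ?thesis
  proof (cases "j \<le> n + 1")
    case True
    then have "J \<inter> ?H = insert j (flip n j J \<inter> ?H)" "j \<notin> flip n j J"
      using rj j by (auto simp: flip_def)
    then show ?thesis by simp
  next
    case False
    then have "flip n j J \<inter> ?H = insert (2 * n + 3 - j) (J \<inter> ?H)"
      using rj by (auto simp: flip_def)
    then show ?thesis using nj by simp
  qed
qed

text \<open>Termination measure for the induction on transversal index sets. The first flip brings
  \<open>b\<close> into \<open>K\<close>, and both flips remove only indices outside
  \<open>J\<close>.\<close>

lemma Diff_flip_flip_less:
  assumes J: "lagrangian_indices n c J" and K: "lagrangian_indices n c K"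
    and b: "b \<in> J - K" and i: "i \<in> flip n (2 * n + 3 - b) K" "i \<notin> J"
  shows "card (J - flip n i (flip n (2 * n + 3 - b) K)) < card (J - K)"
proof (rule psubset_card_mono)
  have rb: "c < b" "b + c \<le> 2 * n + 2" using lagrangian_indices_range[OF J] b by auto
  have "2 * n + 3 - b \<notin> J" using lagrangian_indices_iff[OF J rb] b by simp
  moreover have "2 * n + 3 - (2 * n + 3 - b) = b" using rb by auto
  ultimately show "J - flip n i (flip n (2 * n + 3 - b) K) \<subset> J - K"
    using b i by (auto simp: flip_def)
qed (use finite_lagrangian_indices[OF J] in auto)

section \<open>Maximal isotropic subspaces of a split quadratic space\<close>

locale split_quadric = coordinates e N
  for e :: "nat \<Rightarrow> complex^'k" and N +
  fixes n :: nat and \<omega> :: "complex^'k \<Rightarrow> complex^'k \<Rightarrow> complex"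
  assumes N_even: "N = 2 * n + 2"
    and form: "\<omega> x y = (\<Sum>i\<in>{1..N}. coord e i x * coord e (N + 1 - i) y)"
begin

lemma bar_eq: "N + 1 - i = 2 * n + 3 - i"
  by (simp add: N_even)

lemma form_add_left: "\<omega> (x + y) z = \<omega> x z + \<omega> y z"
  unfolding form coord_add distrib_right sum.distrib ..

lemma form_add_right: "\<omega> z (x + y) = \<omega> z x + \<omega> z y"
  unfolding form coord_add distrib_left sum.distrib ..

lemma form_scale_left: "\<omega> (a *s x) z = a * \<omega> x z"
  unfolding form coord_scale sum_distrib_left by (rule sum.cong) auto

lemma form_scale_right: "\<omega> z (a *s x) = a * \<omega> z x"
  unfolding form coord_scale sum_distrib_left by (rule sum.cong) auto

lemma form_diff_left: "\<omega> (x - y) z = \<omega> x z - \<omega> y z"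
  unfolding form coord_diff left_diff_distrib sum_subtractf ..

lemma form_diff_right: "\<omega> z (x - y) = \<omega> z x - \<omega> z y"
  unfolding form coord_diff right_diff_distrib sum_subtractf ..

lemma form_sym: "\<omega> x y = \<omega> y x"
  unfolding form
  by (rule sum.reindex_bij_witness[of _ "\<lambda>i. N + 1 - i" "\<lambda>i. N + 1 - i"]) auto

lemmas form_linear = form_add_left form_add_right form_scale_left form_scale_right
  form_diff_left form_diff_right

lemma form_basis_left:
  assumes "i \<in> {1..N}"
  shows "\<omega> (e i) x = coord e (N + 1 - i) x"
proof -
  have "\<omega> (e i) x = (\<Sum>j\<in>{1..N}. if j = i then coord e (N + 1 - j) x else 0)"
    unfolding form using assms by (intro sum.cong) (auto simp: coord_basis)
  then show ?thesis using assms by simp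
qed

abbreviation "lagr \<equiv> lagrangian_indices n"

lemma lagr_subset: "lagr c J \<Longrightarrow> J \<subseteq> {c + 1..N - c}"
  by (simp add: lagrangian_indices_def N_even)

lemma lagr_subset_all: "lagr c J \<Longrightarrow> J \<subseteq> {1..N}"
  using lagr_subset by fastforce

lemma dim_E_lagr: "lagr c J \<Longrightarrow> vec.dim (E J) = n + 1 - c"
  using dim_E[OF lagr_subset_all] card_lagrangian_indices by simp

lemma dim_E_middle: "c \<le> n + 1 \<Longrightarrow> vec.dim (E {c + 1..N - c}) = 2 * (n + 1 - c)"
  by (subst dim_E) (auto simp: N_even)

text \<open>No index of \<open>J\<close> other than \<open>j\<close> has its partner in the flipped
  set, so a single term of the form survives.\<close>

lemma flip_form:
  assumes J: "lagr c J" and j: "j \<in> J" and w: "w \<in> E J" and v: "v \<in> E (flip n j J)"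
  shows "\<omega> w v = coord e j w * coord e (N + 1 - j) v"
proof -
  have j1: "j \<in> {1..N}" using lagr_subset_all[OF J] j by blast
  have "\<omega> w v = (\<Sum>i\<in>{1..N}. if i = j then coord e i w * coord e (N + 1 - i) v else 0)"
    unfolding form
  proof (rule sum.cong)
    fix i assume i: "i \<in> {1..N}"
    show "coord e i w * coord e (N + 1 - i) v = (if i = j then coord e i w * coord e (N + 1 - i) v else 0)"
    proof (cases "i = j \<or> i \<notin> J")
      case True
      then show ?thesis using mem_E_D[OF w i] by auto
    next
      case False
      then have r: "c < i" "i + c \<le> 2 * n + 2" using lagrangian_indices_range[OF J, of i] by auto
      then have "2 * n + 3 - i \<notin> flip n j J"
        using lagrangian_indices_iff[OF J r] False i j1 N_even by (auto simp: flip_def)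
      then have "coord e (N + 1 - i) v = 0"
        using mem_E_D[OF v bar_mem[OF i]] unfolding bar_eq by blast
      then show ?thesis using False by simp
    qed
  qed simp
  then show ?thesis using j1 by simp
qed

lemma lagr_isotropic:
  assumes J: "lagr c J" and "x \<in> E J" "y \<in> E J"
  shows "\<omega> x y = 0"
  unfolding form
proof (rule sum.neutral, rule ballI)
  fix i assume i: "i \<in> {1..N}"
  show "coord e i x * coord e (N + 1 - i) y = 0"
  proof (cases "i \<in> J")
    case True
    then have r: "c < i" "i + c \<le> 2 * n + 2" using lagrangian_indices_range[OF J, of i] by auto
    then have "2 * n + 3 - i \<notin> J" using lagrangian_indices_iff[OF J r] True by simp
    then have "coord e (N + 1 - i) y = 0"
      using mem_E_D[OF assms(3) bar_mem[OF i]] unfolding bar_eq by blast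
    then show ?thesis by simp
  next
    case False
    then show ?thesis using mem_E_D[OF assms(2) i] by simp
  qed
qed

text \<open>Flipping \<open>a\<close> in \<open>K\<close> creates a line \<open>w\<close> in the intersection with \<open>L\<close>; flipping another index in
  the support of \<open>w\<close> restores transversality and moves \<open>K\<close> closer to \<open>J\<close>.\<close>

lemma transversal_parity:
  assumes c: "c \<le> n + 1"
    and L: "vec.subspace L" "L \<subseteq> E {c + 1..N - c}" "\<And>x y. x \<in> L \<Longrightarrow> y \<in> L \<Longrightarrow> \<omega> x y = 0"
    and dim: "vec.dim L = n + 1 - c"
    and J: "lagr c J" "L \<inter> E J \<subseteq> {0}"
    and K: "lagr c K" "L \<inter> E K \<subseteq> {0}"
  shows "even (card (J \<inter> {c + 1..n + 1}) + card (K \<inter> {c + 1..n + 1}))"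
  using K
proof (induction "card (J - K)" arbitrary: K rule: less_induct)
  case less
  show ?case
  proof (cases "J \<subseteq> K")
    case True
    then have "J = K"
      using less.prems(1) J(1) card_lagrangian_indices finite_lagrangian_indices
      by (metis card_subset_eq)
    then show ?thesis by simp
  next
    case False
    then obtain b where b: "b \<in> J - K" by blast
    define a where "a = N + 1 - b"
    have rb: "c < b" "b + c \<le> 2 * n + 2" using lagrangian_indices_range[OF J(1)] b by auto
    have ab: "b = N + 1 - a" "a \<in> {1..N}" "b \<in> {1..N}" 
      using rb by (auto simp: a_def N_even)
    have "a \<noteq> b" using rb unfolding a_def N_even by presburger
    note ab = ab this
    have aK: "a \<in> K"
      using lagrangian_indices_iff[OF less.prems(1) rb] b unfolding a_def bar_eq by blast
    have aJ: "a \<notin> J"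
      using lagrangian_indices_iff[OF J(1) rb] b unfolding a_def bar_eq by blast
    have bK: "insert b K \<subseteq> {1..N}" using lagr_subset_all[OF less.prems(1)] ab by auto
    \<comment> \<open>One index more than half the dimension forces a nonzero intersection with
      \<open>L\<close>.\<close>
    have "vec.dim (E (insert b K)) = n + 2 - c"
      using dim_E[OF bK] card_lagrangian_indices[OF less.prems(1)]
        finite_lagrangian_indices[OF less.prems(1)] b c by simp
    then have "vec.dim (E {c + 1..N - c}) < vec.dim L + vec.dim (E (insert b K))"
      using dim_E_middle[OF c] dim c by simp
    moreover have "E (insert b K) \<subseteq> E {c + 1..N - c}"
      using lagr_subset[OF less.prems(1)] rb by (intro E_mono) (auto simp: N_even)
    ultimately obtain w where w: "w \<in> L" "w \<in> E (insert b K)" "w \<noteq> 0"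
      using Int_nonzero_if_dim[OF L(1) subspace_E subspace_E L(2)] by blast
    have wb: "coord e b w \<noteq> 0"
    proof
      assume "coord e b w = 0"
      then have "w \<in> E K" using mem_E_Diff[OF w(2), of b] E_mono[of "insert b K - {b}" K] by auto
      then show False using less.prems(2) w by blast
    qed
    have fl: "flip n a K = insert b (K - {a})"
      using ab(1) unfolding flip_def bar_eq by simp
    \<comment> \<open>\<open>a\<close> and \<open>b\<close> are the only partners inside
      \<open>insert b K\<close>, so isotropy of \<open>w\<close> forces its coordinate at
      \<open>a\<close> to vanish, and \<open>w\<close> lies in the flipped subspace.\<close>
    have "\<omega> w w = 2 * (coord e b w * coord e a w)"
    proof -
      have "\<omega> w w = (\<Sum>i\<in>{1..N}. if i = a then coord e i w * coord e b w
          else if i = b then coord e i w * coord e a w else 0)"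
        unfolding form
      proof (rule sum.cong)
        fix i assume i: "i \<in> {1..N}"
        consider "i = a" | "i = b" | "i \<noteq> a" "i \<noteq> b" "i \<in> K" | "i \<noteq> b" "i \<notin> K" by blast
        then show "coord e i w * coord e (N + 1 - i) w = (if i = a then coord e i w * coord e b w
          else if i = b then coord e i w * coord e a w else 0)"
        proof cases
          case 3
          then have r: "c < i" "i + c \<le> 2 * n + 2"
            using lagrangian_indices_range[OF less.prems(1), of i] by auto
          then have "N + 1 - i \<notin> insert b K"
            using lagrangian_indices_iff[OF less.prems(1) r] 3 i ab unfolding bar_eq by auto
          then have "coord e (N + 1 - i) w = 0"
            using mem_E_D[OF w(2) bar_mem[OF i]] by blast
          then show ?thesis using 3 by simp
        next
          case 4
          then have "coord e i w = 0" using mem_E_D[OF w(2) i] by blast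
          then show ?thesis using 4 aK by auto
        next
          case 1
          then show ?thesis by (simp only: ab(1)[symmetric] if_True simp_thms)
        next
          case 2
          then show ?thesis using ab(4) by (simp only: a_def[symmetric] if_False simp_thms) simp
        qed
      qed simp
      also have "\<dots> = (\<Sum>i\<in>{1..N}. (if i = a then coord e i w * coord e b w else 0)
          + (if i = b then coord e i w * coord e a w else 0))"
        by (rule sum.cong) (use ab(4) in auto)
      also have "\<dots> = 2 * (coord e b w * coord e a w)"
        unfolding sum.distrib using ab(2,3) by simp
      finally show ?thesis .
    qed
    then have "coord e a w = 0" using L(3)[OF w(1) w(1)] wb by simp
    then have "w \<in> E (insert b K - {a})" using mem_E_Diff[OF w(2)] by blast
    then have wfl: "w \<in> E (flip n a K)"
      using ab(4) by (simp add: fl insert_Diff_if)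
    have lfl: "lagr c (flip n a K)" by (rule lagrangian_indices_flip[OF less.prems(1) aK])
    \<comment> \<open>The second flip is taken at an index in the support of \<open>w\<close> but
      outside \<open>J\<close>: the former restores transversality, the latter keeps the measure
      decreasing.\<close>
    have "w \<notin> E J" using J(2) w by blast
    then obtain i where i: "i \<in> {1..N}" "i \<notin> J" "coord e i w \<noteq> 0"
      unfolding coord_subspace_eq by blast
    have ifl: "i \<in> flip n a K" using mem_E_D[OF wfl i(1)] i(3) by blast
    let ?M = "flip n i (flip n a K)"
    have lM: "lagr c ?M" by (rule lagrangian_indices_flip[OF lfl ifl])
    have "v = 0" if v: "v \<in> L" "v \<in> E ?M" for v
    proof -
      have "coord e i w * coord e (N + 1 - i) v = 0"
        using flip_form[OF lfl ifl wfl v(2)] L(3)[OF w(1) v(1)] by simp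
      then have "coord e (N + 1 - i) v = 0" using i(3) by simp
      then have vi: "v \<in> E (flip n a K - {i})"
        using mem_E_Diff[OF v(2), of "N + 1 - i"]
          E_mono[of "?M - {N + 1 - i}" "flip n a K - {i}"] by (auto simp: flip_def bar_eq)
      \<comment> \<open>Clearing coordinate \<open>b\<close> with \<open>w\<close> moves
        \<open>v\<close> into \<open>L \<inter> E K\<close>, so \<open>v\<close> is a multiple of
        \<open>w\<close>; but its coordinate \<open>i\<close> is zero and that of \<open>w\<close>
        is not.\<close>
      define l where "l = coord e b v / coord e b w"
      have "v - l *s w \<in> L" using v w L(1) by (intro vec.subspace_diff vec.subspace_scale)
      moreover have "v - l *s w \<in> E K"
      proof (rule mem_E_I)
        fix j assume j: "j \<in> {1..N}" "j \<notin> K"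
        show "coord e j (v - l *s w) = 0"
        proof (cases "j = b")
          case True
          then show ?thesis using wb by (simp add: l_def coord_diff coord_scale)
        next
          case False
          then have "coord e j v = 0" "coord e j w = 0"
            using mem_E_D[OF vi j(1)] mem_E_D[OF wfl j(1)] j(2) by (auto simp: fl)
          then show ?thesis by (simp add: coord_diff coord_scale)
        qed
      qed
      ultimately have vl: "v = l *s w" using less.prems(2) by auto
      have "coord e i v = 0" using mem_E_D[OF vi i(1)] by blast
      then have "l = 0" using i(3) unfolding vl coord_scale by simp
      then show "v = 0" using vl by simp
    qed
    then have tM: "L \<inter> E ?M \<subseteq> {0}" by blast
    have "card (J - ?M) < card (J - K)"
      using Diff_flip_flip_less[OF J(1) less.prems(1) b, of i] i(2) ifl unfolding a_def bar_eq by blast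
    then have "even (card (J \<inter> {c + 1..n + 1}) + card (?M \<inter> {c + 1..n + 1}))"
      using less.hyps lM tM by blast
    \<comment> \<open>Two flips change the parity twice.\<close>
    then show ?thesis
      using flip_parity[OF lfl ifl] flip_parity[OF less.prems(1) aK] by simp
  qed
qed

text \<open>A minimiser of \<open>vec.dim (L \<inter> E J)\<close> works. Flipping at an index in
  the support of a nonzero \<open>w\<close> in the intersection would lose \<open>w\<close> and gain
  nothing, since orthogonality to \<open>w\<close> kills the new coordinate.\<close>

lemma exists_transversal:
  assumes c: "c \<le> n + 1" and L: "vec.subspace L" "\<And>x y. x \<in> L \<Longrightarrow> y \<in> L \<Longrightarrow> \<omega> x y = 0"
  shows "\<exists>J. lagr c J \<and> L \<inter> E J \<subseteq> {0}"
proof -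
  obtain J where J: "lagr c J" "\<And>K. lagr c K \<Longrightarrow> vec.dim (L \<inter> E J) \<le> vec.dim (L \<inter> E K)"
    using ex_has_least_nat[of "lagr c" "{c + 1..n + 1}" "\<lambda>K. vec.dim (L \<inter> E K)"]
      lagrangian_indices_half[OF c] by blast
  have "w = 0" if w: "w \<in> L" "w \<in> E J" for w
  proof (rule ccontr)
    assume "w \<noteq> 0"
    then obtain j where j: "j \<in> {1..N}" "coord e j w \<noteq> 0"
      using coord_eqI[of w 0] by (auto simp: coord_zero)
    have jJ: "j \<in> J" using mem_E_D[OF w(2) j(1)] j(2) by blast
    have sub: "L \<inter> E (flip n j J) \<subseteq> L \<inter> E (J - {j})"
    proof
      fix v assume v: "v \<in> L \<inter> E (flip n j J)"
      then have "coord e (N + 1 - j) v = 0"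
        using flip_form[OF J(1) jJ w(2), of v] L(2)[OF w(1), of v] j(2) by auto
      then show "v \<in> L \<inter> E (J - {j})"
        using mem_E_Diff[of v "flip n j J" "N + 1 - j"] v
          E_mono[of "flip n j J - {N + 1 - j}" "J - {j}"] by (auto simp: flip_def bar_eq)
    qed
    have "w \<notin> E (J - {j})" using mem_E_D[of w "J - {j}" j] j by blast
    then have "vec.dim (L \<inter> E (J - {j})) < vec.dim (L \<inter> E J)"
      using w E_mono[of "J - {j}" J] L(1)
      by (intro dim_less_if_mem_diff[of _ _ w]) (auto simp: vec.subspace_inter)
    then have "vec.dim (L \<inter> E (flip n j J)) < vec.dim (L \<inter> E J)"
      using vec.dim_subset[OF sub] by simp
    then show False using J(2)[OF lagrangian_indices_flip[OF J(1) jJ]] by simp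
  qed
  then show ?thesis using J(1) by blast
qed

lemma dim_isotropic_le:
  assumes c: "c \<le> n + 1" and L: "vec.subspace L" "L \<subseteq> E {c + 1..N - c}"
    "\<And>x y. x \<in> L \<Longrightarrow> y \<in> L \<Longrightarrow> \<omega> x y = 0"
  shows "vec.dim L \<le> n + 1 - c"
proof -
  obtain J where J: "lagr c J" "L \<inter> E J \<subseteq> {0}" using exists_transversal[OF c L(1,3)] by blast
  have "vec.dim L + vec.dim (E J) \<le> vec.dim (E {c + 1..N - c}) + vec.dim (L \<inter> E J)"
    by (rule dim_add_le_dim_Int[OF L(1) subspace_E subspace_E L(2) E_mono[OF lagr_subset[OF J(1)]]])
  moreover have "vec.dim (L \<inter> E J) = 0" using J(2) by (simp only: vec.dim_eq_0)
  ultimately show ?thesis using dim_E_middle[OF c] dim_E_lagr[OF J(1)] by simp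
qed

lemma transversal_decomposition:
  assumes c: "c \<le> n + 1" and L: "vec.subspace L" "L \<subseteq> E {c + 1..N - c}" "vec.dim L = n + 1 - c"
    and J: "lagr c J" "L \<inter> E J \<subseteq> {0}" and x: "x \<in> E {c + 1..N - c}"
  obtains l w where "l \<in> L" "w \<in> E J" "x = l + w"
proof (rule sum_decomposition_if_dim[OF L(1) subspace_E subspace_E L(2) _ _ x])
  show "E J \<subseteq> E {c + 1..N - c}" by (rule E_mono[OF lagr_subset[OF J(1)]])
  have "vec.dim (L \<inter> E J) = 0" using J(2) by (simp only: vec.dim_eq_0)
  then show "vec.dim (E {c + 1..N - c}) + vec.dim (L \<inter> E J) \<le> vec.dim L + vec.dim (E J)"
    using dim_E_middle[OF c] dim_E_lagr[OF J(1)] L(3) by simp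
qed

text \<open>The component \<open>w\<close> of \<open>x\<close> along a transversal
  \<open>E J\<close> is orthogonal to \<open>L\<close> and to \<open>E J\<close>, hence to the whole
  middle space, hence zero.\<close>

lemma mem_if_orthogonal:
  assumes c: "c \<le> n + 1" and L: "vec.subspace L" "L \<subseteq> E {c + 1..N - c}"
    "\<And>x y. x \<in> L \<Longrightarrow> y \<in> L \<Longrightarrow> \<omega> x y = 0" "vec.dim L = n + 1 - c"
    and x: "x \<in> E {c + 1..N - c}" "\<And>y. y \<in> L \<Longrightarrow> \<omega> x y = 0"
  shows "x \<in> L"
proof -
  obtain J where J: "lagr c J" "L \<inter> E J \<subseteq> {0}" using exists_transversal[OF c L(1,3)] by blast
  note dec = transversal_decomposition[OF c L(1,2,4) J]
  obtain l w where lw: "l \<in> L" "w \<in> E J" "x = l + w" using dec[OF x(1)] by blast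
  have wL: "\<omega> w y = 0" if "y \<in> L" for y
    using x(2)[OF that] L(3)[OF lw(1) that] by (simp add: lw(3) form_linear)
  have "w = 0"
  proof (rule coord_eqI)
    fix i assume i: "i \<in> {1..N}"
    show "coord e i w = coord e i 0"
    proof (cases "i \<in> {c + 1..N - c}")
      case True
      then have "e (N + 1 - i) \<in> E {c + 1..N - c}" by (intro basis_mem_E) auto
      then obtain l' w' where lw': "l' \<in> L" "w' \<in> E J" "e (N + 1 - i) = l' + w'"
        using dec by blast
      have "coord e i w = \<omega> (e (N + 1 - i)) w" using i by (subst form_basis_left) auto
      also have "\<dots> = \<omega> w l' + \<omega> w w'" unfolding lw'(3) by (simp add: form_sym form_linear)
      also have "\<dots> = 0" using wL[OF lw'(1)] lagr_isotropic[OF J(1) lw(2) lw'(2)] by simp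
      finally show ?thesis by (simp add: coord_zero)
    next
      case False
      then have "i \<notin> J" using lagr_subset[OF J(1)] by blast
      then show ?thesis using mem_E_D[OF lw(2) i] by (simp add: coord_zero)
    qed
  qed
  then show ?thesis using lw by simp
qed

end

lemma hyperplane_decomposition:
  fixes A C :: "(complex^'k) set"
  assumes "vec.subspace A" "vec.subspace C" "C \<subseteq> A" "vec.dim A \<le> vec.dim C + 1"
    and a: "a \<in> A" "a \<notin> C" and x: "x \<in> A"
  obtains t c where "c \<in> C" "x = c + t *s a"
proof -
  have "a \<notin> vec.span C" using a assms(2) vec.span_eq_iff by blast
  then have "vec.dim (insert a C) = vec.dim C + 1" by (simp add: vec.dim_insert)
  then have "vec.span (insert a C) = A"
    using assms by (intro vec.subspace_dim_equal vec.span_minimal) auto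
  then obtain t where "x - t *s a \<in> vec.span C" using x vec.span_breakdown_eq by blast
  then have "x - t *s a \<in> C" using assms(2) vec.span_eq_iff by blast
  then show thesis using that[of "x - t *s a" t] by simp
qed

context split_quadric
begin

text \<open>If \<open>A\<close> and \<open>B\<close> were adjacent, then \<open>B\<close> would meet every \<open>E J\<close> transversal to \<open>A\<close> in a line, and a
  single flip of \<open>J\<close> would make it transversal to \<open>B\<close>, changing the parity.\<close>

lemma adjacent_same_family_eq:
  assumes c: "c \<le> n + 1"
    and A: "vec.subspace A" "A \<subseteq> E {c + 1..N - c}" "\<And>x y. x \<in> A \<Longrightarrow> y \<in> A \<Longrightarrow> \<omega> x y = 0" "vec.dim A = n + 1 - c"
    and B: "vec.subspace B" "B \<subseteq> E {c + 1..N - c}" "\<And>x y. x \<in> B \<Longrightarrow> y \<in> B \<Longrightarrow> \<omega> x y = 0" "vec.dim B = n + 1 - c"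
    and AB: "n + 1 - c \<le> vec.dim (A \<inter> B) + 1"
    and par: "\<And>J. lagr c J \<Longrightarrow> A \<inter> E J \<subseteq> {0} \<Longrightarrow> even (card (J \<inter> {c + 1..n + 1}) + p)"
      "\<And>J. lagr c J \<Longrightarrow> B \<inter> E J \<subseteq> {0} \<Longrightarrow> even (card (J \<inter> {c + 1..n + 1}) + q)"
      "even (p + q)"
  shows "A = B"
proof (rule ccontr)
  assume ne: "A \<noteq> B"
  have nsub: "\<not> B \<subseteq> A"
    using vec.subspace_dim_equal[OF B(1) A(1)] A(4) B(4) ne by auto
  have sC: "vec.subspace (A \<inter> B)" using A(1) B(1) by (rule vec.subspace_inter)
  obtain J where J: "lagr c J" "A \<inter> E J \<subseteq> {0}" using exists_transversal[OF c A(1,3)] by blast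
  \<comment> \<open>Otherwise some \<open>b\<close> in \<open>B\<close> outside \<open>A\<close>
    differs from an \<open>a\<close> in \<open>A\<close> by an isotropic vector of
    \<open>E J\<close>. Then \<open>b\<close> is orthogonal to \<open>a\<close> and to
    \<open>A \<inter> B\<close>, so to all of \<open>A\<close>, and maximality puts it into
    \<open>A\<close>.\<close>
  have "\<exists>w\<in>B \<inter> E J. w \<noteq> 0"
  proof (rule ccontr)
    assume "\<not> (\<exists>w\<in>B \<inter> E J. w \<noteq> 0)"
    then have BJ: "w = 0" if "w \<in> B" "w \<in> E J" for w using that by blast
    obtain b where b: "b \<in> B" "b \<notin> A" using nsub by blast
    then obtain a w where aw: "a \<in> A" "w \<in> E J" "b = a + w"
      using transversal_decomposition[OF c A(1,2,4) J, of b] B(2) by blast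
    have w: "w = b - a" using aw(3) by simp
    have "a \<notin> B"
    proof
      assume "a \<in> B"
      then have "w \<in> B" unfolding w using b(1) B(1) by (intro vec.subspace_diff)
      then show False using BJ[OF _ aw(2)] aw b(2) by simp
    qed
    have "\<omega> w w = 0" using lagr_isotropic[OF J(1) aw(2,2)] .
    then have "\<omega> b b - 2 * \<omega> b a + \<omega> a a = 0"
      unfolding w by (simp add: form_linear form_sym[of a b] algebra_simps)
    then have ba: "\<omega> b a = 0" using A(3)[OF aw(1,1)] B(3)[OF b(1,1)] by simp
    have "\<omega> b x = 0" if xA: "x \<in> A" for x
    proof -
      obtain t y where "y \<in> A \<inter> B" "x = y + t *s a"
        by (rule hyperplane_decomposition[OF A(1) sC _ _ aw(1) _ xA]) (use A(4) AB \<open>a \<notin> B\<close> in auto)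
      then show ?thesis using ba B(3)[OF b(1), of y] by (simp add: form_linear)
    qed
    then have "b \<in> A" using mem_if_orthogonal[OF c A] B(2) b(1) by blast
    then show False using b(2) by simp
  qed
  then obtain w where w: "w \<in> B" "w \<in> E J" "w \<noteq> 0" by blast
  then have wA: "w \<notin> A" using J(2) by blast
  obtain j where j: "j \<in> {1..N}" "coord e j w \<noteq> 0"
    using coord_eqI[of w 0] w(3) by (auto simp: coord_zero)
  have jJ: "j \<in> J" using mem_E_D[OF w(2) j(1)] j(2) by blast
  \<comment> \<open>Orthogonality to \<open>w\<close> puts \<open>v\<close> into
    \<open>E (J - {j})\<close>; modulo \<open>w\<close> it lies in \<open>A \<inter> B\<close>,
    which is transversal to \<open>E J\<close>, so \<open>v\<close> is a multiple of
    \<open>w\<close> that misses coordinate \<open>j\<close>.\<close>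
  have "v = 0" if v: "v \<in> B" "v \<in> E (flip n j J)" for v
  proof -
    have "coord e (N + 1 - j) v = 0"
      using flip_form[OF J(1) jJ w(2) v(2)] B(3)[OF w(1) v(1)] j(2) by auto
    then have vJ: "v \<in> E (J - {j})"
      using mem_E_Diff[OF v(2), of "N + 1 - j"]
        E_mono[of "flip n j J - {N + 1 - j}" "J - {j}"] by (auto simp: flip_def bar_eq)
    then have "v \<in> E J" using E_mono[of "J - {j}" J] by blast
    obtain t y where ty: "y \<in> A \<inter> B" "v = y + t *s w"
      by (rule hyperplane_decomposition[OF B(1) sC _ _ w(1) _ v(1)]) (use B(4) AB wA in auto)
    then have "y = v - t *s w" by simp
    then have "y \<in> E J" using \<open>v \<in> E J\<close> w(2) by (simp add: vec.subspace_diff vec.subspace_scale)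
    then have "y = 0" using J(2) ty(1) by blast
    then have vt: "v = t *s w" using ty by simp
    have "coord e j v = 0" using mem_E_D[OF vJ j(1)] by blast
    then have "t = 0" using j(2) unfolding vt coord_scale by simp
    then show "v = 0" using vt by simp
  qed
  then have "B \<inter> E (flip n j J) \<subseteq> {0}" by blast
  then have "even (card (flip n j J \<inter> {c + 1..n + 1}) + q)"
    using par(2) lagrangian_indices_flip[OF J(1) jJ] by blast
  then show False using flip_parity[OF J(1) jJ] par(1)[OF J] par(3) by presburger
qed

end

section \<open>Incidence conditions on Schubert varieties\<close>

context coordinates
begin

section \<open>Reflecting index sets by \<open>i \<mapsto> N + 1 - i\<close>\<close>

lemma image_bar_iff: "T \<subseteq> {1..N} \<Longrightarrow> i \<in> {1..N} \<Longrightarrow> i \<in> (\<lambda>i. N + 1 - i) ` T \<longleftrightarrow> N + 1 - i \<in> T"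
proof
  assume T: "T \<subseteq> {1..N}" and i: "i \<in> {1..N}"
  show "N + 1 - i \<in> T" if "i \<in> (\<lambda>i. N + 1 - i) ` T"
  proof -
    obtain j where j: "j \<in> T" "i = N + 1 - j" using \<open>i \<in> (\<lambda>i. N + 1 - i) ` T\<close> by blast
    then have "N + 1 - i = j" using T by auto
    then show ?thesis using j(1) by simp
  qed
  show "i \<in> (\<lambda>i. N + 1 - i) ` T" if "N + 1 - i \<in> T"
  proof -
    have "i = N + 1 - (N + 1 - i)" using i by auto
    then show ?thesis using \<open>N + 1 - i \<in> T\<close> by blast
  qed
qed

lemma image_bar_subset: "T \<subseteq> {1..N} \<Longrightarrow> (\<lambda>i. N + 1 - i) ` T \<subseteq> {1..N}"
  using bar_mem by blast

lemma card_image_bar: "T \<subseteq> {1..N} \<Longrightarrow> card ((\<lambda>i. N + 1 - i) ` T) = card T"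
  by (rule card_image) (force intro: inj_onI)

lemma card_image_bar_initial:
  assumes "T \<subseteq> {1..N}" "c \<le> N"
  shows "card ((\<lambda>i. N + 1 - i) ` T \<inter> {1..c}) = card (T \<inter> {N - c + 1..N})"
proof -
  have "(\<lambda>i. N + 1 - i) ` T \<inter> {1..c} = (\<lambda>i. N + 1 - i) ` (T \<inter> {N - c + 1..N})"
  proof (intro equalityI subsetI)
    fix i assume i: "i \<in> (\<lambda>i. N + 1 - i) ` T \<inter> {1..c}"
    then have "i \<in> {1..N}" using assms by auto
    then have "N + 1 - i \<in> T" using image_bar_iff[OF assms(1)] i by blast
    moreover have "i = N + 1 - (N + 1 - i)" "N + 1 - i \<in> {N - c + 1..N}" using i assms(2) by auto
    ultimately show "i \<in> (\<lambda>i. N + 1 - i) ` (T \<inter> {N - c + 1..N})" by blast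
  qed (use assms in auto)
  moreover have "T \<inter> {N - c + 1..N} \<subseteq> {1..N}" using assms by blast
  ultimately show ?thesis using card_image_bar by simp
qed

lemma card_image_bar_final:
  assumes "T \<subseteq> {1..N}" "c \<le> N"
  shows "card ((\<lambda>i. N + 1 - i) ` T \<inter> {c + 1..N}) = card (T \<inter> {1..N - c})"
proof -
  have "card T = card (T \<inter> {1..N - c}) + card (T \<inter> {N - c + 1..N})"
    using card_split_at[OF assms(1), of "N - c"] by simp
  moreover have "card T = card (T \<inter> {N - c + 1..N}) + card ((\<lambda>i. N + 1 - i) ` T \<inter> {c + 1..N})"
    using card_split_at[OF image_bar_subset[OF assms(1)] assms(2)]
      card_image_bar[OF assms(1)] card_image_bar_initial[OF assms] by simp
  ultimately show ?thesis by linarith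
qed

lemma image_bar_symbol:
  assumes T: "\<forall>c\<in>T. \<forall>d\<in>T. c + d \<noteq> N + 1" "T \<subseteq> {1..N}"
  shows "\<forall>c\<in>(\<lambda>i. N + 1 - i) ` T. \<forall>d\<in>(\<lambda>i. N + 1 - i) ` T. c + d \<noteq> N + 1"
proof (intro ballI)
  fix c d assume "c \<in> (\<lambda>i. N + 1 - i) ` T" "d \<in> (\<lambda>i. N + 1 - i) ` T"
  then obtain i j where "i \<in> T" "j \<in> T" "c = N + 1 - i" "d = N + 1 - j" by blast
  moreover from this have "i + j \<noteq> N + 1" "i \<in> {1..N}" "j \<in> {1..N}" using T by auto
  ultimately show "c + d \<noteq> N + 1" by auto
qed

lemma sym_hull_image_bar:
  assumes "T \<subseteq> {1..N}"
  shows "sym_hull N ((\<lambda>i. N + 1 - i) ` T) = sym_hull N T"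
proof (intro equalityI subsetI)
  have ii: "N + 1 - (N + 1 - i) = i" if "i \<in> {1..N}" for i using that by auto
  show "i \<in> sym_hull N T" if i: "i \<in> sym_hull N ((\<lambda>i. N + 1 - i) ` T)" for i
  proof -
    have r: "i \<in> {1..N}" using i image_bar_subset[OF assms] by (auto simp: sym_hull_def)
    then show ?thesis
      using i image_bar_iff[OF assms r] image_bar_iff[OF assms bar_mem[OF r]] ii[OF r]
      by (auto simp: sym_hull_def)
  qed
  show "i \<in> sym_hull N ((\<lambda>i. N + 1 - i) ` T)" if i: "i \<in> sym_hull N T" for i
  proof -
    have r: "i \<in> {1..N}" using i assms by (auto simp: sym_hull_def)
    then show ?thesis
      using i image_bar_iff[OF assms r] image_bar_iff[OF assms bar_mem[OF r]] ii[OF r]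
      unfolding sym_hull_def by auto
  qed
qed

end

section \<open>Projections, flags and the reversed basis\<close>

context coordinates
begin

lemma subspace_pr_image:
  assumes "vec.subspace X"
  shows "vec.subspace (pr A ` X)"
proof (rule vec.subspaceI)
  have "pr A 0 = 0" by (rule coord_eqI) (simp add: coord_pr coord_zero)
  then show "0 \<in> pr A ` X" using vec.subspace_0[OF assms] by force
  show "x + y \<in> pr A ` X" if "x \<in> pr A ` X" "y \<in> pr A ` X" for x y
    using that vec.subspace_add[OF assms] by (force simp: pr_add[symmetric])
  show "a *s x \<in> pr A ` X" if "x \<in> pr A ` X" for a x
    using that vec.subspace_scale[OF assms] by (force simp: pr_scale[symmetric])
qed

lemma diff_pr_mem: "x \<in> E (A \<union> B) \<Longrightarrow> x - pr B x \<in> E A"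
  using mem_E_D[of x "A \<union> B"] by (intro mem_E_I) (simp add: coord_diff coord_pr)

lemma mem_E_if_pr_eq_0:
  assumes "x \<in> E (A \<union> B)" "pr B x = 0"
  shows "x \<in> E A"
  using diff_pr_mem[OF assms(1)] assms(2) by simp

text \<open>Rank-nullity without quotients: \<open>S \<inter> E (A \<union> B)\<close> and its
  projection have the same sum with \<open>E A\<close>, and the projection meets \<open>E A\<close>
  trivially.\<close>

lemma dim_pr_image:
  assumes S: "vec.subspace S" and AB: "A \<union> B \<subseteq> {1..N}" "A \<inter> B = {}"
  shows "vec.dim (pr B ` (S \<inter> E (A \<union> B))) + vec.dim (S \<inter> E A) = vec.dim (S \<inter> E (A \<union> B))"
proof -
  let ?X = "S \<inter> E (A \<union> B)" and ?L = "pr B ` (S \<inter> E (A \<union> B))"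
  have sX: "vec.subspace ?X" using S by (simp add: vec.subspace_inter)
  have sL: "vec.subspace ?L" by (rule subspace_pr_image[OF sX])
  have "{x + y |x y. x \<in> ?X \<and> y \<in> E A} = {x + y |x y. x \<in> ?L \<and> y \<in> E A}"
  proof (intro equalityI subsetI)
    fix z assume "z \<in> {x + y |x y. x \<in> ?X \<and> y \<in> E A}"
    then obtain x y where xy: "x \<in> ?X" "y \<in> E A" "z = x + y" by blast
    have "z = pr B x + ((x - pr B x) + y)" using xy(3) by simp
    moreover have "(x - pr B x) + y \<in> E A"
      by (rule vec.subspace_add[OF subspace_E diff_pr_mem xy(2)]) (use xy(1) in blast)
    ultimately show "z \<in> {x + y |x y. x \<in> ?L \<and> y \<in> E A}" using xy(1) by blast
  next
    fix z assume "z \<in> {x + y |x y. x \<in> ?L \<and> y \<in> E A}"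
    then obtain x y where xy: "x \<in> ?X" "y \<in> E A" "z = pr B x + y" by blast
    have "z = x + (y - (x - pr B x))" using xy(3) by simp
    moreover have "y - (x - pr B x) \<in> E A"
      by (rule vec.subspace_diff[OF subspace_E xy(2) diff_pr_mem]) (use xy(1) in blast)
    ultimately show "z \<in> {x + y |x y. x \<in> ?X \<and> y \<in> E A}" using xy(1) by blast
  qed
  note M = this
  have X: "?X \<inter> E A = S \<inter> E A" using E_mono[of A "A \<union> B"] by blast
  have "?L \<inter> E A \<subseteq> {0}"
  proof
    fix x assume "x \<in> ?L \<inter> E A"
    then have "x \<in> E (A \<inter> B)" using pr_mem E_Int by blast
    then show "x \<in> {0}" using E_disjoint_eq_0[of x "A \<inter> B"] AB(2) by simp
  qed
  then have "vec.dim (?L \<inter> E A) = 0" by (simp only: vec.dim_eq_0)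
  then show ?thesis
    using vec.dim_sums_Int[OF sX subspace_E, of A] vec.dim_sums_Int[OF sL subspace_E, of A]
    unfolding M X by linarith
qed

text \<open>Adding one basis vector raises the dimension by at most one, so dimensions along the
  flag count the jumps.\<close>

lemma dim_flag_eq_card:
  assumes S: "vec.subspace S" and c: "c \<le> N"
  shows "vec.dim (S \<inter> E {1..c})
    = card ({d \<in> {1..N}. S \<inter> E {1..d - 1} \<subset> S \<inter> E {1..d}} \<inter> {1..c})"
  using c
proof (induction c)
  case 0
  have "S \<inter> E {1..0} \<subseteq> {0}" using E_disjoint_eq_0[of _ "{1..0}"] by auto
  then have "vec.dim (S \<inter> E {1..0}) = 0" by (simp only: vec.dim_eq_0)
  then show ?case by simp
next
  case (Suc c)
  let ?P = "{d \<in> {1..N}. S \<inter> E {1..d - 1} \<subset> S \<inter> E {1..d}}"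
  have i: "{1..Suc c} = insert (Suc c) {1..c}" by auto
  have le: "S \<inter> E {1..c} \<subseteq> S \<inter> E {1..Suc c}" using E_mono[of "{1..c}" "{1..Suc c}"] by auto
  have mem: "Suc c \<in> ?P \<longleftrightarrow> S \<inter> E {1..c} \<noteq> S \<inter> E {1..Suc c}"
    using Suc.prems le by auto
  show ?case
  proof (cases "Suc c \<in> ?P")
    case True
    then obtain x where "x \<in> S \<inter> E {1..Suc c}" "x \<notin> S \<inter> E {1..c}" using mem le by blast
    then have "vec.dim (S \<inter> E {1..c}) < vec.dim (S \<inter> E {1..Suc c})"
      using S le by (intro dim_less_if_mem_diff) (auto simp: vec.subspace_inter)
    then have "vec.dim (S \<inter> E {1..Suc c}) = vec.dim (S \<inter> E {1..c}) + 1"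
      using dim_Int_E_insert_le[OF S, of "Suc c" "{1..c}"] unfolding i by simp
    moreover have "?P \<inter> {1..Suc c} = insert (Suc c) (?P \<inter> {1..c})" using True by auto
    then have "card (?P \<inter> {1..Suc c}) = card (?P \<inter> {1..c}) + 1"
      by (metis (no_types, lifting) Int_iff Suc_eq_plus1 Suc_n_not_le_n atLeastAtMost_iff card_insert_disjoint finite_Int finite_atLeastAtMost)
    ultimately show ?thesis using Suc by simp
  next
    case False
    then have "?P \<inter> {1..Suc c} = ?P \<inter> {1..c}" unfolding i by blast
    then show ?thesis using mem False Suc by simp
  qed
qed

lemma rev_image: "(\<lambda>i. e (N + 1 - i)) ` {1..N} = e ` {1..N}"
proof -
  have "(\<lambda>i. N + 1 - i) ` {1..N} = {1..N}"
  proof (intro equalityI subsetI)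
    fix i assume "i \<in> {1..N}"
    then have "i = N + 1 - (N + 1 - i)" "N + 1 - i \<in> {1..N}" by auto
    then show "i \<in> (\<lambda>i. N + 1 - i) ` {1..N}" by blast
  qed auto
  then show ?thesis by (metis image_image)
qed

text \<open>Reversal turns final segments into initial ones, which reduces opposite cells to
  ordinary ones.\<close>

lemma coordinates_rev: "coordinates (\<lambda>i. e (N + 1 - i)) N"
proof
  show "inj_on (\<lambda>i. e (N + 1 - i)) {1..N}"
  proof (rule inj_onI)
    fix i j assume ij: "i \<in> {1..N}" "j \<in> {1..N}" "e (N + 1 - i) = e (N + 1 - j)"
    then have "N + 1 - i = N + 1 - j"
      by (intro inj_onD[OF inj_basis ij(3)]) auto
    then show "i = j" using ij by auto
  qed
qed (simp_all add: N_eq rev_image[unfolded N_eq] independent_basis[unfolded N_eq] span_basis[unfolded N_eq])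

lemma coord_rev: "coord (\<lambda>i. e (N + 1 - i)) i x = coord e (N + 1 - i) x"
  unfolding coord_def N_eq[symmetric] rev_image ..

lemma E_rev: "A \<subseteq> {1..N} \<Longrightarrow> coord_subspace (\<lambda>i. e (N + 1 - i)) A = E ((\<lambda>i. N + 1 - i) ` A)"
proof -
  assume A: "A \<subseteq> {1..N}"
  show ?thesis
  proof (intro equalityI subsetI)
    fix x assume x: "x \<in> coord_subspace (\<lambda>i. e (N + 1 - i)) A"
    show "x \<in> E ((\<lambda>i. N + 1 - i) ` A)"
    proof (rule mem_E_I)
      fix i assume i: "i \<in> {1..N}" "i \<notin> (\<lambda>i. N + 1 - i) ` A"
      have ii: "N + 1 - (N + 1 - i) = i" "N + 1 - i \<in> {1..N}" using i(1) by auto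
      then have "N + 1 - i \<notin> A" using i(2) by (metis image_eqI)
      then have "coord (\<lambda>i. e (N + 1 - i)) (N + 1 - i) x = 0"
        using x ii(2) unfolding coord_subspace_def N_eq[symmetric] by blast
      then show "coord e i x = 0" unfolding coord_rev ii(1) .
    qed
  next
    fix x assume x: "x \<in> E ((\<lambda>i. N + 1 - i) ` A)"
    have "coord e (N + 1 - i) x = 0" if i: "i \<in> {1..N}" "i \<notin> A" for i
    proof (rule mem_E_D[OF x])
      show "N + 1 - i \<in> {1..N}" using i by auto
      show "N + 1 - i \<notin> (\<lambda>i. N + 1 - i) ` A"
      proof
        assume "N + 1 - i \<in> (\<lambda>i. N + 1 - i) ` A"
        then obtain j where "j \<in> A" "N + 1 - i = N + 1 - j" by blast
        moreover have "j \<in> {1..N}" using \<open>j \<in> A\<close> A by blast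
        ultimately have "i = j" using i(1) by auto
        then show False using \<open>j \<in> A\<close> i(2) by simp
      qed
    qed
    then show "x \<in> coord_subspace (\<lambda>i. e (N + 1 - i)) A"
      unfolding coord_subspace_def N_eq[symmetric] coord_rev by blast
  qed
qed

lemma E_rev_initial:
  assumes "c \<le> N"
  shows "coord_subspace (\<lambda>i. e (N + 1 - i)) {1..c} = E {N + 1 - c..N}"
proof -
  have "(\<lambda>i. N + 1 - i) ` {1..c} = {N + 1 - c..N}"
  proof (intro equalityI subsetI)
    fix i assume "i \<in> {N + 1 - c..N}"
    then have "i = N + 1 - (N + 1 - i)" "N + 1 - i \<in> {1..c}" using assms by auto
    then show "i \<in> (\<lambda>i. N + 1 - i) ` {1..c}" by blast
  qed (use assms in auto)
  then show ?thesis using E_rev[of "{1..c}"] assms by simp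
qed

lemma dim_opposite_flag_eq_card:
  assumes S: "vec.subspace S" and c: "c \<le> N"
  shows "vec.dim (S \<inter> E {c + 1..N})
    = card ({d \<in> {1..N}. S \<inter> E {d + 1..N} \<subset> S \<inter> E {d..N}} \<inter> {c + 1..N})" (is "_ = card (?T \<inter> _)")
proof -
  interpret r: coordinates "\<lambda>i. e (N + 1 - i)" N by (rule coordinates_rev)
  let ?R = "{d \<in> {1..N}. S \<inter> r.E {1..d - 1} \<subset> S \<inter> r.E {1..d}}"
  have R: "d \<in> ?R \<longleftrightarrow> N + 1 - d \<in> ?T" if d: "d \<in> {1..N}" for d
  proof -
    have "N + 1 - (d - 1) = N + 1 - d + 1" using d by auto
    then show ?thesis
      using d E_rev_initial[of d] E_rev_initial[of "d - 1"] by auto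
  qed
  have "N + 1 - (N - c) = c + 1" using c by simp
  then have "vec.dim (S \<inter> E {c + 1..N}) = card (?R \<inter> {1..N - c})"
    using r.dim_flag_eq_card[OF S, of "N - c"] E_rev_initial[of "N - c"] by simp
  also have "\<dots> = card (?T \<inter> {c + 1..N})"
  proof (rule bij_betw_same_card[of "\<lambda>d. N + 1 - d"], rule bij_betwI[of _ _ _ "\<lambda>d. N + 1 - d"])
    show "(\<lambda>d. N + 1 - d) \<in> ?R \<inter> {1..N - c} \<rightarrow> ?T \<inter> {c + 1..N}"
    proof
      fix d assume d: "d \<in> ?R \<inter> {1..N - c}"
      then have "N + 1 - d \<in> ?T" using R[of d] by blast
      then show "N + 1 - d \<in> ?T \<inter> {c + 1..N}" using d by auto
    qed
    show "(\<lambda>d. N + 1 - d) \<in> ?T \<inter> {c + 1..N} \<rightarrow> ?R \<inter> {1..N - c}"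
    proof
      fix d assume d: "d \<in> ?T \<inter> {c + 1..N}"
      have "N + 1 - (N + 1 - d) = d" "N + 1 - d \<in> {1..N}" using d by auto
      moreover have "d \<in> ?T" using d by (rule IntD1)
      ultimately have "N + 1 - d \<in> ?R" using R[of "N + 1 - d"] by simp
      then show "N + 1 - d \<in> ?R \<inter> {1..N - c}" using d by auto
    qed
  qed auto
  finally show ?thesis .
qed

definition cell :: "nat set \<Rightarrow> (complex^'k) set \<Rightarrow> bool" where
  "cell P S \<longleftrightarrow> {c \<in> {1..N}. S \<inter> E {1..c - 1} \<subset> S \<inter> E {1..c}} = P"

definition opposite_cell :: "nat set \<Rightarrow> (complex^'k) set \<Rightarrow> bool" where
  "opposite_cell T S \<longleftrightarrow> {c \<in> {1..N}. S \<inter> E {c + 1..N} \<subset> S \<inter> E {c..N}} = T"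

lemma schubert_variety_eq:
  "schubert_variety \<omega> e m P = zariski_closure \<omega> e m {S \<in> isotropic_grassmannian \<omega> m. cell P S}"
proof -
  have "vec.span (e ` {1..c}) = E {1..c}" "vec.span (e ` {1..c - 1}) = E {1..c - 1}"
    if "c \<in> {1..N}" for c using that by (auto intro!: span_image_basis)
  then have "{c \<in> {1..N}. S \<inter> vec.span (e ` {1..c - 1}) \<subset> S \<inter> vec.span (e ` {1..c})}
      = {c \<in> {1..N}. S \<inter> E {1..c - 1} \<subset> S \<inter> E {1..c}}" for S by auto
  then show ?thesis unfolding schubert_variety_def cell_def N_eq[symmetric] by simp
qed

lemma opposite_schubert_variety_eq:
  "opposite_schubert_variety \<omega> e m T
    = zariski_closure \<omega> e m {S \<in> isotropic_grassmannian \<omega> m. opposite_cell T S}"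
proof -
  have "vec.span (e ` {c..N}) = E {c..N}" "vec.span (e ` {c + 1..N}) = E {c + 1..N}"
    if "c \<in> {1..N}" for c using that by (auto intro!: span_image_basis)
  then have "{c \<in> {1..N}. S \<inter> vec.span (e ` {c + 1..N}) \<subset> S \<inter> vec.span (e ` {c..N})}
      = {c \<in> {1..N}. S \<inter> E {c + 1..N} \<subset> S \<inter> E {c..N}}" for S by auto
  then show ?thesis unfolding opposite_schubert_variety_def opposite_cell_def N_eq[symmetric] by simp
qed

lemma schubert_variety_rank:
  assumes S: "S \<in> schubert_variety \<omega> e m P" and c: "c \<le> N"
  shows "card (P \<inter> {1..c}) \<le> vec.dim (S \<inter> E {1..c})"
proof (rule dim_ge_on_zariski_closure[OF _ _ _ S[unfolded schubert_variety_eq]])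
  fix S assume "S \<in> {S \<in> isotropic_grassmannian \<omega> m. cell P S}"
  then show "card (P \<inter> {1..c}) \<le> vec.dim (S \<inter> E {1..c})"
    using dim_flag_eq_card[OF _ c, of S] by (auto simp: cell_def isotropic_grassmannian_def)
qed (use c in auto)

lemma opposite_schubert_variety_rank:
  assumes S: "S \<in> opposite_schubert_variety \<omega> e m T" and c: "c \<le> N"
  shows "card (T \<inter> {c + 1..N}) \<le> vec.dim (S \<inter> E {c + 1..N})"
proof (rule dim_ge_on_zariski_closure[OF _ _ _ S[unfolded opposite_schubert_variety_eq]])
  fix S assume "S \<in> {S \<in> isotropic_grassmannian \<omega> m. opposite_cell T S}"
  then show "card (T \<inter> {c + 1..N}) \<le> vec.dim (S \<inter> E {c + 1..N})"
    using dim_opposite_flag_eq_card[OF _ c, of S] by (auto simp: opposite_cell_def isotropic_grassmannian_def)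
qed (use c in auto)

end

section \<open>Family conditions on Schubert varieties\<close>

context split_quadric
begin

text \<open>The two outer sums vanish on \<open>E {1..N - c}\<close> and on
  \<open>E {c + 1..N}\<close>, so there the form descends to the middle space; for general vectors
  of \<open>S\<close> they carry the equation at an exceptional cut.\<close>

lemma form_split:
  assumes c: "c \<le> n + 1"
  shows "\<omega> x y = \<omega> (pr {c + 1..N - c} x) (pr {c + 1..N - c} y)
    + (\<Sum>i\<in>{1..c}. coord e i x * coord e (N + 1 - i) y)
    + (\<Sum>i\<in>{1..c}. coord e (N + 1 - i) x * coord e i y)"
proof -
  let ?I = "{c + 1..N - c}" and ?f = "\<lambda>i. coord e i x * coord e (N + 1 - i) y"
  have "\<omega> (pr ?I x) (pr ?I y) = (\<Sum>i\<in>{1..N}. if i \<in> ?I then ?f i else 0)"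
    unfolding form
  proof (rule sum.cong)
    fix i assume i: "i \<in> {1..N}"
    have "N + 1 - i \<in> ?I \<longleftrightarrow> i \<in> ?I" using i by auto
    then show "coord e i (pr ?I x) * coord e (N + 1 - i) (pr ?I y) = (if i \<in> ?I then ?f i else 0)"
      using coord_pr[OF i] coord_pr[OF bar_mem[OF i]] by simp
  qed simp
  also have "\<dots> = sum ?f ({1..N} \<inter> ?I)" by (rule sum.inter_restrict[symmetric]) simp
  also have "{1..N} \<inter> ?I = ?I" by auto
  finally have 1: "\<omega> (pr ?I x) (pr ?I y) = sum ?f ?I" .
  have 2: "(\<Sum>i\<in>{1..c}. coord e (N + 1 - i) x * coord e i y) = sum ?f {N - c + 1..N}"
    by (rule sum.reindex_bij_witness[of _ "\<lambda>i. N + 1 - i" "\<lambda>i. N + 1 - i"]) (use c N_even in auto)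
  have "{1..N} = (?I \<union> {1..c}) \<union> {N - c + 1..N}" using c N_even by auto
  then have "\<omega> x y = sum ?f ((?I \<union> {1..c}) \<union> {N - c + 1..N})" unfolding form by simp
  also have "\<dots> = (sum ?f ?I + sum ?f {1..c}) + sum ?f {N - c + 1..N}"
    using c N_even by (subst sum.union_disjoint, auto)+
  finally show ?thesis unfolding 1 2 .
qed

text \<open>Under the condition on \<open>sym_hull\<close>, the indices of \<open>P\<close> in the
  middle range span a maximal isotropic subspace and the remaining ones a transversal subspace,
  whose parity is that of \<open>card ({c + 1..n + 1} - P)\<close>. Sets \<open>J\<close> of the
  other parity must therefore be met. The \<open>+ 1\<close> provides a vector of \<open>S\<close>
  in \<open>E ({1..c} \<union> J)\<close> outside \<open>E {1..c}\<close>, as long as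
  \<open>S \<inter> E {1..c}\<close> has only the dimension prescribed by \<open>P\<close>.\<close>

definition flag_conditions :: "nat set \<Rightarrow> (complex^'k) set \<Rightarrow> bool" where
  "flag_conditions P S \<longleftrightarrow>
     (\<forall>c\<le>N. card (P \<inter> {1..c}) \<le> vec.dim (S \<inter> E {1..c})) \<and>
     (\<forall>c\<le>n. \<forall>J. {c + 1..n + 1} \<subseteq> sym_hull N P \<longrightarrow> lagr c J \<longrightarrow>
        odd (card (J \<inter> {c + 1..n + 1}) + card ({c + 1..n + 1} - P)) \<longrightarrow>
        card (P \<inter> {1..c}) + 1 \<le> vec.dim (S \<inter> E ({1..c} \<union> J)))"

lemma lagr_symbol:
  assumes P: "\<forall>c\<in>P. \<forall>d\<in>P. c + d \<noteq> N + 1" and H: "{c + 1..n + 1} \<subseteq> sym_hull N P"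
  shows "lagr c (P \<inter> {c + 1..N - c})"
proof (rule lagrangian_indicesI)
  show "c < i \<and> i + c \<le> 2 * n + 2" if "i \<in> P \<inter> {c + 1..N - c}" for i
    using that by (auto simp: N_even)
  fix i assume i: "c < i" "i \<le> n + 1"
  then have "i \<in> sym_hull N P" using H by auto
  then have "i \<in> P \<or> N + 1 - i \<in> P" by (auto simp: sym_hull_def)
  moreover have "\<not> (i \<in> P \<and> N + 1 - i \<in> P)"
  proof
    assume "i \<in> P \<and> N + 1 - i \<in> P"
    then have "i + (N + 1 - i) \<noteq> N + 1" using P by blast
    then show False using i N_even by simp
  qed
  moreover have "N + 1 - i = 2 * n + 3 - i" by (rule bar_eq)
  moreover have "i \<in> {c + 1..N - c}" "2 * n + 3 - i \<in> {c + 1..N - c}" using i by (auto simp: N_even)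
  ultimately show "(i \<in> P \<inter> {c + 1..N - c}) = (2 * n + 3 - i \<notin> P \<inter> {c + 1..N - c})" by auto
qed

lemma card_symbol_split:
  assumes P: "\<forall>c\<in>P. \<forall>d\<in>P. c + d \<noteq> N + 1" and H: "{c + 1..n + 1} \<subseteq> sym_hull N P" and c: "c \<le> n + 1"
  shows "card (P \<inter> {1..N - c}) = card (P \<inter> {1..c}) + (n + 1 - c)"
proof -
  have "P \<inter> {1..N - c} = (P \<inter> {1..c}) \<union> (P \<inter> {c + 1..N - c})" using c N_even by auto
  also have "card \<dots> = card (P \<inter> {1..c}) + card (P \<inter> {c + 1..N - c})"
    by (rule card_Un_disjoint) auto
  finally show ?thesis using card_lagrangian_indices[OF lagr_symbol[OF P H]] by simp
qed

lemma form_pr_initial: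
  assumes c: "c \<le> n + 1" and x: "x \<in> E {1..N - c}" and y: "y \<in> E {1..N - c}"
  shows "\<omega> x y = \<omega> (pr {c + 1..N - c} x) (pr {c + 1..N - c} y)"
proof -
  have "coord e (N + 1 - i) z = 0" if "z \<in> E {1..N - c}" "i \<in> {1..c}" for z i
    using that c N_even by (intro mem_E_D[OF that(1)]) auto
  then show ?thesis using form_split[OF c, of x y] x y by simp
qed

text \<open>On the cell the intersections have exactly the prescribed dimensions, so the image of
  \<open>S \<inter> E {1..N - c}\<close> in the middle space is maximal isotropic, and one
  transversal index set fixes the parity of all others.\<close>

lemma cell_flag_conditions:
  assumes S: "vec.subspace S" "\<And>x y. x \<in> S \<Longrightarrow> y \<in> S \<Longrightarrow> \<omega> x y = 0"
    and P: "\<forall>c\<in>P. \<forall>d\<in>P. c + d \<noteq> N + 1" and cell: "cell P S"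
  shows "flag_conditions P S"
  unfolding flag_conditions_def
proof (intro conjI allI impI)
  have dim: "vec.dim (S \<inter> E {1..c}) = card (P \<inter> {1..c})" if "c \<le> N" for c
    using dim_flag_eq_card[OF S(1) that] cell unfolding cell_def by simp
  then show "card (P \<inter> {1..c}) \<le> vec.dim (S \<inter> E {1..c})" if "c \<le> N" for c using that by simp
  fix c J
  assume c: "c \<le> n" and H: "{c + 1..n + 1} \<subseteq> sym_hull N P" and J: "lagr c J"
    and odd: "odd (card (J \<inter> {c + 1..n + 1}) + card ({c + 1..n + 1} - P))"
  let ?I = "{c + 1..N - c}"
  let ?L = "pr ?I ` (S \<inter> E {1..N - c})"
  have U: "{1..N - c} = {1..c} \<union> ?I" using c N_even by auto
  have sL: "vec.subspace ?L" using S(1) by (intro subspace_pr_image) (simp add: vec.subspace_inter)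
  have LI: "?L \<subseteq> E ?I" using pr_mem by blast
  have isoL: "\<omega> x y = 0" if "x \<in> ?L" "y \<in> ?L" for x y
  proof -
    obtain x' y' where "x' \<in> S \<inter> E {1..N - c}" "x = pr ?I x'" "y' \<in> S \<inter> E {1..N - c}" "y = pr ?I y'"
      using \<open>x \<in> ?L\<close> \<open>y \<in> ?L\<close> by blast
    then show ?thesis using form_pr_initial[of c x' y'] S(2)[of x' y'] c by simp
  qed
  have "vec.dim ?L + vec.dim (S \<inter> E {1..c}) = vec.dim (S \<inter> E {1..N - c})"
    unfolding U by (rule dim_pr_image[OF S(1)]) (use c N_even in auto)
  then have dL: "vec.dim ?L = n + 1 - c"
    using dim[of c] dim[of "N - c"] card_symbol_split[OF P H] c N_even by linarith
  let ?Q = "P \<inter> ?I"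
  have Q: "lagr c ?Q" by (rule lagr_symbol[OF P H])
  \<comment> \<open>The complement of \<open>?Q\<close> is transversal: the last index in the support of a vector of \<open>S\<close> lies in \<open>P\<close>.\<close>
  have K: "lagr c (?I - ?Q)"
    using lagrangian_indices_complement[OF Q] by (simp add: N_even)
  have "l = 0" if l: "l \<in> ?L" "l \<in> E (?I - ?Q)" for l
  proof (rule ccontr)
    assume "l \<noteq> 0"
    then obtain i where i: "i \<in> {1..N}" "coord e i l \<noteq> 0"
      using coord_eqI[of l 0] by (auto simp: coord_zero)
    obtain x where x: "x \<in> S" "x \<in> E {1..N - c}" "l = pr ?I x" using l(1) by blast
    have iI: "i \<in> ?I" "coord e i x \<noteq> 0" using i coord_pr[OF i(1), of ?I x] x(3) by (auto split: if_splits)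
    let ?M = "{j \<in> {1..N}. coord e j x \<noteq> 0}"
    define d where "d = Max ?M"
    have "i \<in> ?M" using iI i by blast
    have fin: "finite ?M" by simp
    have max: "j \<le> d" if "j \<in> ?M" for j
      unfolding d_def using Max_ge[OF fin that] .
    have di: "i \<le> d" by (rule max[OF \<open>i \<in> ?M\<close>])
    have "?M \<noteq> {}" using \<open>i \<in> ?M\<close> by blast
    then have dM: "d \<in> ?M" unfolding d_def by (rule Max_in[OF fin])
    have dN: "d \<in> {1..N}" "coord e d x \<noteq> 0" using dM by auto
    have "d \<in> {1..N - c}" using mem_E_D[OF x(2) dN(1)] dN(2) by blast
    then have dI: "d \<in> ?I" using iI(1) di by auto
    then have "coord e d l \<noteq> 0" using coord_pr[OF dN(1), of ?I x] x(3) dN(2) by simp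
    then have "d \<in> ?I - ?Q" using mem_E_D[OF l(2) dN(1)] by blast
    then have "d \<notin> P" by blast
    moreover have "x \<in> E {1..d}"
    proof (rule mem_E_I)
      fix j assume j: "j \<in> {1..N}" "j \<notin> {1..d}"
      then have "\<not> j \<le> d" by simp
      then show "coord e j x = 0" using max[of j] j(1) by blast
    qed
    moreover have "x \<notin> E {1..d - 1}"
    proof
      assume "x \<in> E {1..d - 1}"
      then have "coord e d x = 0" using dN(1) by (intro mem_E_D[of x "{1..d - 1}"]) auto
      then show False using dN(2) by simp
    qed
    ultimately have "S \<inter> E {1..d - 1} \<noteq> S \<inter> E {1..d}" using x(1) by blast
    moreover have "S \<inter> E {1..d - 1} \<subseteq> S \<inter> E {1..d}" using E_mono[of "{1..d - 1}" "{1..d}"] by auto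
    ultimately have "d \<in> P" using cell dN(1) unfolding cell_def by blast
    then show False using \<open>d \<notin> P\<close> by simp
  qed
  then have "?L \<inter> E (?I - ?Q) \<subseteq> {0}" by blast
  note par = transversal_parity[OF _ sL LI isoL dL K this J]
  have "(?I - ?Q) \<inter> {c + 1..n + 1} = {c + 1..n + 1} - P" using c N_even by auto
  \<comment> \<open>\<open>J\<close> has the other parity, so it cannot be transversal to
    \<open>?L\<close>; a vector of \<open>S\<close> above the intersection supplies the extra
    dimension.\<close>
  then have "\<not> ?L \<inter> E J \<subseteq> {0}" using par c odd by (auto simp: add.commute)
  then obtain l where l: "l \<in> ?L" "l \<in> E J" "l \<noteq> 0" by blast
  then obtain x where x: "x \<in> S" "x \<in> E {1..N - c}" "l = pr ?I x" by blast
  have "x - l \<in> E {1..c}" using diff_pr_mem[of x "{1..c}" ?I] x(2,3) unfolding U by simp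
  then have "x - l \<in> E ({1..c} \<union> J)" "l \<in> E ({1..c} \<union> J)"
    using l(2) E_mono[of "{1..c}" "{1..c} \<union> J"] E_mono[of J "{1..c} \<union> J"] by auto
  then have "(x - l) + l \<in> E ({1..c} \<union> J)" by (intro vec.subspace_add) auto
  then have xJ: "x \<in> E ({1..c} \<union> J)" by simp
  have "x \<notin> E {1..c}" using l(3) x(3) pr_eq_0[of x "{1..c}" ?I] by auto
  then have "vec.dim (S \<inter> E {1..c}) < vec.dim (S \<inter> E ({1..c} \<union> J))"
    using S(1) x(1) xJ E_mono[of "{1..c}" "{1..c} \<union> J"]
    by (intro dim_less_if_mem_diff[of _ _ x]) (auto simp: vec.subspace_inter)
  then show "card (P \<inter> {1..c}) + 1 \<le> vec.dim (S \<inter> E ({1..c} \<union> J))"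
    using dim[of c] c N_even by simp
qed

text \<open>Being a list of rank conditions, they pass to the closure one at a time.\<close>

lemma schubert_variety_flag_conditions:
  assumes P: "\<forall>c\<in>P. \<forall>d\<in>P. c + d \<noteq> N + 1" and S: "S \<in> schubert_variety \<omega> e m P"
  shows "flag_conditions P S"
proof -
  let ?C = "{S \<in> isotropic_grassmannian \<omega> m. cell P S}"
  have C: "?C \<subseteq> isotropic_grassmannian \<omega> m" by blast
  have conds: "flag_conditions P R" if "R \<in> ?C" for R
    using that cell_flag_conditions[OF _ _ P, of R] by (auto simp: isotropic_grassmannian_def)
  show ?thesis
    unfolding flag_conditions_def
  proof (intro conjI allI impI)
    show "card (P \<inter> {1..c}) \<le> vec.dim (S \<inter> E {1..c})" if "c \<le> N" for c
      by (rule schubert_variety_rank[OF S that])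
    fix c J
    assume *: "c \<le> n" "{c + 1..n + 1} \<subseteq> sym_hull N P" "lagr c J"
      "odd (card (J \<inter> {c + 1..n + 1}) + card ({c + 1..n + 1} - P))"
    show "card (P \<inter> {1..c}) + 1 \<le> vec.dim (S \<inter> E ({1..c} \<union> J))"
    proof (rule dim_ge_on_zariski_closure[OF C _ _ S[unfolded schubert_variety_eq]])
      show "{1..c} \<union> J \<subseteq> {1..N}" using lagr_subset_all[OF *(3)] *(1) N_even by auto
      show "card (P \<inter> {1..c}) + 1 \<le> vec.dim (R \<inter> E ({1..c} \<union> J))" if "R \<in> ?C" for R
        using conds[OF that] * unfolding flag_conditions_def by blast
    qed
  qed
qed

lemma split_quadric_rev: "split_quadric (\<lambda>i. e (N + 1 - i)) N n \<omega>"
proof -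
  interpret r: coordinates "\<lambda>i. e (N + 1 - i)" N by (rule coordinates_rev)
  show ?thesis
  proof
    fix x y
    show "\<omega> x y = (\<Sum>i\<in>{1..N}. coord (\<lambda>i. e (N + 1 - i)) i x * coord (\<lambda>i. e (N + 1 - i)) (N + 1 - i) y)"
      unfolding form coord_rev
      by (rule sum.reindex_bij_witness[of _ "\<lambda>i. N + 1 - i" "\<lambda>i. N + 1 - i"]) auto
  qed (rule N_even)
qed

text \<open>Reversal turns the opposite cell into a cell of the reflected symbol. The closure is
  still taken in Pluecker coordinates for \<open>e\<close>, so each rank condition is rewritten in
  terms of \<open>e\<close> before closing up.\<close>

lemma opposite_schubert_variety_flag_conditions:
  assumes T: "\<forall>c\<in>T. \<forall>d\<in>T. c + d \<noteq> N + 1" "T \<subseteq> {1..N}"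
    and S: "S \<in> opposite_schubert_variety \<omega> e m T"
  shows "split_quadric.flag_conditions (\<lambda>i. e (N + 1 - i)) N n ((\<lambda>i. N + 1 - i) ` T) S"
proof -
  interpret r: split_quadric "\<lambda>i. e (N + 1 - i)" N n \<omega> by (rule split_quadric_rev)
  let ?C = "{S \<in> isotropic_grassmannian \<omega> m. opposite_cell T S}"
  let ?T = "(\<lambda>i. N + 1 - i) ` T"
  have C: "?C \<subseteq> isotropic_grassmannian \<omega> m" by blast
  have T': "\<forall>c\<in>?T. \<forall>d\<in>?T. c + d \<noteq> N + 1" by (rule image_bar_symbol[OF T])
  have "r.cell ?T R" if "opposite_cell T R" for R
    unfolding r.cell_def
  proof (intro equalityI subsetI)
    have eq: "R \<inter> r.E {1..d - 1} \<subset> R \<inter> r.E {1..d} \<longleftrightarrow> N + 1 - d \<in> T" if d: "d \<in> {1..N}" for d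
    proof -
      have "N + 1 - (d - 1) = N + 1 - d + 1" using d by auto
      then have "r.E {1..d - 1} = E {N + 1 - d + 1..N}" "r.E {1..d} = E {N + 1 - d..N}"
        using d E_rev_initial[of d] E_rev_initial[of "d - 1"] by auto
      then show ?thesis using \<open>opposite_cell T R\<close> d unfolding opposite_cell_def by auto
    qed
    fix d
    show "d \<in> ?T" if "d \<in> {c \<in> {1..N}. R \<inter> r.E {1..c - 1} \<subset> R \<inter> r.E {1..c}}"
    proof -
      have "N + 1 - d \<in> T" "d = N + 1 - (N + 1 - d)" using that eq by auto
      then show ?thesis by blast
    qed
    show "d \<in> {c \<in> {1..N}. R \<inter> r.E {1..c - 1} \<subset> R \<inter> r.E {1..c}}" if dT: "d \<in> ?T"
    proof -
      obtain t where t: "t \<in> T" "d = N + 1 - t" using dT by blast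
      then have "t \<in> {1..N}" using T by blast
      then have "d \<in> {1..N}" "N + 1 - d = t" using t(2) by auto
      then show ?thesis using eq[of d] t(1) by auto
    qed
  qed
  then have conds: "r.flag_conditions ?T R" if "R \<in> ?C" for R
    using that r.cell_flag_conditions[OF _ _ T', of R] by (auto simp: isotropic_grassmannian_def)
  have closed: "q \<le> vec.dim (S \<inter> r.E A)"
    if "A \<subseteq> {1..N}" "\<And>R. R \<in> ?C \<Longrightarrow> q \<le> vec.dim (R \<inter> r.E A)" for A q
  proof -
    have "(\<lambda>i. N + 1 - i) ` A \<subseteq> {1..N}"
      using that(1) bar_mem by (intro image_subsetI) blast
    then show ?thesis
      using that(2) unfolding E_rev[OF that(1)]
      by (rule dim_ge_on_zariski_closure[OF C _ _ S[unfolded opposite_schubert_variety_eq]])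
  qed
  show ?thesis
    unfolding r.flag_conditions_def
  proof (intro conjI allI impI)
    show "card (?T \<inter> {1..c}) \<le> vec.dim (S \<inter> r.E {1..c})" if "c \<le> N" for c
      using conds that unfolding r.flag_conditions_def by (intro closed) auto
    fix c J
    assume *: "c \<le> n" "{c + 1..n + 1} \<subseteq> sym_hull N ?T" "lagr c J"
      "odd (card (J \<inter> {c + 1..n + 1}) + card ({c + 1..n + 1} - ?T))"
    show "card (?T \<inter> {1..c}) + 1 \<le> vec.dim (S \<inter> r.E ({1..c} \<union> J))"
    proof (rule closed)
      show "{1..c} \<union> J \<subseteq> {1..N}" using lagr_subset_all[OF *(3)] *(1) N_even by auto
      show "card (?T \<inter> {1..c}) + 1 \<le> vec.dim (R \<inter> r.E ({1..c} \<union> J))" if "R \<in> ?C" for R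
        using conds[OF that] * unfolding r.flag_conditions_def by blast
    qed
  qed
qed

end

section \<open>The opposite conditions in the original basis\<close>

context split_quadric
begin

text \<open>The reversed \<open>flag_conditions\<close> expressed through \<open>e\<close>. The
  parity test keeps its shape because reflection complements both \<open>J\<close> and
  \<open>T\<close> within the lower half.\<close>

definition opposite_flag_conditions :: "nat set \<Rightarrow> (complex^'k) set \<Rightarrow> bool" where
  "opposite_flag_conditions T S \<longleftrightarrow>
     (\<forall>c\<le>N. card (T \<inter> {c + 1..N}) \<le> vec.dim (S \<inter> E {c + 1..N})) \<and>
     (\<forall>c\<le>n. \<forall>J. {c + 1..n + 1} \<subseteq> sym_hull N T \<longrightarrow> lagr c J \<longrightarrow>
        odd (card (J \<inter> {c + 1..n + 1}) + card ({c + 1..n + 1} - T)) \<longrightarrow>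
        card (T \<inter> {N - c + 1..N}) + 1 \<le> vec.dim (S \<inter> E ({N - c + 1..N} \<union> J)))"

lemma lagr_image_bar:
  assumes J: "lagr c J"
  shows "lagr c ((\<lambda>i. N + 1 - i) ` J)"
    and "card ((\<lambda>i. N + 1 - i) ` J \<inter> {c + 1..n + 1}) = (n + 1 - c) - card (J \<inter> {c + 1..n + 1})"
proof -
  let ?b = "\<lambda>i. N + 1 - i"
  have J1: "J \<subseteq> {1..N}" by (rule lagr_subset_all[OF J])
  have mem: "i \<in> ?b ` J \<longleftrightarrow> i \<notin> J" if "c < i" "i \<le> n + 1" for i
    using image_bar_iff[OF J1, of i] lagrangian_indices_iff[OF J, of i] that
    unfolding bar_eq by (auto simp: N_even)
  show "lagr c (?b ` J)"
  proof (rule lagrangian_indicesI)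
    show "c < i \<and> i + c \<le> 2 * n + 2" if "i \<in> ?b ` J" for i
      using that lagrangian_indices_range[OF J] by (fastforce simp: N_even)
    fix i assume i: "c < i" "i \<le> n + 1"
    have "2 * n + 3 - i \<in> ?b ` J \<longleftrightarrow> i \<in> J"
    proof -
      have "2 * n + 3 - i \<in> {1..N}" "N + 1 - (2 * n + 3 - i) = i" using i N_even by auto
      then show ?thesis using image_bar_iff[OF J1, of "2 * n + 3 - i"] by simp
    qed
    then show "(i \<in> ?b ` J) = (2 * n + 3 - i \<notin> ?b ` J)" using mem[OF i] by simp
  qed
  have "?b ` J \<inter> {c + 1..n + 1} = {c + 1..n + 1} - J \<inter> {c + 1..n + 1}"
  proof (intro equalityI subsetI)
    fix i assume "i \<in> ?b ` J \<inter> {c + 1..n + 1}"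
    then show "i \<in> {c + 1..n + 1} - J \<inter> {c + 1..n + 1}" using mem[of i] by simp
  next
    fix i assume "i \<in> {c + 1..n + 1} - J \<inter> {c + 1..n + 1}"
    then have "i \<in> {c + 1..n + 1}" "i \<notin> J" by blast+
    then show "i \<in> ?b ` J \<inter> {c + 1..n + 1}" using mem[of i] by simp
  qed
  then show "card (?b ` J \<inter> {c + 1..n + 1}) = (n + 1 - c) - card (J \<inter> {c + 1..n + 1})"
    by (simp add: card_Diff_subset)
qed

lemma card_half_Diff_image_bar:
  assumes T: "\<forall>c\<in>T. \<forall>d\<in>T. c + d \<noteq> N + 1" "T \<subseteq> {1..N}" and H: "{c + 1..n + 1} \<subseteq> sym_hull N T"
  shows "card ({c + 1..n + 1} - (\<lambda>i. N + 1 - i) ` T) = (n + 1 - c) - card ({c + 1..n + 1} - T)"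
proof -
  have "i \<in> (\<lambda>i. N + 1 - i) ` T \<longleftrightarrow> i \<notin> T" if i: "i \<in> {c + 1..n + 1}" for i
  proof -
    have r: "i \<in> {1..N}" using i N_even by auto
    have "i \<in> T \<or> N + 1 - i \<in> T" using H i by (auto simp: sym_hull_def)
    moreover have "\<not> (i \<in> T \<and> N + 1 - i \<in> T)"
    proof
      assume "i \<in> T \<and> N + 1 - i \<in> T"
      then have "i + (N + 1 - i) \<noteq> N + 1" using T by blast
      then show False using r by simp
    qed
    ultimately show ?thesis using image_bar_iff[OF T(2) r] by blast
  qed
  then have "{c + 1..n + 1} - (\<lambda>i. N + 1 - i) ` T = {c + 1..n + 1} - ({c + 1..n + 1} - T)" by blast
  then show ?thesis by (simp add: card_Diff_subset)
qed

lemma opposite_flag_conditions_if_rev: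
  assumes T: "\<forall>c\<in>T. \<forall>d\<in>T. c + d \<noteq> N + 1" "T \<subseteq> {1..N}"
    and rev: "split_quadric.flag_conditions (\<lambda>i. e (N + 1 - i)) N n ((\<lambda>i. N + 1 - i) ` T) S"
  shows "opposite_flag_conditions T S"
proof -
  interpret r: split_quadric "\<lambda>i. e (N + 1 - i)" N n \<omega> by (rule split_quadric_rev)
  let ?b = "\<lambda>i. N + 1 - i"
  show ?thesis
    unfolding opposite_flag_conditions_def
  proof (intro conjI allI impI)
    fix c assume c: "c \<le> N"
    have "card (?b ` T \<inter> {1..N - c}) \<le> vec.dim (S \<inter> r.E {1..N - c})"
      using rev unfolding r.flag_conditions_def by auto
    moreover have "N + 1 - (N - c) = c + 1" "N - (N - c) = c" using c by auto
    ultimately show "card (T \<inter> {c + 1..N}) \<le> vec.dim (S \<inter> E {c + 1..N})"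
      using card_image_bar_initial[OF T(2), of "N - c"] E_rev_initial[of "N - c"] by simp
  next
    fix c J
    assume *: "c \<le> n" "{c + 1..n + 1} \<subseteq> sym_hull N T" "lagr c J"
      "odd (card (J \<inter> {c + 1..n + 1}) + card ({c + 1..n + 1} - T))"
    have cN: "c \<le> N" using *(1) N_even by simp
    have J1: "J \<subseteq> {1..N}" by (rule lagr_subset_all[OF *(3)])
    have "card (J \<inter> {c + 1..n + 1}) \<le> n + 1 - c" "card ({c + 1..n + 1} - T) \<le> n + 1 - c"
      using card_mono[of "{c + 1..n + 1}" "J \<inter> {c + 1..n + 1}"]
        card_mono[of "{c + 1..n + 1}" "{c + 1..n + 1} - T"] by auto
    \<comment> \<open>Reflected and original counts add up to an even number, so oddness carries
      over.\<close>
    then have "(card (?b ` J \<inter> {c + 1..n + 1}) + card ({c + 1..n + 1} - ?b ` T))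
        + (card (J \<inter> {c + 1..n + 1}) + card ({c + 1..n + 1} - T)) = 2 * (n + 1 - c)"
      using lagr_image_bar(2)[OF *(3)] card_half_Diff_image_bar[OF T *(2)] by linarith
    then have "odd (card (?b ` J \<inter> {c + 1..n + 1}) + card ({c + 1..n + 1} - ?b ` T))"
      using *(4) by (metis dvd_triv_left even_add)
    then have "card (?b ` T \<inter> {1..c}) + 1 \<le> vec.dim (S \<inter> r.E ({1..c} \<union> ?b ` J))"
      using rev * lagr_image_bar(1)[OF *(3)] sym_hull_image_bar[OF T(2)]
      unfolding r.flag_conditions_def by blast
    moreover have "{1..c} \<union> ?b ` J \<subseteq> {1..N}" using image_bar_subset[OF J1] cN by auto
    then have "r.E ({1..c} \<union> ?b ` J) = E (?b ` ({1..c} \<union> ?b ` J))" by (rule E_rev)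
    moreover have "?b ` ({1..c} \<union> ?b ` J) = {N - c + 1..N} \<union> J"
    proof (intro equalityI subsetI)
      fix i assume "i \<in> ?b ` ({1..c} \<union> ?b ` J)"
      then obtain j where "i = N + 1 - j" "j \<in> {1..c} \<or> (\<exists>h\<in>J. j = N + 1 - h)" by blast
      then consider "j \<in> {1..c}" "i = N + 1 - j" | h where "h \<in> J" "i = N + 1 - (N + 1 - h)" by blast
      then show "i \<in> {N - c + 1..N} \<union> J"
      proof cases
        case 1
        then show ?thesis using cN by auto
      next
        case 2
        then have "i = h" using J1 by force
        then show ?thesis using 2 by simp
      qed
    next
      fix i assume i: "i \<in> {N - c + 1..N} \<union> J"
      then have "i \<in> {1..N}" using J1 cN by auto
      then have "i = N + 1 - (N + 1 - i)" by simp
      moreover have "N + 1 - i \<in> {1..c} \<union> ?b ` J" using i cN by auto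
      ultimately show "i \<in> ?b ` ({1..c} \<union> ?b ` J)" by blast
    qed
    ultimately show "card (T \<inter> {N - c + 1..N}) + 1 \<le> vec.dim (S \<inter> E ({N - c + 1..N} \<union> J))"
      using card_image_bar_initial[OF T(2) cN] by simp
  qed
qed

text \<open>Truncated subtraction makes the double reversal the identity only on a bounded range, so
  the two bases agree on \<open>{1..N}\<close> without being the same function.\<close>

lemma flag_conditions_rev_rev:
  assumes P: "P \<subseteq> {1..N}" and flag: "flag_conditions P S"
  shows "split_quadric.flag_conditions (\<lambda>i. e (N + 1 - (N + 1 - i))) N n
    ((\<lambda>i. N + 1 - i) ` (\<lambda>i. N + 1 - i) ` P) S"
proof -
  interpret r: split_quadric "\<lambda>i. e (N + 1 - i)" N n \<omega> by (rule split_quadric_rev)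
  interpret rr: split_quadric "\<lambda>i. e (N + 1 - (N + 1 - i))" N n \<omega> by (rule r.split_quadric_rev)
  have ii: "N + 1 - (N + 1 - i) = i" if "i \<in> {1..N}" for i using that by auto
  have "coord (\<lambda>i. e (N + 1 - (N + 1 - i))) i x = coord e i x" if "i \<in> {1..N}" for i x
    using r.coord_rev[of i x] coord_rev[of "N + 1 - i" x] ii[OF that] by simp
  then have "coord_subspace (\<lambda>i. e (N + 1 - (N + 1 - i))) = coord_subspace e"
    unfolding coord_subspace_def N_eq[symmetric] by (intro ext) (simp del: diff_diff_cancel)
  then have "rr.flag_conditions P S"
    using flag unfolding rr.flag_conditions_def flag_conditions_def by simp
  moreover have "(\<lambda>i. N + 1 - i) ` (\<lambda>i. N + 1 - i) ` P = P"
    unfolding image_image using ii P by force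
  ultimately show ?thesis by simp
qed

end

section \<open>Exceptional cuts\<close>

lemma sum_eq_last:
  fixes f :: "nat \<Rightarrow> complex"
  assumes "1 \<le> c" "\<And>i. 1 \<le> i \<Longrightarrow> i < c \<Longrightarrow> f i = 0"
  shows "(\<Sum>i\<in>{1..c}. f i) = f c"
  using assms by (subst sum.remove[of _ c]) (auto intro!: sum.neutral)

text \<open>The condition on \<open>T\<close> is stated for the reversed basis so that reversal is a
  symmetry of the locale, exchanging \<open>P\<close> with the reflection of
  \<open>T\<close>.\<close>

locale split_richardson = split_quadric e N n \<omega>
  for e :: "nat \<Rightarrow> complex^'k" and N n \<omega> +
  fixes m :: nat and S :: "(complex^'k) set" and P T :: "nat set"
  assumes subspace_S: "vec.subspace S" and dim_S: "vec.dim S = m"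
    and isotropic_S: "x \<in> S \<Longrightarrow> y \<in> S \<Longrightarrow> \<omega> x y = 0"
    and P_subset: "P \<subseteq> {1..N}" and T_subset: "T \<subseteq> {1..N}"
    and card_P: "card P = m" and card_T: "card T = m"
    and P_symbol: "\<forall>c\<in>P. \<forall>d\<in>P. c + d \<noteq> N + 1"
    and T_symbol: "\<forall>c\<in>T. \<forall>d\<in>T. c + d \<noteq> N + 1"
    and flag: "flag_conditions P S"
    and opposite_flag:
      "split_quadric.flag_conditions (\<lambda>i. e (N + 1 - i)) N n ((\<lambda>i. N + 1 - i) ` T) S"
begin

sublocale pt: isotropic_subspace e N \<omega> "\<lambda>_. 1" S
  by unfold_locales (use form subspace_S isotropic_S in simp_all)

lemma split_richardson_rev:
  "split_richardson (\<lambda>i. e (N + 1 - i)) N n \<omega> m S ((\<lambda>i. N + 1 - i) ` T) ((\<lambda>i. N + 1 - i) ` P)"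
proof -
  interpret r: split_quadric "\<lambda>i. e (N + 1 - i)" N n \<omega> by (rule split_quadric_rev)
  show ?thesis
  proof
    show "r.flag_conditions ((\<lambda>i. N + 1 - i) ` T) S" by (rule opposite_flag)
    show "split_quadric.flag_conditions (\<lambda>i. e (N + 1 - (N + 1 - i))) N n
        ((\<lambda>i. N + 1 - i) ` (\<lambda>i. N + 1 - i) ` P) S"
      by (rule flag_conditions_rev_rev[OF P_subset flag])
  qed (use subspace_S dim_S isotropic_S image_bar_subset[OF P_subset] image_bar_subset[OF T_subset]
    card_image_bar[OF P_subset] card_image_bar[OF T_subset] card_P card_T
    image_bar_symbol[OF P_symbol P_subset] image_bar_symbol[OF T_symbol T_subset] in simp_all)
qed


abbreviation "I c \<equiv> {c + 1..N - c}"
abbreviation "H c \<equiv> {c + 1..n + 1}"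
text \<open>\<open>A c\<close> and \<open>B c\<close> realise inside \<open>E (I c)\<close> the
  images of two parts of \<open>S\<close> in the quotients of \<open>E {1..N - c}\<close> by
  \<open>E {1..c}\<close> and of \<open>E {c + 1..N}\<close> by
  \<open>E {N - c + 1..N}\<close>.\<close>

abbreviation "A c \<equiv> pr (I c) ` (S \<inter> E {1..N - c})"
abbreviation "B c \<equiv> pr (I c) ` (S \<inter> E {c + 1..N})"

lemma dim_initial: "c \<le> N \<Longrightarrow> card (P \<inter> {1..c}) \<le> vec.dim (S \<inter> E {1..c})"
  using flag unfolding flag_conditions_def by blast

lemma family_P:
  "c \<le> n \<Longrightarrow> H c \<subseteq> sym_hull N P \<Longrightarrow> lagr c J \<Longrightarrow> odd (card (J \<inter> H c) + card (H c - P)) \<Longrightarrow>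
    card (P \<inter> {1..c}) + 1 \<le> vec.dim (S \<inter> E ({1..c} \<union> J))"
  using flag unfolding flag_conditions_def by blast

lemma opposite_flag': "opposite_flag_conditions T S"
  by (rule opposite_flag_conditions_if_rev[OF T_symbol T_subset opposite_flag])

lemma dim_final: "c \<le> N \<Longrightarrow> card (T \<inter> {c + 1..N}) \<le> vec.dim (S \<inter> E {c + 1..N})"
  using opposite_flag' unfolding opposite_flag_conditions_def by blast

lemma family_T:
  "c \<le> n \<Longrightarrow> H c \<subseteq> sym_hull N T \<Longrightarrow> lagr c J \<Longrightarrow> odd (card (J \<inter> H c) + card (H c - T)) \<Longrightarrow>
    card (T \<inter> {N - c + 1..N}) + 1 \<le> vec.dim (S \<inter> E ({N - c + 1..N} \<union> J))"
  using opposite_flag' unfolding opposite_flag_conditions_def by blast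

lemma card_T_split:
  assumes "c \<le> n" "H c \<subseteq> sym_hull N T"
  shows "card (T \<inter> {1..c}) + (n + 1 - c) + card (T \<inter> {N - c + 1..N}) = m"
    and "card (T \<inter> {c + 1..N}) = (n + 1 - c) + card (T \<inter> {N - c + 1..N})"
proof -
  have "c \<le> n + 1" "c \<le> N" "N - c \<le> N" using assms(1) N_even by auto
  then show "card (T \<inter> {1..c}) + (n + 1 - c) + card (T \<inter> {N - c + 1..N}) = m"
    "card (T \<inter> {c + 1..N}) = (n + 1 - c) + card (T \<inter> {N - c + 1..N})"
    using card_symbol_split[OF T_symbol assms(2)] card_split_at[OF T_subset, of c]
      card_split_at[OF T_subset, of "N - c"] card_T by linarith+
qed

lemma dim_U:
  assumes "c \<le> n" "H c \<subseteq> sym_hull N P"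
  shows "card (P \<inter> {1..c}) + (n + 1 - c) \<le> vec.dim (S \<inter> E {1..N - c})"
  using card_symbol_split[OF P_symbol assms(2)] dim_initial[of "N - c"] assms(1) by simp

lemma dim_V:
  assumes "c \<le> n" "H c \<subseteq> sym_hull N T"
  shows "(n + 1 - c) + card (T \<inter> {N - c + 1..N}) \<le> vec.dim (S \<inter> E {c + 1..N})"
  using card_T_split(2)[OF assms] dim_final[of c] assms(1) N_even by simp

lemma dim_G:
  assumes "c \<le> n"
  shows "card (T \<inter> {N - c + 1..N}) \<le> vec.dim (S \<inter> E {N - c + 1..N})"
  using dim_final[of "N - c"] by simp

lemma form_pr_final:
  assumes c: "c \<le> n + 1" and x: "x \<in> E {c + 1..N}" and y: "y \<in> E {c + 1..N}"
  shows "\<omega> x y = \<omega> (pr (I c) x) (pr (I c) y)"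
proof -
  have "coord e i z = 0" if "z \<in> E {c + 1..N}" "i \<in> {1..c}" for z i
    using that c N_even by (intro mem_E_D[OF that(1)]) auto
  then show ?thesis using form_split[OF c, of x y] x y by simp
qed

lemma A_props:
  assumes c: "c \<le> n"
  shows "vec.subspace (A c)" "A c \<subseteq> E (I c)" "\<And>x y. x \<in> A c \<Longrightarrow> y \<in> A c \<Longrightarrow> \<omega> x y = 0"
    "vec.dim (A c) + vec.dim (S \<inter> E {1..c}) = vec.dim (S \<inter> E {1..N - c})"
proof -
  show "vec.subspace (A c)" using subspace_S by (intro subspace_pr_image) (simp add: vec.subspace_inter)
  show "A c \<subseteq> E (I c)" using pr_mem by blast
  show "\<omega> x y = 0" if xy: "x \<in> A c" "y \<in> A c" for x y
  proof -
    obtain u v where "u \<in> S \<inter> E {1..N - c}" "x = pr (I c) u" "v \<in> S \<inter> E {1..N - c}" "y = pr (I c) v"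
      using xy by blast
    then show ?thesis using form_pr_initial[of c u v] isotropic_S[of u v] c by simp
  qed
  have "{1..N - c} = {1..c} \<union> I c" using c N_even by auto
  then show "vec.dim (A c) + vec.dim (S \<inter> E {1..c}) = vec.dim (S \<inter> E {1..N - c})"
    using dim_pr_image[OF subspace_S, of "{1..c}" "I c"] c N_even by auto
qed

lemma B_props:
  assumes c: "c \<le> n"
  shows "vec.subspace (B c)" "B c \<subseteq> E (I c)" "\<And>x y. x \<in> B c \<Longrightarrow> y \<in> B c \<Longrightarrow> \<omega> x y = 0"
    "vec.dim (B c) + vec.dim (S \<inter> E {N - c + 1..N}) = vec.dim (S \<inter> E {c + 1..N})"
proof -
  show "vec.subspace (B c)" using subspace_S by (intro subspace_pr_image) (simp add: vec.subspace_inter)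
  show "B c \<subseteq> E (I c)" using pr_mem by blast
  show "\<omega> x y = 0" if xy: "x \<in> B c" "y \<in> B c" for x y
  proof -
    obtain u v where "u \<in> S \<inter> E {c + 1..N}" "x = pr (I c) u" "v \<in> S \<inter> E {c + 1..N}" "y = pr (I c) v"
      using xy by blast
    then show ?thesis using form_pr_final[of c u v] isotropic_S[of u v] c by simp
  qed
  have "{c + 1..N} = {N - c + 1..N} \<union> I c" using c N_even by auto
  then show "vec.dim (B c) + vec.dim (S \<inter> E {N - c + 1..N}) = vec.dim (S \<inter> E {c + 1..N})"
    using dim_pr_image[OF subspace_S, of "{N - c + 1..N}" "I c"] by auto
qed

text \<open>As \<open>S \<inter> E {1..c}\<close> is no larger than prescribed, the extra dimension
  in \<open>family_P\<close> yields a vector outside \<open>E {1..c}\<close>, whose projection is a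
  nonzero element of \<open>A c \<inter> E J\<close>.\<close>

lemma A_family:
  assumes c: "c \<le> n" "H c \<subseteq> sym_hull N P" and r: "vec.dim (S \<inter> E {1..c}) \<le> card (P \<inter> {1..c})"
    and J: "lagr c J" "A c \<inter> E J \<subseteq> {0}"
  shows "even (card (J \<inter> H c) + card (H c - P))"
proof (rule ccontr)
  assume "odd (card (J \<inter> H c) + card (H c - P))"
  then have "vec.dim (S \<inter> E {1..c}) < vec.dim (S \<inter> E ({1..c} \<union> J))"
    using family_P[OF c J(1)] r by simp
  then obtain x where x: "x \<in> S" "x \<in> E ({1..c} \<union> J)" "x \<notin> E {1..c}"
    using exists_diff_if_dim_less by blast
  have "{1..c} \<union> J \<subseteq> {1..N - c}" "{1..c} \<union> J \<subseteq> {1..c} \<union> I c"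
    using lagr_subset[OF J(1)] c N_even by auto
  then have xU: "x \<in> E {1..N - c}" "x \<in> E ({1..c} \<union> I c)" using x(2) E_mono by blast+
  have "pr (I c) x \<in> E J"
  proof (rule mem_E_I)
    fix i assume i: "i \<in> {1..N}" "i \<notin> J"
    show "coord e i (pr (I c) x) = 0"
    proof (cases "i \<in> I c")
      case True
      then have "i \<notin> {1..c} \<union> J" using i(2) by auto
      then show ?thesis using coord_pr[OF i(1)] mem_E_D[OF x(2) i(1)] by simp
    next
      case False
      then show ?thesis using coord_pr[OF i(1), of "I c" x] by (simp only: if_False)
    qed
  qed
  then have "pr (I c) x = 0" using J(2) x(1) xU(1) by blast
  then show False using mem_E_if_pr_eq_0[OF xU(2)] x(3) by simp
qed

lemma B_family:
  assumes c: "c \<le> n" "H c \<subseteq> sym_hull N T"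
    and g: "vec.dim (S \<inter> E {N - c + 1..N}) \<le> card (T \<inter> {N - c + 1..N})"
    and J: "lagr c J" "B c \<inter> E J \<subseteq> {0}"
  shows "even (card (J \<inter> H c) + card (H c - T))"
proof (rule ccontr)
  assume "odd (card (J \<inter> H c) + card (H c - T))"
  then have "vec.dim (S \<inter> E {N - c + 1..N}) < vec.dim (S \<inter> E ({N - c + 1..N} \<union> J))"
    using family_T[OF c J(1)] g by simp
  then obtain x where x: "x \<in> S" "x \<in> E ({N - c + 1..N} \<union> J)" "x \<notin> E {N - c + 1..N}"
    using exists_diff_if_dim_less by blast
  have "{N - c + 1..N} \<subseteq> {c + 1..N}" "I c \<subseteq> {c + 1..N}" using c N_even by auto
  then have "{N - c + 1..N} \<union> J \<subseteq> {c + 1..N}" "{N - c + 1..N} \<union> J \<subseteq> {N - c + 1..N} \<union> I c"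
    using lagr_subset[OF J(1)] by blast+
  then have xU: "x \<in> E {c + 1..N}" "x \<in> E ({N - c + 1..N} \<union> I c)" using x(2) E_mono by blast+
  have "pr (I c) x \<in> E J"
  proof (rule mem_E_I)
    fix i assume i: "i \<in> {1..N}" "i \<notin> J"
    show "coord e i (pr (I c) x) = 0"
    proof (cases "i \<in> I c")
      case True
      then have "i \<notin> {N - c + 1..N} \<union> J" using i(2) by auto
      then show ?thesis using coord_pr[OF i(1)] mem_E_D[OF x(2) i(1)] by simp
    next
      case False
      then show ?thesis using coord_pr[OF i(1), of "I c" x] by (simp only: if_False)
    qed
  qed
  then have "pr (I c) x = 0" using J(2) x(1) xU(1) by blast
  then show False using mem_E_if_pr_eq_0[OF xU(2)] x(3) by simp
qed

lemma pr_U_G: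
  assumes c: "c \<le> n" and u: "u \<in> E {1..N - c}" and y: "y \<in> E {N - c + 1..N}"
  shows "pr (I c) (u + y) = pr (I c) u"
proof -
  have "pr (I c) y = 0" by (rule pr_eq_0[OF y]) auto
  then show ?thesis by (simp add: pr_add)
qed

text \<open>With equal counts \<open>S\<close> splits at \<open>N - c\<close>, so every vector of
  \<open>S\<close> projects into \<open>A c\<close> and \<open>B c\<close> lies in
  \<open>A c\<close>. An index set transversal to \<open>A c\<close> is then transversal to both and
  carries both parities. This rules out a case for lone stars in \<open>P\<close>.\<close>

lemma equal_counts_even:
  assumes c: "c \<le> n" and HP: "H c \<subseteq> sym_hull N P" and HT: "H c \<subseteq> sym_hull N T"
    and eq: "card (T \<inter> {1..c}) = card (P \<inter> {1..c})"
  shows "even (card (H c - P) + card (H c - T))"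
proof (rule ccontr)
  assume odd: "odd (card (H c - P) + card (H c - T))"
  note cT = card_T_split[OF c HT]
  have "vec.dim (S \<inter> E {1..c}) + vec.dim (S \<inter> E {c + 1..N}) \<le> m"
    using dim_Int_E_disjoint_le[OF subspace_S, of "{1..c}" "{c + 1..N}"] dim_S by auto
  then have dF: "vec.dim (S \<inter> E {1..c}) \<le> card (P \<inter> {1..c})"
    using dim_V[OF c HT] cT eq by linarith
  have "vec.dim (S \<inter> E {1..N - c}) + vec.dim (S \<inter> E {N - c + 1..N}) \<le> m"
    using dim_Int_E_disjoint_le[OF subspace_S, of "{1..N - c}" "{N - c + 1..N}"] dim_S by auto
  then have dG: "vec.dim (S \<inter> E {N - c + 1..N}) \<le> card (T \<inter> {N - c + 1..N})"
    using dim_U[OF c HP] cT eq by linarith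
  obtain J where J: "lagr c J" "A c \<inter> E J \<subseteq> {0}"
    using exists_transversal[of c "A c"] A_props[OF c] c by auto
  have eP: "even (card (J \<inter> H c) + card (H c - P))" by (rule A_family[OF c HP dF J])
  have "B c \<inter> E J \<subseteq> {0}"
  proof
    fix z assume z: "z \<in> B c \<inter> E J"
    then obtain s where s: "s \<in> S" "z = pr (I c) s" by blast
    have "vec.dim S \<le> vec.dim (S \<inter> E {1..N - c}) + vec.dim (S \<inter> E {N - c + 1..N})"
      using dim_U[OF c HP] dim_G[OF c] cT eq dim_S by linarith
    then obtain u y where "u \<in> S" "u \<in> E {1..N - c}" "y \<in> S" "y \<in> E {N - c + 1..N}" "s = u + y"
      by (rule split_if_disjoint[OF subspace_S _ _ s(1)]) auto
    then have "z \<in> A c" using pr_U_G[OF c] s(2) by auto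
    then show "z \<in> {0}" using J(2) z by blast
  qed
  then have "even (card (J \<inter> H c) + card (H c - T))" using B_family[OF c HT dG J(1)] by blast
  then show False using eP odd by presburger
qed


text \<open>The off-by-one in the counts makes \<open>A c\<close> and \<open>B c\<close> equal or
  adjacent, the parity makes them equal. Then all of \<open>S\<close> projects into this one
  isotropic subspace, so the middle part of the form vanishes on \<open>S\<close> and the outer part
  must vanish too.\<close>

lemma outer_form_zero:
  assumes c: "c \<le> n" and HP: "H c \<subseteq> sym_hull N P" and HT: "H c \<subseteq> sym_hull N T"
    and card: "card (T \<inter> {1..c}) = card (P \<inter> {1..c}) + 1"
    and par: "even (card (H c - P) + card (H c - T))"
    and dF: "vec.dim (S \<inter> E {1..c}) \<le> card (P \<inter> {1..c})"
    and dG: "vec.dim (S \<inter> E {N - c + 1..N}) \<le> card (T \<inter> {N - c + 1..N})"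
    and x: "x \<in> S" and y: "y \<in> S"
  shows "(\<Sum>i\<in>{1..c}. coord e i x * coord e (N + 1 - i) y)
    + (\<Sum>i\<in>{1..c}. coord e (N + 1 - i) x * coord e i y) = 0"
proof -
  note cT = card_T_split[OF c HT] and A = A_props[OF c] and B = B_props[OF c]
  have c1: "c \<le> n + 1" using c by simp
  have dA: "vec.dim (A c) = n + 1 - c"
    using dim_U[OF c HP] A(4) dF dim_isotropic_le[OF c1 A(1-3)] by linarith
  have dB: "vec.dim (B c) = n + 1 - c"
    using dim_V[OF c HT] B(4) dG dim_isotropic_le[OF c1 B(1-3)] by linarith
  have UV: "{1..N - c} \<inter> {c + 1..N} = I c" by auto
  have IA: "S \<inter> E (I c) \<subseteq> A c" and IB: "S \<inter> E (I c) \<subseteq> B c"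
  proof -
    have "I c \<subseteq> {1..N - c}" "I c \<subseteq> {c + 1..N}" by auto
    then have "E (I c) \<subseteq> E {1..N - c}" "E (I c) \<subseteq> E {c + 1..N}" by (simp_all add: E_mono)
    moreover have "z = pr (I c) z" if "z \<in> E (I c)" for z using pr_id[OF that] by simp
    ultimately show "S \<inter> E (I c) \<subseteq> A c" "S \<inter> E (I c) \<subseteq> B c" by blast+
  qed
  \<comment> \<open>The prescribed dimensions add up to \<open>m + (n + 1 - c) - 1\<close>; the
    missing one is the off-by-one in \<open>card\<close>.\<close>
  have dI: "(n + 1 - c) \<le> vec.dim (S \<inter> E (I c)) + 1"
    using dim_Int_E_add_le[OF subspace_S, of "{1..N - c}" "{c + 1..N}"]
      dim_U[OF c HP] dim_V[OF c HT] cT card dim_S unfolding UV by linarith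
  have "vec.dim (S \<inter> E (I c)) \<le> vec.dim (A c \<inter> B c)"
    using IA IB by (intro vec.dim_subset) blast
  then have "n + 1 - c \<le> vec.dim (A c \<inter> B c) + 1" using dI by linarith
  then have AB: "A c = B c"
    using adjacent_same_family_eq[OF c1 A(1-3) dA B(1-3) dB _ A_family[OF c HP dF] B_family[OF c HT dG] par]
    by blast
  \<comment> \<open>Vectors of \<open>S\<close> need not lie in \<open>E {1..N - c}\<close> or
    \<open>E {c + 1..N}\<close>. Either \<open>S \<inter> E (I c)\<close> is already all of
    \<open>A c\<close>, and orthogonality to it forces membership, or the dimension count shows that
    \<open>S\<close> is the sum of its two parts.\<close>
  have prA: "pr (I c) z \<in> A c" if z: "z \<in> S" for z
  proof (cases "n + 1 - c \<le> vec.dim (S \<inter> E (I c))")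
    case True
    have "S \<inter> E (I c) = A c"
      using IA A(1) True dA subspace_S by (intro vec.subspace_dim_equal) (auto simp: vec.subspace_inter)
    then have AS: "y \<in> S" "y \<in> E (I c)" if "y \<in> A c" for y using that by blast+
    show ?thesis
    proof (rule mem_if_orthogonal[OF c1 A(1-3) dA pr_mem])
      fix y assume y: "y \<in> A c"
      have "coord e i y = 0" "coord e (N + 1 - i) y = 0" if "i \<in> {1..c}" for i
        using that c N_even by (auto intro!: mem_E_D[OF AS(2)[OF y]])
      then have "\<omega> z y = \<omega> (pr (I c) z) (pr (I c) y)" using form_split[OF c1, of z y] by simp
      then show "\<omega> (pr (I c) z) y = 0" using isotropic_S[OF z AS(1)[OF y]] pr_id[OF AS(2)[OF y]] by simp
    qed
  next
    case False
    then have "vec.dim S + vec.dim (S \<inter> E ({1..N - c} \<inter> {c + 1..N}))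
        \<le> vec.dim (S \<inter> E {1..N - c}) + vec.dim (S \<inter> E {c + 1..N})"
      using dim_U[OF c HP] dim_V[OF c HT] cT card dim_S unfolding UV by linarith
    then obtain u v where uv: "u \<in> S" "u \<in> E {1..N - c}" "v \<in> S" "v \<in> E {c + 1..N}" "z = u + v"
      by (rule split_if_dim[OF subspace_S _ z])
    have "pr (I c) v \<in> B c" using uv(3,4) by blast
    then have "pr (I c) v \<in> A c" by (simp only: AB)
    moreover have "pr (I c) u \<in> A c" using uv(1,2) by blast
    ultimately show ?thesis unfolding uv(5) pr_add by (intro vec.subspace_add[OF A(1)])
  qed
  have "\<omega> (pr (I c) x) (pr (I c) y) = 0" using A(3) prA x y by blast
  then show ?thesis using form_split[OF c1, of x y] isotropic_S[OF x y] by (simp add: add.assoc)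
qed

text \<open>If an outer intersection is larger than prescribed, \<open>S\<close> splits at
  \<open>c\<close> or at \<open>N - c\<close> as at an apparent cut. Otherwise the family conditions
  are effective, and the outer form at \<open>x\<close>, \<open>x\<close> is twice the
  quadric.\<close>

lemma exceptional_quadric:
  assumes c: "c \<le> n" and HP: "H c \<subseteq> sym_hull N P" and HT: "H c \<subseteq> sym_hull N T"
    and card: "card (T \<inter> {1..c}) = card (P \<inter> {1..c}) + 1"
    and par: "even (card (H c - P) + card (H c - T))"
    and x: "x \<in> S"
  shows "(\<Sum>i\<in>{1..c}. coord e i x * coord e (N + 1 - i) x) = 0"
proof -
  note cT = card_T_split[OF c HT]
  have c1: "c \<le> n + 1" using c by simp
  consider "card (P \<inter> {1..c}) + 1 \<le> vec.dim (S \<inter> E {1..c})"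
    | "card (T \<inter> {N - c + 1..N}) + 1 \<le> vec.dim (S \<inter> E {N - c + 1..N})"
    | "vec.dim (S \<inter> E {1..c}) \<le> card (P \<inter> {1..c})"
      "vec.dim (S \<inter> E {N - c + 1..N}) \<le> card (T \<inter> {N - c + 1..N})" by linarith
  then show ?thesis
  proof cases
    case 1
    then have "vec.dim S \<le> vec.dim (S \<inter> E {1..c}) + vec.dim (S \<inter> E {c + 1..N})"
      using dim_V[OF c HT] cT card dim_S by linarith
    then obtain y z where "y \<in> S" "y \<in> E {1..c}" "z \<in> S" "z \<in> E {c + 1..N}" "x = y + z"
      by (rule split_if_disjoint[OF subspace_S _ _ x]) auto
    then show ?thesis using pt.quadric_eq_0_if_split[of c y c z] c N_even by simp
  next
    case 2
    then have "vec.dim S \<le> vec.dim (S \<inter> E {1..N - c}) + vec.dim (S \<inter> E {N - c + 1..N})"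
      using dim_U[OF c HP] cT card dim_S by linarith
    then obtain y z where "y \<in> S" "y \<in> E {1..N - c}" "z \<in> S" "z \<in> E {N - c + 1..N}" "x = y + z"
      by (rule split_if_disjoint[OF subspace_S _ _ x]) auto
    then show ?thesis using pt.quadric_eq_0_if_split[of c y "N - c" z] c N_even by simp
  next
    case 3
    have "(\<Sum>i\<in>{1..c}. coord e (N + 1 - i) x * coord e i x) = (\<Sum>i\<in>{1..c}. coord e i x * coord e (N + 1 - i) x)"
      by (simp add: mult.commute)
    then show ?thesis using outer_form_zero[OF c HP HT card par 3 x x] by simp
  qed
qed

text \<open>Wherever possible a vector of \<open>S\<close> starting at column \<open>c\<close> is
  paired with \<open>x\<close> or a summand of it, which isolates coordinate
  \<open>N + 1 - c\<close>; the cases differ in how such a vector is found.\<close>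

lemma lone_star_T:
  assumes c1: "1 \<le> c" and c: "c \<le> n" and HP: "H c \<subseteq> sym_hull N P" and HT: "H c \<subseteq> sym_hull N T"
    and card: "card (T \<inter> {1..c}) = card (P \<inter> {1..c}) + 1"
    and par: "even (card (H c - P) + card (H c - T))"
    and cT: "c \<in> T" and x: "x \<in> S"
  shows "coord e (N + 1 - c) x = 0"
proof -
  note sT = card_T_split[OF c HT]
  have cN: "c \<in> {1..N}" "N + 1 - c \<in> {1..N}" using c c1 N_even by auto
  have dG: "vec.dim (S \<inter> E {1..N - c}) + vec.dim (S \<inter> E {N - c + 1..N}) \<le> m"
    using dim_Int_E_disjoint_le[OF subspace_S, of "{1..N - c}" "{N - c + 1..N}"] dim_S by auto
  have dV': "card (T \<inter> {c + 1..N}) + 1 \<le> vec.dim (S \<inter> E {c..N})"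
  proof -
    have "T \<inter> {c..N} = insert c (T \<inter> {c + 1..N})" using cT cN by auto
    then have "card (T \<inter> {c..N}) = card (T \<inter> {c + 1..N}) + 1" by simp
    then show ?thesis using dim_final[of "c - 1"] cN c1 by simp
  qed
  have low: "coord e i z = 0" if "z \<in> E {c..N}" "1 \<le> i" "i < c" for z i
    using that cN by (intro mem_E_D[OF that(1)]) auto
  have high: "coord e (N + 1 - i) u = 0" if "u \<in> E {1..N - c}" "1 \<le> i" "i \<le> c" for u i
    using that cN by (intro mem_E_D[OF that(1)]) auto
  consider "card (P \<inter> {1..c}) + 1 \<le> vec.dim (S \<inter> E {1..c})"
    | "vec.dim (S \<inter> E {1..c}) \<le> card (P \<inter> {1..c})"
      "card (T \<inter> {N - c + 1..N}) + 1 \<le> vec.dim (S \<inter> E {N - c + 1..N})"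
    | "vec.dim (S \<inter> E {1..c}) \<le> card (P \<inter> {1..c})"
      "vec.dim (S \<inter> E {N - c + 1..N}) \<le> card (T \<inter> {N - c + 1..N})" by linarith
  then show ?thesis
  proof cases
    case 1
    \<comment> \<open>The left intersection is larger than prescribed, so it overlaps
      \<open>S \<inter> E {c..N}\<close> in the line of \<open>e c\<close>.\<close>
    have "{1..c} \<inter> {c..N} = {c}" using cN by auto
    then have "0 < vec.dim (S \<inter> E {c})"
      using dim_Int_E_add_le[OF subspace_S, of "{1..c}" "{c..N}"] 1 dV' sT card dim_S by simp
    then obtain w where "w \<in> S" "w \<in> E {c}" "w \<noteq> 0" using exists_nonzero_if_dim_pos by blast
    then show ?thesis using pt.coord_bar_eq_0_if_line cN x by blast
  next
    \<comment> \<open>Here the family condition for \<open>T\<close> at \<open>c\<close> is void; if no \<open>z\<close> below exists, the one at \<open>c - 1\<close> is used.\<close>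
    case 2
    have dS: "vec.dim S \<le> vec.dim (S \<inter> E {1..N - c}) + vec.dim (S \<inter> E {N - c + 1..N})"
      using dim_U[OF c HP] 2 sT card dim_S by linarith
    obtain u y where uy: "u \<in> S" "u \<in> E {1..N - c}" "y \<in> S" "y \<in> E {N - c + 1..N}" "x = u + y"
      by (rule split_if_disjoint[OF subspace_S dS _ x]) auto
    have xy: "coord e (N + 1 - c) x = coord e (N + 1 - c) y"
      using high[OF uy(2), of c] c1 by (simp add: uy(5) coord_add)
    show ?thesis
    proof (cases "\<exists>z\<in>S \<inter> E {c..N}. coord e c z \<noteq> 0")
      case True
      then obtain z where z: "z \<in> S" "z \<in> E {c..N}" "coord e c z \<noteq> 0" by blast
      have y0: "coord e i y = 0" if "i \<in> {1..N - c}" for i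
        using that by (intro mem_E_D[OF uy(4)]) auto
      have "pr (I c) y = 0" by (rule pr_eq_0[OF uy(4)]) auto
      then have "\<omega> (pr (I c) z) (pr (I c) y) = 0" unfolding form by (simp add: coord_zero)
      moreover have "(\<Sum>i\<in>{1..c}. coord e (N + 1 - i) z * coord e i y) = 0"
        using y0 c N_even by (intro sum.neutral) auto
      ultimately have "(\<Sum>i\<in>{1..c}. coord e i z * coord e (N + 1 - i) y) = 0"
        using form_split[of c z y] c isotropic_S[OF z(1) uy(3)] by simp
      moreover have "(\<Sum>i\<in>{1..c}. coord e i z * coord e (N + 1 - i) y) = coord e c z * coord e (N + 1 - c) y"
        using low[OF z(2)] c1 by (intro sum_eq_last) auto
      ultimately show ?thesis using z(3) xy by simp
    next
      case False
      show ?thesis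
      proof (rule ccontr)
        assume "coord e (N + 1 - c) x \<noteq> 0"
        then have yc: "coord e (N + 1 - c) y \<noteq> 0" using xy by simp
        have sub: "{N - (c - 1) + 1..N} \<subseteq> {N - c + 1..N}" by auto
        have "y \<notin> E {N - (c - 1) + 1..N}"
          using yc mem_E_D[of y "{N - (c - 1) + 1..N}" "N + 1 - c"] cN c1 by auto
        then have "vec.dim (S \<inter> E {N - (c - 1) + 1..N}) < vec.dim (S \<inter> E {N - c + 1..N})"
          using uy E_mono[OF sub] subspace_S
          by (intro dim_less_if_mem_diff[of _ _ y]) (auto simp: vec.subspace_inter)
        \<comment> \<open>Since \<open>y\<close> has nonzero coordinate \<open>N + 1 - c\<close>,
          the shorter final segment meets \<open>S\<close> in at most the prescribed dimension, so
          the family condition at \<open>c - 1\<close> is effective.\<close>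
        then have dG': "vec.dim (S \<inter> E {N - (c - 1) + 1..N}) \<le> card (T \<inter> {N - c + 1..N})"
          using dG dim_U[OF c HP] sT card by linarith
        obtain J where J: "lagr c J" "A c \<inter> E J \<subseteq> {0}"
          using exists_transversal[of c "A c"] A_props[OF c] c by auto
        have eP: "even (card (J \<inter> H c) + card (H c - P))" by (rule A_family[OF c HP 2(1) J])
        have c': "c - 1 \<le> n" using c by simp
        have cc: "c - 1 + 1 = c" using c1 by simp
        have Hc: "H (c - 1) = insert c (H c)" using c c1 by auto
        have HT': "H (c - 1) \<subseteq> sym_hull N T" using HT cT unfolding Hc by (auto simp: sym_hull_def)
        \<comment> \<open>\<open>insert c J\<close> has the wrong parity for \<open>T\<close> at
          \<open>c - 1\<close>: it gains the index \<open>c\<close>, whereas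
          \<open>c \<in> T\<close> leaves the count of missing indices unchanged.\<close>
        have J': "lagr (c - 1) (insert c J)"
        proof (rule lagrangian_indicesI)
          show "c - 1 < i \<and> i + (c - 1) \<le> 2 * n + 2" if "i \<in> insert c J" for i
            using that lagrangian_indices_range[OF J(1), of i] c c1 by auto
          fix i assume i: "c - 1 < i" "i \<le> n + 1"
          have "2 * n + 3 - c \<notin> J" using lagrangian_indices_range[OF J(1), of "2 * n + 3 - c"] c by auto
          then show "i \<in> insert c J \<longleftrightarrow> 2 * n + 3 - i \<notin> insert c J"
            using lagrangian_indices_iff[OF J(1), of i] i c by (cases "i = c") auto
        qed
        have "c \<notin> J" using lagrangian_indices_range[OF J(1), of c] by auto
        then have "card (insert c J \<inter> H (c - 1)) = card (J \<inter> H c) + 1"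
        proof -
          have "insert c J \<inter> H (c - 1) = insert c (J \<inter> H c)"
            unfolding Hc using \<open>c \<notin> J\<close> by auto
          then show ?thesis by simp
        qed
        moreover have "H (c - 1) - T = H c - T" unfolding Hc using cT by auto
        ultimately have odd: "odd (card (insert c J \<inter> H (c - 1)) + card (H (c - 1) - T))"
          using eP par by simp
        have "N + 1 - c \<notin> T"
        proof
          assume "N + 1 - c \<in> T"
          then have "c + (N + 1 - c) \<noteq> N + 1" using T_symbol cT by blast
          then show False using cN by simp
        qed
        moreover have "{N - c + 1..N} = insert (N + 1 - c) {N - (c - 1) + 1..N}" using cN c1 by auto
        ultimately have "T \<inter> {N - (c - 1) + 1..N} = T \<inter> {N - c + 1..N}" by auto
        then have "vec.dim (S \<inter> E {N - (c - 1) + 1..N}) < vec.dim (S \<inter> E ({N - (c - 1) + 1..N} \<union> insert c J))"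
          using family_T[OF c' HT' J' odd] dG' by simp
        then obtain s where s: "s \<in> S" "s \<in> E ({N - (c - 1) + 1..N} \<union> insert c J)" "s \<notin> E {N - (c - 1) + 1..N}"
          using exists_diff_if_dim_less by blast
        have "{N - (c - 1) + 1..N} \<subseteq> {c..N}" "I c \<subseteq> {c..N}" "c \<in> {c..N}" using cN c N_even by auto
        then have "{N - (c - 1) + 1..N} \<union> insert c J \<subseteq> {c..N}" using lagr_subset[OF J(1)] by blast
        then have "s \<in> E {c..N}" using s(2) E_mono by blast
        then have "coord e c s = 0" using False s(1) by blast
        then have "s \<in> E (({N - (c - 1) + 1..N} \<union> insert c J) - {c})" by (rule mem_E_Diff[OF s(2)])
        then have sJ: "s \<in> E ({N - (c - 1) + 1..N} \<union> J)"
          using E_mono[of "({N - (c - 1) + 1..N} \<union> insert c J) - {c}" "{N - (c - 1) + 1..N} \<union> J"] by auto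
        \<comment> \<open>Splitting at \<open>N - c\<close> puts the projection of \<open>s\<close>
          into \<open>A c\<close>; it also lies in \<open>E J\<close>, so it vanishes, and
          \<open>s\<close> would lie in the final segment after all.\<close>
        obtain u' y' where uy': "u' \<in> S" "u' \<in> E {1..N - c}" "y' \<in> S" "y' \<in> E {N - c + 1..N}" "s = u' + y'"
          by (rule split_if_disjoint[OF subspace_S dS _ s(1)]) auto
        have "pr (I c) s \<in> A c" using pr_U_G[OF c uy'(2,4)] uy'(1,2,5) by auto
        moreover have "pr (I c) s \<in> E J"
        proof (rule mem_E_I)
          fix i assume i: "i \<in> {1..N}" "i \<notin> J"
          show "coord e i (pr (I c) s) = 0"
          proof (cases "i \<in> I c")
            case True
            then have "i \<notin> {N - (c - 1) + 1..N} \<union> J" using i(2) by auto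
            then show ?thesis using coord_pr[OF i(1)] mem_E_D[OF sJ i(1)] by simp
          next
            case False
            then show ?thesis using coord_pr[OF i(1), of "I c" s] by (simp only: if_False)
          qed
        qed
        ultimately have "pr (I c) s = 0" using J(2) by blast
        moreover have "s \<in> E ({N - (c - 1) + 1..N} \<union> I c)"
          using sJ E_mono[of "{N - (c - 1) + 1..N} \<union> J" "{N - (c - 1) + 1..N} \<union> I c"] lagr_subset[OF J(1)] by blast
        ultimately show False using mem_E_if_pr_eq_0 s(3) by blast
      qed
    qed
  next
    case 3
    note outer = outer_form_zero[OF c HP HT card par 3]
    \<comment> \<open>The support conditions leave at most the last term of each outer sum.\<close>
    have outer': "coord e c z * coord e (N + 1 - c) y + coord e (N + 1 - c) z * coord e c y = 0"
      if "z \<in> S" "y \<in> S" "z \<in> E {c..N}" "y \<in> E {c..N} \<or> z \<in> E {1..N - c}" for z y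
    proof -
      have "(\<Sum>i\<in>{1..c}. coord e i z * coord e (N + 1 - i) y) = coord e c z * coord e (N + 1 - c) y"
        using low[OF that(3)] c1 by (intro sum_eq_last) auto
      moreover have "(\<Sum>i\<in>{1..c}. coord e (N + 1 - i) z * coord e i y) = coord e (N + 1 - c) z * coord e c y"
        using low[of y] high[of z] that(4) c1 by (intro sum_eq_last) auto
      ultimately show ?thesis using outer[OF that(1,2)] by simp
    qed
    have Ic: "{1..N - c} \<inter> {c..N} = {c..N - c}" using c1 by auto
    show ?thesis
    proof (cases "\<exists>s\<in>S \<inter> E {c..N - c}. coord e c s \<noteq> 0")
      case True
      then obtain s where s: "s \<in> S" "s \<in> E {c..N - c}" "coord e c s \<noteq> 0" by blast
      have "{c..N - c} \<subseteq> {c..N}" "{c..N - c} \<subseteq> {1..N - c}" using c1 by auto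
      then have s': "s \<in> E {c..N}" "s \<in> E {1..N - c}" using s(2) E_mono by blast+
      then have "coord e (N + 1 - c) s = 0" using high[of s c] c1 by simp
      then show ?thesis using outer'[OF s(1) x s'(1)] s'(2) s(3) by simp
    next
      case False
      \<comment> \<open>Without a vector starting at \<open>c\<close>, this intersection is small
        enough for \<open>S\<close> to be the sum of its parts on \<open>{1..N - c}\<close> and
        \<open>{c..N}\<close>.\<close>
      have sub: "S \<inter> E {c..N - c} \<subseteq> A c"
      proof
        fix s assume s: "s \<in> S \<inter> E {c..N - c}"
        then have "coord e c s = 0" using False by blast
        then have "s \<in> E ({c..N - c} - {c})" using s mem_E_Diff by blast
        moreover have "{c..N - c} - {c} = I c" by auto
        ultimately have "s = pr (I c) s" by (simp add: pr_id)
        moreover have "s \<in> E {1..N - c}" using s E_mono[of "{c..N - c}" "{1..N - c}"] c1 by auto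
        ultimately show "s \<in> A c" using s by blast
      qed
      have "vec.dim (A c) \<le> n + 1 - c" using dim_isotropic_le[OF _ A_props(1-3)[OF c]] c by simp
      then have "vec.dim (S \<inter> E {c..N - c}) \<le> n + 1 - c" using vec.dim_subset[OF sub] by linarith
      then have "vec.dim S + vec.dim (S \<inter> E ({1..N - c} \<inter> {c..N}))
          \<le> vec.dim (S \<inter> E {1..N - c}) + vec.dim (S \<inter> E {c..N})"
        using dim_U[OF c HP] dV' sT card dim_S unfolding Ic by linarith
      then obtain u v where uv: "u \<in> S" "u \<in> E {1..N - c}" "v \<in> S" "v \<in> E {c..N}" "x = u + v"
        by (rule split_if_dim[OF subspace_S _ x])
      have "vec.dim (B c) \<le> n + 1 - c" using dim_isotropic_le[OF _ B_props(1-3)[OF c]] c by simp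
      then have "vec.dim (S \<inter> E {c + 1..N}) < vec.dim (S \<inter> E {c..N})"
        using B_props(4)[OF c] 3(2) dV' sT by linarith
      then obtain z where z: "z \<in> S" "z \<in> E {c..N}" "z \<notin> E {c + 1..N}"
        using exists_diff_if_dim_less by blast
      have zc: "coord e c z \<noteq> 0"
      proof
        assume "coord e c z = 0"
        then have "z \<in> E ({c..N} - {c})" by (rule mem_E_Diff[OF z(2)])
        moreover have "{c..N} - {c} = {c + 1..N}" by auto
        ultimately show False using z(3) by simp
      qed
      \<comment> \<open>Pairing \<open>z\<close> with itself counts one product twice, so its
        coordinate \<open>N + 1 - c\<close> vanishes; pairing it with \<open>v\<close> then gives
        the claim.\<close>
      have "coord e (N + 1 - c) z = 0"
        using outer'[OF z(1) z(1) z(2) disjI1[OF z(2)]] zc by (simp add: mult.commute)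
      then have "coord e (N + 1 - c) v = 0"
        using outer'[OF z(1) uv(3) z(2) disjI1[OF uv(4)]] zc by simp
      then show ?thesis using high[OF uv(2), of c] c1 by (simp add: uv(5) coord_add)
    qed
  qed
qed

end

section \<open>Lone stars in \<open>P\<close>, at the middle, and by reversal\<close>

context split_richardson
begin

lemma card_P_split:
  assumes "c \<le> n" "H c \<subseteq> sym_hull N P"
  shows "card (P \<inter> {1..c}) + (n + 1 - c) + card (P \<inter> {N - c + 1..N}) = m"
proof -
  have "c \<le> n + 1" "N - c \<le> N" using assms(1) by auto
  then show ?thesis
    using card_symbol_split[OF P_symbol assms(2)] card_split_at[OF P_subset, of "N - c"] card_P
    by linarith
qed

text \<open>Shift to \<open>c + 1\<close>, where the lone star in \<open>P\<close> becomes one in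
  \<open>T\<close>. If \<open>c + 1 \<notin> T\<close>, the counts at \<open>c + 1\<close> are equal
  and \<open>equal_counts_even\<close> contradicts the parity at \<open>c\<close>. For
  \<open>c = n\<close> there is no room to shift, and the family condition of \<open>T\<close> on
  the single middle pair is used.\<close>

lemma lone_star_P:
  assumes c: "c \<le> n" and HP: "H c \<subseteq> sym_hull N P" and HT: "H c \<subseteq> sym_hull N T"
    and card: "card (T \<inter> {1..c}) = card (P \<inter> {1..c}) + 1"
    and par: "even (card (H c - P) + card (H c - T))"
    and cP: "c + 1 \<in> P" and x: "x \<in> S"
  shows "coord e (N - c) x = 0"
proof -
  have "P \<inter> {1..c + 1} = insert (c + 1) (P \<inter> {1..c})" using cP by auto
  then have P1: "card (P \<inter> {1..c + 1}) = card (P \<inter> {1..c}) + 1" by simp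
  show ?thesis
  proof (cases "c < n")
    case True
    have Hc: "H c = insert (c + 1) (H (c + 1))" using True by auto
    have c': "c + 1 \<le> n" using True by simp
    have HP': "H (c + 1) \<subseteq> sym_hull N P" and HT': "H (c + 1) \<subseteq> sym_hull N T"
      using HP HT Hc by blast+
    have HcP: "H c - P = H (c + 1) - P" unfolding Hc using cP by auto
    show ?thesis
    proof (cases "c + 1 \<in> T")
      case True
      then have "T \<inter> {1..c + 1} = insert (c + 1) (T \<inter> {1..c})" by auto
      then have "card (T \<inter> {1..c + 1}) = card (P \<inter> {1..c + 1}) + 1" using card P1 by simp
      moreover have "H c - T = H (c + 1) - T" unfolding Hc using True by auto
      ultimately show ?thesis
        using lone_star_T[OF _ c' HP' HT' _ _ True x] par HcP by simp
    next
      case False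
      moreover have "{1..c + 1} = insert (c + 1) {1..c}" by auto
      ultimately have "T \<inter> {1..c + 1} = T \<inter> {1..c}" by (simp only: Int_insert_right if_False)
      then have "card (T \<inter> {1..c + 1}) = card (P \<inter> {1..c + 1})" using card P1 by simp
      then have e: "even (card (H (c + 1) - P) + card (H (c + 1) - T))"
        by (rule equal_counts_even[OF c' HP' HT'])
      have "H c - T = insert (c + 1) (H (c + 1) - T)" unfolding Hc using False by auto
      then have "card (H c - T) = card (H (c + 1) - T) + 1" by simp
      then show ?thesis using e par HcP by simp
    qed
  next
    case False
    then have cn: "c = n" using c by simp
    have Hn: "H n = {n + 1}" by auto
    have nP: "n + 1 \<in> P" using cP cn by simp
    have nT: "n + 1 \<in> T"
    proof (rule ccontr)
      assume "n + 1 \<notin> T"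
      then have "H n - T = {n + 1}" "H n - P = {}" using Hn nP by auto
      then show False using par cn by simp
    qed
    have "lagr n (H n)" by (rule lagrangian_indices_half) simp
    moreover have "odd (card (H n \<inter> H n) + card (H n - T))" using Hn nT by simp
    ultimately have "card (T \<inter> {N - n + 1..N}) + 1 \<le> vec.dim (S \<inter> E ({N - n + 1..N} \<union> {n + 1}))"
      using family_T[of n "H n"] HT cn Hn by simp
    moreover have "card (P \<inter> {1..n + 1}) \<le> vec.dim (S \<inter> E {1..n + 1})"
      by (rule dim_initial) (simp add: N_even)
    ultimately have ge: "vec.dim S \<le> vec.dim (S \<inter> E {1..n + 1}) + vec.dim (S \<inter> E ({N - n + 1..N} \<union> {n + 1}))"
      using card_T_split(1)[OF c HT] card P1 dim_S cn by simp
    \<comment> \<open>Both index sets omit \<open>n + 2\<close> and share only \<open>n + 1\<close>: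
      either \<open>S\<close> is the sum of the two parts, or it contains \<open>e (n + 1)\<close>,
      whose pairing reads off coordinate \<open>n + 2\<close>.\<close>
    have cap: "{1..n + 1} \<inter> ({N - n + 1..N} \<union> {n + 1}) = {n + 1}" using N_even by auto
    have n1: "n + 1 \<in> {1..N}" "n + 2 \<in> {1..N}" "N - c = n + 2" "N + 1 - (n + 1) = n + 2"
      using N_even cn by auto
    show ?thesis
    proof (cases "vec.dim (S \<inter> E {n + 1}) = 0")
      case True
      then have "vec.dim S + vec.dim (S \<inter> E ({1..n + 1} \<inter> ({N - n + 1..N} \<union> {n + 1})))
          \<le> vec.dim (S \<inter> E {1..n + 1}) + vec.dim (S \<inter> E ({N - n + 1..N} \<union> {n + 1}))"
        unfolding cap using ge by linarith
      then obtain y z where yz: "y \<in> E {1..n + 1}" "z \<in> E ({N - n + 1..N} \<union> {n + 1})" "x = y + z"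
        by (rule split_if_dim[OF subspace_S _ x])
      have "coord e (n + 2) y = 0" by (rule mem_E_D[OF yz(1) n1(2)]) simp
      moreover have "coord e (n + 2) z = 0" by (rule mem_E_D[OF yz(2) n1(2)]) (simp add: N_even)
      ultimately show ?thesis unfolding n1(3) yz(3) by (simp add: coord_add)
    next
      case False
      then have "0 < vec.dim (S \<inter> E {n + 1})" by linarith
      then obtain w where "w \<in> S" "w \<in> E {n + 1}" "w \<noteq> 0"
        using exists_nonzero_if_dim_pos by blast
      then show ?thesis using pt.coord_bar_eq_0_if_line[OF _ _ _ n1(1) x] n1(3,4) by simp
    qed
  qed
qed

text \<open>On the middle pair the wrong-parity set for \<open>P\<close> is \<open>{n + 2}\<close>;
  its family condition says that the dimension counted on \<open>{1..n + 2}\<close> is reached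
  without column \<open>n + 1\<close>. With \<open>n + 1 \<in> T\<close>, this and the condition for
  \<open>T\<close> would together exceed \<open>vec.dim S\<close>, which excludes the other kind of
  lone star at this cut.\<close>

lemma middle_lone_star_P:
  assumes nP: "n + 2 \<in> P" and ge: "m \<le> card (P \<inter> {1..n + 2}) + card (T \<inter> {n + 2..N})"
  shows "x \<in> S \<Longrightarrow> coord e (n + 1) x = 0" and "n + 1 \<notin> T"
proof -
  have n1: "n + 1 \<in> {1..N}" "n + 2 \<in> {1..N}" "N - n + 1 = n + 3" "N + 1 - (n + 2) = n + 1"
    using N_even by auto
  have Hn: "H n = {n + 1}" by auto
  have n1P: "n + 1 \<notin> P"
  proof
    assume "n + 1 \<in> P"
    then have "(n + 1) + (n + 2) \<noteq> N + 1" using P_symbol nP by blast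
    then show False using N_even by simp
  qed
  have "H n \<subseteq> sym_hull N P" using nP N_even by (auto simp: sym_hull_def Hn)
  moreover have "lagr n {n + 2}"
    by (rule lagrangian_indicesI) auto
  moreover have "{n + 2} \<inter> H n = {}" "H n - P = {n + 1}" using Hn n1P by auto
  then have "odd (card ({n + 2} \<inter> H n) + card (H n - P))" by simp
  ultimately have "card (P \<inter> {1..n}) + 1 \<le> vec.dim (S \<inter> E ({1..n} \<union> {n + 2}))"
    using family_P[of n "{n + 2}"] by blast
  moreover have "{1..n + 2} = insert (n + 2) (insert (n + 1) {1..n})" by auto
  then have "P \<inter> {1..n + 2} = insert (n + 2) (P \<inter> {1..n})" using nP n1P by blast
  then have "card (P \<inter> {1..n + 2}) = card (P \<inter> {1..n}) + 1" by simp
  ultimately have dP: "card (P \<inter> {1..n + 2}) \<le> vec.dim (S \<inter> E ({1..n} \<union> {n + 2}))" by simp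
  show "coord e (n + 1) x = 0" if x: "x \<in> S"
  proof -
    have "card (T \<inter> {n + 2..N}) \<le> vec.dim (S \<inter> E {n + 2..N})"
      using dim_final[of "n + 1"] N_even by (simp add: add.assoc)
    then have dS: "vec.dim S \<le> vec.dim (S \<inter> E ({1..n} \<union> {n + 2})) + vec.dim (S \<inter> E {n + 2..N})"
      using dP ge dim_S by linarith
    have cap: "({1..n} \<union> {n + 2}) \<inter> {n + 2..N} = {n + 2}" using N_even by auto
    show ?thesis
    proof (cases "vec.dim (S \<inter> E {n + 2}) = 0")
      case True
      then have "vec.dim S + vec.dim (S \<inter> E (({1..n} \<union> {n + 2}) \<inter> {n + 2..N}))
          \<le> vec.dim (S \<inter> E ({1..n} \<union> {n + 2})) + vec.dim (S \<inter> E {n + 2..N})"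
        unfolding cap using dS by linarith
      then obtain y z where yz: "y \<in> E ({1..n} \<union> {n + 2})" "z \<in> E {n + 2..N}" "x = y + z"
        by (rule split_if_dim[OF subspace_S _ x])
      have "coord e (n + 1) y = 0" by (rule mem_E_D[OF yz(1) n1(1)]) simp
      moreover have "coord e (n + 1) z = 0" by (rule mem_E_D[OF yz(2) n1(1)]) simp
      ultimately show ?thesis unfolding yz(3) by (simp add: coord_add)
    next
      case False
      then have "0 < vec.dim (S \<inter> E {n + 2})" by linarith
      then obtain w where "w \<in> S" "w \<in> E {n + 2}" "w \<noteq> 0"
        using exists_nonzero_if_dim_pos by blast
      then show ?thesis using pt.coord_bar_eq_0_if_line[OF _ _ _ n1(2) x] n1(4) by simp
    qed
  qed
  show "n + 1 \<notin> T"
  proof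
    assume nT: "n + 1 \<in> T"
    have n2T: "n + 2 \<notin> T"
    proof
      assume "n + 2 \<in> T"
      then have "(n + 1) + (n + 2) \<noteq> N + 1" using T_symbol nT by blast
      then show False using N_even by simp
    qed
    have "H n \<subseteq> sym_hull N T" using nT by (auto simp: sym_hull_def Hn)
    moreover have "lagr n (H n)" by (rule lagrangian_indices_half) simp
    moreover have "odd (card (H n \<inter> H n) + card (H n - T))" using Hn nT by simp
    ultimately have dT: "card (T \<inter> {n + 3..N}) + 1 \<le> vec.dim (S \<inter> E ({n + 3..N} \<union> {n + 1}))"
      using family_T[of n "H n"] Hn n1(3) by simp
    have "T \<inter> {n + 2..N} = T \<inter> {n + 3..N}"
    proof (intro equalityI subsetI)
      fix i assume "i \<in> T \<inter> {n + 2..N}"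
      then have "i \<noteq> n + 2" "i \<in> T \<inter> {n + 2..N}" using n2T by auto
      then show "i \<in> T \<inter> {n + 3..N}" by auto
    qed auto
    then have "vec.dim S < vec.dim (S \<inter> E ({1..n} \<union> {n + 2})) + vec.dim (S \<inter> E ({n + 3..N} \<union> {n + 1}))"
      using dP dT ge dim_S by simp
    moreover have "({1..n} \<union> {n + 2}) \<inter> ({n + 3..N} \<union> {n + 1}) \<inter> {1..N} = {}" by auto
    ultimately show False using dim_Int_E_disjoint_le[OF subspace_S] by (metis not_le)
  qed
qed

text \<open>The last two equations are the first two for the reversed basis, where column
  \<open>c\<close> becomes \<open>N + 1 - c\<close> and \<open>P\<close>, \<open>T\<close> become
  the reflections of \<open>T\<close>, \<open>P\<close>.\<close>

lemma exceptional_lone_stars: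
  assumes c1: "1 \<le> c" and c: "c \<le> n" and HP: "H c \<subseteq> sym_hull N P" and HT: "H c \<subseteq> sym_hull N T"
    and card: "card (T \<inter> {1..c}) = card (P \<inter> {1..c}) + 1"
    and par: "even (card (H c - P) + card (H c - T))" and x: "x \<in> S"
  shows "c \<in> T \<Longrightarrow> coord e (N + 1 - c) x = 0" "c + 1 \<in> P \<Longrightarrow> coord e (N - c) x = 0"
    "N - c \<in> T \<Longrightarrow> coord e (c + 1) x = 0" "N - c + 1 \<in> P \<Longrightarrow> coord e c x = 0"
proof -
  let ?b = "\<lambda>i. N + 1 - i"
  interpret r: split_richardson "\<lambda>i. e (N + 1 - i)" N n \<omega> m S "?b ` T" "?b ` P"
    by (rule split_richardson_rev)
  show "coord e (N + 1 - c) x = 0" if "c \<in> T" by (rule lone_star_T[OF c1 c HP HT card par that x])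
  show "coord e (N - c) x = 0" if "c + 1 \<in> P" by (rule lone_star_P[OF c HP HT card par that x])
  have cN: "c \<le> N" "c \<in> {1..N}" "c + 1 \<in> {1..N}" using c c1 N_even by auto
  have rP: "H c \<subseteq> sym_hull N (?b ` P)" and rT: "H c \<subseteq> sym_hull N (?b ` T)"
    using HP HT sym_hull_image_bar[OF P_subset] sym_hull_image_bar[OF T_subset] by simp_all
  \<comment> \<open>Both symbols have equally many indices in the middle range, so the off-by-one on
    \<open>{1..c}\<close> reappears with opposite sign on the final segment, and exchanging
    \<open>P\<close> and \<open>T\<close> restores it.\<close>
  have rcard: "card (?b ` P \<inter> {1..c}) = card (?b ` T \<inter> {1..c}) + 1"
    using card_P_split[OF c HP] card_T_split(1)[OF c HT] card
      card_image_bar_initial[OF P_subset cN(1)] card_image_bar_initial[OF T_subset cN(1)] by linarith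
  have "card (H c - P) \<le> n + 1 - c" "card (H c - T) \<le> n + 1 - c"
    using card_mono[of "H c" "H c - P"] card_mono[of "H c" "H c - T"] by auto
  then have "(card (H c - ?b ` T) + card (H c - ?b ` P)) + (card (H c - P) + card (H c - T)) = 2 * (n + 1 - c)"
    using card_half_Diff_image_bar[OF P_symbol P_subset HP] card_half_Diff_image_bar[OF T_symbol T_subset HT]
    by linarith
  then have rpar: "even (card (H c - ?b ` T) + card (H c - ?b ` P))"
    using par by (metis dvd_triv_left even_add)
  show "coord e c x = 0" if "N - c + 1 \<in> P"
  proof -
    have eq: "N + 1 - c = N - c + 1" "N + 1 - (N + 1 - c) = c" using cN by auto
    have "c \<in> ?b ` P" unfolding image_bar_iff[OF P_subset cN(2)] eq(1) by (rule that)
    from r.lone_star_T[OF c1 c rT rP rcard rpar this x]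
    show ?thesis unfolding coord_rev eq(2) .
  qed
  show "coord e (c + 1) x = 0" if "N - c \<in> T"
  proof -
    have eq: "N + 1 - (c + 1) = N - c" "N + 1 - (N - c) = c + 1" using cN by auto
    have "c + 1 \<in> ?b ` T" unfolding image_bar_iff[OF T_subset cN(3)] eq(1) by (rule that)
    from r.lone_star_P[OF c rT rP rcard rpar this x]
    show ?thesis unfolding coord_rev eq(2) .
  qed
qed

text \<open>Reversal of \<open>middle_lone_star_P\<close>; the reflection exchanges the two middle
  columns.\<close>

lemma middle_lone_star_T:
  assumes nT: "n + 1 \<in> T" and ge: "m \<le> card (P \<inter> {1..n + 1}) + card (T \<inter> {n + 1..N})"
  shows "x \<in> S \<Longrightarrow> coord e (n + 2) x = 0" and "n + 2 \<notin> P"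
proof -
  let ?b = "\<lambda>i. N + 1 - i"
  interpret r: split_richardson "\<lambda>i. e (N + 1 - i)" N n \<omega> m S "?b ` T" "?b ` P"
    by (rule split_richardson_rev)
  have n1: "n + 1 \<in> {1..N}" "n + 2 \<in> {1..N}" "N + 1 - (n + 1) = n + 2" "N + 1 - (n + 2) = n + 1"
    "N - (n + 2) + 1 = n + 1" "N - (n + 1) = n + 1" "n + 2 \<le> N" "n + 1 \<le> N"
    using N_even by auto
  have "card (?b ` T \<inter> {1..n + 2}) = card (T \<inter> {n + 1..N})"
    using card_image_bar_initial[OF T_subset n1(7)] n1(5) by simp
  moreover have "card (?b ` P \<inter> {n + 2..N}) = card (P \<inter> {1..n + 1})"
    using card_image_bar_final[OF P_subset n1(8)] n1(6) by (simp add: add.assoc)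
  moreover have "n + 2 \<in> ?b ` T" using image_bar_iff[OF T_subset n1(2)] nT n1(4) by simp
  ultimately have *: "n + 2 \<in> ?b ` T" "m \<le> card (?b ` T \<inter> {1..n + 2}) + card (?b ` P \<inter> {n + 2..N})"
    using ge by simp_all
  show "coord e (n + 2) x = 0" if "x \<in> S"
    using r.middle_lone_star_P(1)[OF * that] n1(3) by (simp add: coord_rev)
  show "n + 2 \<notin> P"
    using r.middle_lone_star_P(2)[OF *] image_bar_iff[OF P_subset n1(1)] n1(3) by simp
qed

end

section \<open>The defining equations\<close>

lemma bilinear_formD:
  assumes "bilinear_form \<omega>"
  shows "\<omega> (x + y) z = \<omega> x z + \<omega> y z" "\<omega> (a *s x) z = a * \<omega> x z"
    "\<omega> z (x + y) = \<omega> z x + \<omega> z y" "\<omega> z (a *s x) = a * \<omega> z x"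
  using assms
  by (auto simp: bilinear_form_def Vector_Spaces.linear_def module_hom_def module_hom_axioms_def)

lemma bilinear_form_sum:
  assumes "bilinear_form \<omega>" "finite A"
  shows "\<omega> (\<Sum>i\<in>A. u i) z = (\<Sum>i\<in>A. \<omega> (u i) z)" "\<omega> z (\<Sum>i\<in>A. u i) = (\<Sum>i\<in>A. \<omega> z (u i))"
proof -
  have "\<omega> 0 z = 0" "\<omega> z 0 = 0"
    using bilinear_formD(2)[OF assms(1), of 0 0 z] bilinear_formD(4)[OF assms(1), of z 0 0] by simp_all
  note zero = this
  show "\<omega> (\<Sum>i\<in>A. u i) z = (\<Sum>i\<in>A. \<omega> (u i) z)"
    using assms(2) by (induction A rule: finite_induct) (auto simp: bilinear_formD[OF assms(1)] zero)
  show "\<omega> z (\<Sum>i\<in>A. u i) = (\<Sum>i\<in>A. \<omega> z (u i))"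
    using assms(2) by (induction A rule: finite_induct) (auto simp: bilinear_formD[OF assms(1)] zero)
qed

lemma form_of_type_symmetric:
  "form_of_type ty \<omega> \<Longrightarrow> ty \<noteq> TypeC \<Longrightarrow> \<omega> x y = \<omega> y x"
  by (induction ty) (unfold form_of_type.simps, blast+)

lemma form_of_type_alternating: "form_of_type TypeC \<omega> \<Longrightarrow> \<omega> x y = - \<omega> y x"
  unfolding form_of_type.simps by blast

context coordinates
begin

text \<open>\<open>adapted_basis\<close> fixes the form only for \<open>i \<le> j\<close>; symmetry
  up to sign supplies the rest of the Gram matrix, which is nonzero exactly on the
  antidiagonal.\<close>

lemma paired_form_if_adapted:
  assumes bil: "bilinear_form \<omega>" and ad: "adapted_basis \<omega> e" and type: "form_of_type ty \<omega>"
  shows "paired_form e N \<omega> (\<lambda>i. \<omega> (e i) (e (N + 1 - i)))"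
proof -
  have e1: "\<omega> (e i) (e j) = (if i + j = N + 1 then 1 else 0)"
    if "i \<in> {1..N}" "j \<in> {1..N}" "i \<le> j" for i j
    using ad that unfolding adapted_basis_def N_eq[symmetric] by blast
  have sw: "\<omega> x y = \<omega> y x \<or> \<omega> x y = - \<omega> y x" for x y
    using form_of_type_symmetric[OF type] form_of_type_alternating[of \<omega>] type
    by (cases "ty = TypeC") blast+
  have e0: "\<omega> (e i) (e j) = 0" if ij: "i \<in> {1..N}" "j \<in> {1..N}" "i + j \<noteq> N + 1" for i j
  proof (cases "i \<le> j")
    case True
    then show ?thesis using e1[OF ij(1,2)] ij(3) by simp
  next
    case False
    then have "\<omega> (e j) (e i) = 0" using e1[OF ij(2,1)] ij(3) by simp
    then show ?thesis using sw[of "e i" "e j"] by simp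
  qed
  have row: "(\<Sum>j\<in>{1..N}. coord e j y * \<omega> (e i) (e j)) = coord e (N + 1 - i) y * \<omega> (e i) (e (N + 1 - i))"
    if i: "i \<in> {1..N}" for i y
  proof -
    have "(\<Sum>j\<in>{1..N}. coord e j y * \<omega> (e i) (e j))
        = (\<Sum>j\<in>{1..N}. if j = N + 1 - i then coord e j y * \<omega> (e i) (e j) else 0)"
    proof (rule sum.cong)
      fix j assume j: "j \<in> {1..N}"
      have "i + j = N + 1 \<longleftrightarrow> j = N + 1 - i" using i by auto
      then show "coord e j y * \<omega> (e i) (e j) = (if j = N + 1 - i then coord e j y * \<omega> (e i) (e j) else 0)"
        using e0[OF i j] by simp
    qed simp
    also have "\<dots> = coord e (N + 1 - i) y * \<omega> (e i) (e (N + 1 - i))"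
      using bar_mem[OF i] by (simp only: sum.delta finite_atLeastAtMost if_True)
    finally show ?thesis .
  qed
  have bar: "i + (N + 1 - i) = N + 1" "N + 1 - i + i = N + 1" if "i \<in> {1..N}" for i
    using that by auto
  show ?thesis
  proof unfold_locales
    fix x y
    have "\<omega> x y = \<omega> (\<Sum>i\<in>{1..N}. coord e i x *s e i) (\<Sum>j\<in>{1..N}. coord e j y *s e j)"
      by (simp only: coord_expansion)
    also have "\<dots> = (\<Sum>i\<in>{1..N}. coord e i x * (\<Sum>j\<in>{1..N}. coord e j y * \<omega> (e i) (e j)))"
      by (simp only: bilinear_form_sum(1)[OF bil finite_atLeastAtMost] bilinear_formD(2)[OF bil])
        (simp only: bilinear_form_sum(2)[OF bil finite_atLeastAtMost] bilinear_formD(4)[OF bil])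
    also have "\<dots> = (\<Sum>i\<in>{1..N}. \<omega> (e i) (e (N + 1 - i)) * (coord e i x * coord e (N + 1 - i) y))"
      by (rule sum.cong) (simp_all only: row mult_ac)
    finally show "\<omega> x y = (\<Sum>i\<in>{1..N}. \<omega> (e i) (e (N + 1 - i)) * (coord e i x * coord e (N + 1 - i) y))" .
  next
    fix i assume i: "i \<in> {1..N}"
    show "\<omega> (e i) (e (N + 1 - i)) = 1" if "2 * i \<le> N + 1"
      using e1[OF i bar_mem[OF i]] bar(1)[OF i] that by simp
    show "\<omega> (e i) (e (N + 1 - i)) \<noteq> 0"
    proof (cases "i \<le> N + 1 - i")
      case True
      then show ?thesis using e1[OF i bar_mem[OF i]] bar(1)[OF i] by simp
    next
      case False
      then have "\<omega> (e (N + 1 - i)) (e i) = 1" using e1[OF bar_mem[OF i] i] bar(2)[OF i] by simp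
      then show ?thesis using sw[of "e i" "e (N + 1 - i)"] by auto
    qed
  qed
qed

end

text \<open>In the applications the middle range is a single index in type \<open>B\<close> and
  empty in type \<open>D\<close>.\<close>

lemma sum_symmetric_pairs:
  fixes f :: "nat \<Rightarrow> complex"
  assumes "\<And>i. 1 \<le> i \<Longrightarrow> i \<le> k \<Longrightarrow> f (N + 1 - i) = f i" and "2 * k \<le> N"
  shows "(\<Sum>i\<in>{1..N}. f i) = 2 * (\<Sum>i\<in>{1..k}. f i) + (\<Sum>i\<in>{k + 1..N - k}. f i)"
proof -
  have top: "(\<Sum>i\<in>{N - k + 1..N}. f i) = (\<Sum>i\<in>{1..k}. f i)"
    by (rule sum.reindex_bij_witness[of _ "\<lambda>i. N + 1 - i" "\<lambda>i. N + 1 - i", symmetric])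
      (use assms in auto)
  have "{1..N} = ({1..k} \<union> {k + 1..N - k}) \<union> {N - k + 1..N}" using assms(2) by auto
  then have "sum f {1..N} = sum f (({1..k} \<union> {k + 1..N - k}) \<union> {N - k + 1..N})" by simp
  also have "\<dots> = (sum f {1..k} + sum f {k + 1..N - k}) + sum f {N - k + 1..N}"
    using assms(2) by (subst sum.union_disjoint, auto)+
  finally show ?thesis using top by simp
qed

section \<open>Exceptional cuts as counts and parities\<close>

context split_richardson
begin

text \<open>As \<open>n + 1\<close> lies in both hulls, both types are parities. Differing parities
  over \<open>{1..n + 1}\<close> and counts differing by one over \<open>{1..c}\<close> cancel,
  which leaves equal parities on \<open>H c\<close>.\<close>

lemma family_parity:
  assumes c: "c \<le> n" and HP: "H c \<subseteq> sym_hull N P" and HT: "H c \<subseteq> sym_hull N T"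
    and type: "symbol_type n T \<noteq> symbol_type n P"
    and card: "card (T \<inter> {1..c}) = card (P \<inter> {1..c}) + 1"
  shows "even (card (H c - P) + card (H c - T))"
proof -
  have split: "card ({1..n + 1} - Q) + card (Q \<inter> {1..c}) = c + card (H c - Q)" for Q
  proof -
    have "{1..n + 1} - Q = ({1..c} - Q) \<union> (H c - Q)" using c by auto
    moreover have "card (({1..c} - Q) \<union> (H c - Q)) = card ({1..c} - Q) + card (H c - Q)"
      by (rule card_Un_disjoint) auto
    moreover have "card ({1..c} - Q) + card (Q \<inter> {1..c}) = c"
      using card_Int_Diff[of "{1..c}" Q] by (simp add: Int_commute)
    ultimately show ?thesis by simp
  qed
  have "n + 1 \<in> H c" using c by auto
  then have "n + 1 \<in> sym_hull (2 * n + 2) P" "n + 1 \<in> sym_hull (2 * n + 2) T"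
    using HP HT N_even by auto
  then have "card ({1..n + 1} - T) mod 2 \<noteq> card ({1..n + 1} - P) mod 2"
    using type by (simp add: symbol_type_def)
  then show ?thesis using split[of P] split[of T] card by presburger
qed

lemma exceptional_cut2_cases:
  assumes d: "d \<in> exceptional_cuts2 n P T"
  obtains c where "1 \<le> c" "c \<le> n" "H c \<subseteq> sym_hull N P" "H c \<subseteq> sym_hull N T"
    "card (T \<inter> {1..c}) = card (P \<inter> {1..c}) + 1" "even (card (H c - P) + card (H c - T))"
    "d = c \<or> d = N - c"
proof -
  obtain c where c: "c \<in> {1..n}" "symbol_type n T \<noteq> symbol_type n P"
    "H c \<subseteq> sym_hull N P \<inter> sym_hull N T" "card (T \<inter> {1..c}) = card (P \<inter> {1..c}) + 1"
    "d = c \<or> d = N - c"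
    using d unfolding exceptional_cuts2_def Let_def N_even[symmetric] by blast
  then show thesis using that[of c] family_parity[of c] by auto
qed

end

context richardson_point
begin

text \<open>The shared middle column is counted on both sides, so a bound by \<open>m\<close> is one
  less than the overlap demanded in \<open>coord_bar_eq_0_if_card\<close>; the family conditions on
  the middle pair make up for it.\<close>

lemma exceptional_cut1_cases:
  assumes N: "N = 2 * n + 2" and d: "d \<in> exceptional_cuts1 n m P T"
  obtains "d = n + 1" "n + 2 \<in> P" "m \<le> card (P \<inter> {1..n + 2}) + card (T \<inter> {n + 2..N})"
  | "d = n + 1" "n + 1 \<in> T" "m \<le> card (P \<inter> {1..n + 1}) + card (T \<inter> {n + 1..N})"
proof -
  have fin: "finite P" "finite T" using P_subset T_subset finite_subset by blast+
  obtain i where i: "1 \<le> i" "i \<le> m" "d = n + 1"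
    "entry N P i = n + 2 \<and> n + 2 \<le> entry N T (i + 1) \<or> entry N T i = n + 1 \<and> entry N P (i - 1) \<le> n + 1"
    using d unfolding exceptional_cuts1_def Let_def N[symmetric] by auto
  from i(4) show thesis
  proof
    assume *: "entry N P i = n + 2 \<and> n + 2 \<le> entry N T (i + 1)"
    have "n + 2 \<in> P" using entry_mem[OF fin(1) i(1), of N] i(2) card_P * by simp
    moreover have "i \<le> card (P \<inter> {1..n + 2})"
      by (rule card_ge_if_entry_le[OF P_subset]) (use * i(2) card_P in auto)
    moreover have "m \<le> i + card (T \<inter> {n + 1 + 1..N})"
      by (rule card_final_ge) (use * i(2) N in auto)
    ultimately show thesis using that(1) i(3) by (simp add: add.assoc)
  next
    assume *: "entry N T i = n + 1 \<and> entry N P (i - 1) \<le> n + 1"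
    have "n + 1 \<in> T" using entry_mem[OF fin(2) i(1), of N] i(2) card_T * by simp
    moreover have "i - 1 \<le> card (P \<inter> {1..n + 1})"
      by (rule card_ge_if_entry_le[OF P_subset]) (use * i(2) card_P in auto)
    moreover have "m \<le> (i - 1) + card (T \<inter> {n + 1..N})"
      by (rule card_final_ge) (use * i(1,2) N in auto)
    ultimately show thesis using that(2) i(3) by linarith
  qed
qed

end

theorem proposition5p2:
  fixes \<omega> :: "complex^'k \<Rightarrow> complex^'k \<Rightarrow> complex"
    and e :: "nat \<Rightarrow> complex^'k"
    and ty :: lie_type
    and n m :: nat
    and P T :: "nat set"
  assumes "CARD('k) \<ge> 2"
    and "CARD('k) = ambient_dim ty n"
    and "bilinear_form \<omega>"
    and "nondegenerate \<omega>"
    and "form_of_type ty \<omega>"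
    and "adapted_basis \<omega> e"
    and "1 \<le> m"
    and "2 * m \<le> CARD('k)"
    and "P \<in> schubert_symbols (CARD('k)) m"
    and "T \<in> schubert_symbols (CARD('k)) m"
    and "bruhat_le \<omega> e m T P"
  shows "line_projection \<omega> m (richardson_variety \<omega> e m P T) \<subseteq> Z_locus ty n e m P T"
proof
  fix L assume "L \<in> line_projection \<omega> m (richardson_variety \<omega> e m P T)"
  then obtain S where L: "L \<in> projective_space" "L \<subseteq> S"
    and SG: "S \<in> isotropic_grassmannian \<omega> m"
    and SP: "S \<in> schubert_variety \<omega> e m P" and ST: "S \<in> opposite_schubert_variety \<omega> e m T"
    unfolding line_projection_def incidence_variety_def richardson_variety_def by auto
  define N where "N = CARD('k)"
  have N_dim: "N = ambient_dim ty n" using assms(2) by (simp add: N_def)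
  interpret coordinates e N
    by unfold_locales (use assms(6) in \<open>auto simp: N_def adapted_basis_def\<close>)
  have S: "vec.subspace S" "vec.dim S = m" "\<And>x y. x \<in> S \<Longrightarrow> y \<in> S \<Longrightarrow> \<omega> x y = 0"
    using SG by (auto simp: isotropic_grassmannian_def)
  have P: "P \<subseteq> {1..N}" "card P = m" "\<forall>c\<in>P. \<forall>d\<in>P. c + d \<noteq> N + 1"
    and T: "T \<subseteq> {1..N}" "card T = m" "\<forall>c\<in>T. \<forall>d\<in>T. c + d \<noteq> N + 1"
    using assms(9,10) by (auto simp: schubert_symbols_def N_def)
  let ?g = "\<lambda>i. \<omega> (e i) (e (N + 1 - i))"
  interpret paired_form e N \<omega> ?g
    by (rule paired_form_if_adapted[OF assms(3,6,5)])
  interpret richardson_point e N \<omega> ?g S m P T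
    by unfold_locales (use S P T schubert_variety_rank[OF SP] opposite_schubert_variety_rank[OF ST] in auto)
  have D: "split_richardson e N n \<omega> m S P T" if ty: "ty = TypeD"
  proof -
    have N2: "N = 2 * n + 2" using N_dim ty by simp
    have sym: "\<omega> x y = \<omega> y x" for x y 
      using form_of_type_symmetric[OF assms(5)] ty by blast
    \<comment> \<open>Symmetry makes the weights of the second half equal to those of the
      first.\<close>
    have g1: "?g i = 1" if i: "i \<in> {1..N}" for i
    proof (cases "2 * i \<le> N + 1")
      case True
      then show ?thesis by (rule weight_eq_1[OF i])
    next
      case False
      have "?g i = ?g (N + 1 - i)" using i sym[of "e i"] by simp
      also have "\<dots> = 1" by (rule weight_eq_1) (use i False in auto)
      finally show ?thesis .
    qed
    interpret split_quadric e N n \<omega>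
    proof
      show "N = 2 * n + 2" by (rule N2)
      have "(\<Sum>i\<in>{1..N}. ?g i * (coord e i x * coord e (N + 1 - i) y))
          = (\<Sum>i\<in>{1..N}. coord e i x * coord e (N + 1 - i) y)" for x y
        by (rule sum.cong) (simp_all only: g1 mult_1)
      then show "\<omega> x y = (\<Sum>i\<in>{1..N}. coord e i x * coord e (N + 1 - i) y)" for x y
        by (rule trans[OF paired])
    qed
    show ?thesis
      by unfold_locales
        (use S P T schubert_variety_flag_conditions[OF P(3) SP]
          opposite_schubert_variety_flag_conditions[OF T(3,1) ST] in auto)
  qed
  have cuts: "cuts ty n m P T = apparent_cuts N m P T
      \<union> (if ty = TypeD then exceptional_cuts1 n m P T \<union> exceptional_cuts2 n P T else {})"
    by (simp add: cuts_def N_dim)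
  have n_le: "2 * n \<le> N" using N_dim by (cases ty) auto
  have quad: "quadric ty n e c x = 0" if c: "c \<in> quadratic_indices ty n m P T" and x: "x \<in> S" for c x
  proof (cases "c \<le> n")
    case True
    have q: "quadric ty n e c x = (\<Sum>i\<in>{1..c}. coord e i x * coord e (N + 1 - i) x)"
      using True by (simp add: quadric_def N_def)
    have "c \<in> cuts ty n m P T" using c True by (auto simp: quadratic_indices_def split: if_splits)
    then consider "c \<in> apparent_cuts N m P T" | "ty = TypeD" "c \<in> exceptional_cuts1 n m P T"
      | "ty = TypeD" "c \<in> exceptional_cuts2 n P T"
      unfolding cuts by (auto split: if_splits)
    then show ?thesis
    proof cases
      case 1
      then show ?thesis unfolding q using apparent_quadric[OF _ 1 x] True n_le by simp
    next
      case 2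
      \<comment> \<open>The only candidate is \<open>n + 1\<close>, outside the present
        range.\<close>
      then show ?thesis using True by (auto simp: exceptional_cuts1_def Let_def)
    next
      case 3
      interpret D: split_richardson e N n \<omega> m S P T by (rule D[OF 3(1)])
      obtain d where d: "1 \<le> d" "d \<le> n" "{d + 1..n + 1} \<subseteq> sym_hull N P" "{d + 1..n + 1} \<subseteq> sym_hull N T"
        "card (T \<inter> {1..d}) = card (P \<inter> {1..d}) + 1"
        "even (card ({d + 1..n + 1} - P) + card ({d + 1..n + 1} - T))" "c = d \<or> c = N - d"
        by (rule D.exceptional_cut2_cases[OF 3(2)])
      \<comment> \<open>\<open>N - d\<close> exceeds \<open>n\<close>, so only \<open>d\<close>
        itself can occur.\<close>
      have "c = d" using d(2,7) True D.N_even by auto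
      then show ?thesis unfolding q using D.exceptional_quadric[OF d(2-6) x] by simp
    qed
  next
    case False
    \<comment> \<open>The remaining quadric is half of \<open>\<omega> x x\<close>, which vanishes
      because \<open>x\<close> lies in the isotropic \<open>S\<close>.\<close>
    then have c: "c = n + 1" and ty: "ty = TypeB \<or> ty = TypeD"
      using c by (cases ty; auto simp: quadratic_indices_def split: if_splits)+
    have sym: "\<omega> x y = \<omega> y x" for x y
      using form_of_type_symmetric[OF assms(5)] ty by blast
    let ?f = "\<lambda>i. ?g i * (coord e i x * coord e (N + 1 - i) x)"
    have f1: "?f i = coord e i x * coord e (N + 1 - i) x" if "1 \<le> i" "2 * i \<le> N + 1" for i
      using weight_eq_1[of i] that by simp
    have fs: "?f (N + 1 - i) = ?f i" if "1 \<le> i" "i \<le> N" for i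
      using that sym[of "e i"] by (simp add: mult_ac)
    have w: "(\<Sum>i\<in>{1..N}. ?f i) = 0" by (rule trans[OF paired[symmetric] S(3)[OF x x]])
    show ?thesis
    proof (cases "ty = TypeB")
      case True
      then have N: "N = 2 * n + 1" using N_dim by simp
      let ?Q = "\<Sum>i\<in>{1..n}. coord e i x * coord e (N + 1 - i) x"
      have sum: "(\<Sum>i\<in>{1..N}. ?f i) = 2 * (\<Sum>i\<in>{1..n}. ?f i) + (\<Sum>i\<in>{n + 1..N - n}. ?f i)"
        by (rule sum_symmetric_pairs) (use fs N in auto)
      \<comment> \<open>The middle index is its own partner and occurs only once in
        \<open>\<omega> x x\<close>, whence the factor \<open>1 / 2\<close> after halving.\<close>
      have "{n + 1..N - n} = {n + 1}" using N by auto
      then have "(\<Sum>i\<in>{n + 1..N - n}. ?f i) = ?f (n + 1)"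
        by (simp only: sum.insert finite.emptyI empty_iff sum.empty add_0_right not_False_eq_True)
      also have "\<dots> = (coord e (n + 1) x)\<^sup>2"
      proof -
        have eq: "N + 1 - (n + 1) = n + 1" using N by simp
        have "1 \<le> n + 1" "2 * (n + 1) \<le> N + 1" using N by auto
        from f1[OF this] show ?thesis unfolding eq power2_eq_square .
      qed
      finally have mid: "(\<Sum>i\<in>{n + 1..N - n}. ?f i) = (coord e (n + 1) x)\<^sup>2" .
      have low: "(\<Sum>i\<in>{1..n}. ?f i) = ?Q"
        by (rule sum.cong) (use f1 N in auto)
      have "2 * ?Q + (coord e (n + 1) x)\<^sup>2 = 0"
        using w unfolding sum mid low .
      then have "?Q + 1 / 2 * (coord e (n + 1) x)\<^sup>2 = 0" by algebra
      then show ?thesis by (simp only: quadric_def N_def[symmetric] True c simp_thms if_True)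
    next
      case False
      then have N: "N = 2 * n + 2" using N_dim ty by auto
      let ?Q = "\<Sum>i\<in>{1..n + 1}. coord e i x * coord e (N + 1 - i) x"
      have sum: "(\<Sum>i\<in>{1..N}. ?f i) = 2 * (\<Sum>i\<in>{1..n + 1}. ?f i) + (\<Sum>i\<in>{n + 1 + 1..N - (n + 1)}. ?f i)"
        by (rule sum_symmetric_pairs) (use fs N in auto)
      have empty: "{n + 1 + 1..N - (n + 1)} = {}" using N by auto
      have low: "(\<Sum>i\<in>{1..n + 1}. ?f i) = ?Q"
        by (rule sum.cong) (use f1 N in auto)
      have "2 * ?Q = 0"
        using w unfolding sum low empty sum.empty add_0_right .
      then have "?Q = 0" by simp
      then show ?thesis using False by (simp only: quadric_def N_def[symmetric] c simp_thms if_False)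
    qed
  qed
  have lin: "coord e c x = 0" if c: "c \<in> linear_indices ty n m P T" and x: "x \<in> S" for c x
  proof -
    have cN: "c \<in> {1..N}" and cases: "zero_column N m P T c \<or> lone_star ty n m P T (N + 1 - c)"
      using c by (auto simp: linear_indices_def N_dim Let_def)
    define d where "d = N + 1 - c"
    have cd: "c = N + 1 - d" "d \<in> {1..N}" using cN by (auto simp: d_def)
    from cases show ?thesis
    proof
      assume "zero_column N m P T c"
      then show ?thesis by (rule zero_column_coord[OF cN _ x])
    next
      assume "lone_star ty n m P T (N + 1 - c)"
      then have star: "d \<in> T \<and> d \<in> cuts ty n m P T \<or> d \<in> P \<and> d - 1 \<in> cuts ty n m P T"
        by (simp add: lone_star_def d_def)
      consider "d \<in> T" "d \<in> apparent_cuts N m P T" | "d \<in> P" "d - 1 \<in> apparent_cuts N m P T"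
        | a where "ty = TypeD" "a \<in> exceptional_cuts1 n m P T" "d \<in> T \<and> d = a \<or> d \<in> P \<and> d - 1 = a"
        | a where "ty = TypeD" "a \<in> exceptional_cuts2 n P T" "d \<in> T \<and> d = a \<or> d \<in> P \<and> d - 1 = a"
        using star unfolding cuts by (auto split: if_splits)
      then show ?thesis
      proof cases
        case 1
        then show ?thesis unfolding cd(1) by (rule apparent_lone_star_T[OF _ _ x])
      next
        case 2
        then show ?thesis unfolding cd(1) by (rule apparent_lone_star_P[OF _ _ x])
      next
        case (3 a)
        interpret D: split_richardson e N n \<omega> m S P T by (rule D[OF 3(1)])
        have N1: "N + 1 - (n + 1) = n + 2" "N + 1 - (n + 2) = n + 1" using D.N_even by auto
        show ?thesis
        proof (rule exceptional_cut1_cases[OF D.N_even 3(2)])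
          assume *: "a = n + 1" "n + 2 \<in> P" "m \<le> card (P \<inter> {1..n + 2}) + card (T \<inter> {n + 2..N})"
          \<comment> \<open>The alternative of a star at \<open>n + 1\<close> in \<open>T\<close> is
            excluded by the second part of \<open>middle_lone_star_P\<close>.\<close>
          then have "d = n + 2" using 3(3) cd(2) D.middle_lone_star_P(2)[OF *(2,3)] by auto
          then show ?thesis using D.middle_lone_star_P(1)[OF *(2,3) x] N1 cd(1) by simp
        next
          assume *: "a = n + 1" "n + 1 \<in> T" "m \<le> card (P \<inter> {1..n + 1}) + card (T \<inter> {n + 1..N})"
          have "d \<noteq> n + 2 \<or> d \<notin> P" using D.middle_lone_star_T(2)[OF *(2,3)] by blast
          moreover have "d = n + 2 \<or> d - 1 \<noteq> n + 1" using cd(2) by auto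
          ultimately have "d = n + 1" using 3(3) *(1) by blast
          then show ?thesis using D.middle_lone_star_T(1)[OF *(2,3) x] N1 cd(1) by simp
        qed
      next
        case (4 a)
        interpret D: split_richardson e N n \<omega> m S P T by (rule D[OF 4(1)])
        obtain b where b: "1 \<le> b" "b \<le> n" "{b + 1..n + 1} \<subseteq> sym_hull N P" "{b + 1..n + 1} \<subseteq> sym_hull N T"
          "card (T \<inter> {1..b}) = card (P \<inter> {1..b}) + 1"
          "even (card ({b + 1..n + 1} - P) + card ({b + 1..n + 1} - T))" "a = b \<or> a = N - b"
          by (rule D.exceptional_cut2_cases[OF 4(2)])
        note stars = D.exceptional_lone_stars[OF b(1-6) x]
        have bN: "b \<le> N" "N + 1 - (b + 1) = N - b" "N + 1 - (N - b) = b + 1" "N + 1 - (N - b + 1) = b"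
          using b(2) D.N_even by auto
        \<comment> \<open>Since \<open>d \<ge> 1\<close>, the subtraction in \<open>d - 1\<close> is
          not truncated.\<close>
        have star': "d \<in> T \<and> d = a \<or> d \<in> P \<and> d = a + 1" using 4(3) cd(2) by auto
        consider "d \<in> T" "d = b" | "d \<in> P" "d = b + 1" | "d \<in> T" "d = N - b" | "d \<in> P" "d = N - b + 1"
          using star' b(7) by blast
        then show ?thesis
        proof cases
          case 1
          then show ?thesis unfolding cd(1) using stars(1) by simp
        next
          case 2
          then show ?thesis unfolding cd(1) using stars(2) bN(2) by simp
        next
          case 3
          then show ?thesis unfolding cd(1) using stars(3) bN(3) by simp
        next
          case 4
          then show ?thesis unfolding cd(1) using stars(4) bN(4) by simp
        qed
      qed
    qed
  qed
  show "L \<in> Z_locus ty n e m P T"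
    unfolding Z_locus_def using L quad lin by blast
qed

end
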